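(* Let $H$ be a connected graph such that $J_H$ is unmixed, let $v\notin V(H)$, and let $G=\operatorname{cone}(v,H)$. Then the following conditions are equivalent: (a) $H$ is a complete graph; (b) $J_G$ is unmixed. If the equivalent conditions hold, then $J_G$ is Cohen-Macaulay.
   Context: All graphs are finite and simple. For a graph $H$ and $v\notin V(H)$, $\operatorname{cone}(v,H)$ is the graph with vertex set $V(H)\cup\{v\}$ and edge set $E(H)\cup\{\{u,v\}:u\in V(H)\}$. Let $K$ be a field. The binomial edge ideal $J_G$ of a graph $G$ is the ideal of the polynomial ring $K[x_i,y_i: i\in V(G)]$ generated by the binomials $x_iy_j-x_jy_i$, where $\{i,j\}\in E(G)$ and $i<j$ (for a fixed total order on $V(G)$). An ideal is unmixed if all its associated primes have the same height (binomial edge ideals are radical, so these are the minimal primes). $J_G$ is called Cohen-Macaulay if the quotient of this polynomial ring by $J_G$ is a Cohen-Macaulay ring. *)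

theory Defs
  imports
    "HOL-Library.Poly_Mapping"
    "HOL-Library.Extended_Nat"
    "HOL-Algebra.QuotRing"
    "HOL-Algebra.Ring_Divisibility"
begin

section \<open>Finite simple graphs\<close>

record 'a graph =
  verts :: "'a set"
  edges :: "'a set set"

definition simple_graph :: "'a graph \<Rightarrow> bool" where
  "simple_graph G \<longleftrightarrow>
     finite (verts G) \<and> (\<forall>e \<in> edges G. e \<subseteq> verts G \<and> card e = 2)"

definition connected_graph :: "'a graph \<Rightarrow> bool" where
  "connected_graph G \<longleftrightarrow>
     verts G \<noteq> {} \<and>
     (\<forall>u \<in> verts G. \<forall>w \<in> verts G. (u, w) \<in> {(a, b). {a, b} \<in> edges G}\<^sup>*)"

definition complete_graph :: "'a graph \<Rightarrow> bool" where
  "complete_graph G \<longleftrightarrow>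
     (\<forall>u \<in> verts G. \<forall>w \<in> verts G. u \<noteq> w \<longrightarrow> {u, w} \<in> edges G)"

definition cone :: "'a \<Rightarrow> 'a graph \<Rightarrow> 'a graph" where
  "cone v H = \<lparr>verts = insert v (verts H), edges = edges H \<union> {{u, v} | u. u \<in> verts H}\<rparr>"


section \<open>Notions from commutative algebra\<close>

text \<open>
  Suprema and the resulting invariants take values in \<^typ>\<open>enat\<close>; the supremum of the
  empty set is \<open>0\<close> there, so that the zero ring receives Krull dimension \<open>0\<close>.
\<close>

definition prime_chain :: "('r, 'm) ring_scheme \<Rightarrow> nat \<Rightarrow> (nat \<Rightarrow> 'r set) \<Rightarrow> bool" where
  "prime_chain R n P \<longleftrightarrow>
     (\<forall>i \<le> n. primeideal (P i) R) \<and> (\<forall>i < n. P i \<subset> P (Suc i))"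

definition prime_height :: "('r, 'm) ring_scheme \<Rightarrow> 'r set \<Rightarrow> enat" where
  "prime_height R Q = Sup {enat n | n. \<exists>P. prime_chain R n P \<and> P n = Q}"

definition krull_dim :: "('r, 'm) ring_scheme \<Rightarrow> enat" where
  "krull_dim R = Sup {enat n | n. \<exists>P. prime_chain R n P}"

text \<open>
  The associated primes of the ideal \<open>I\<close>, i.e. of the module \<open>R/I\<close>: the primes of the
  form \<open>I : f\<close>, the annihilator of the class of \<open>f\<close>.
\<close>

definition associated_primes :: "('r, 'm) ring_scheme \<Rightarrow> 'r set \<Rightarrow> 'r set set" where
  "associated_primes R I =
     {P. primeideal P R \<and>
         (\<exists>f \<in> carrier R. P = {r \<in> carrier R. r \<otimes>\<^bsub>R\<^esub> f \<in> I})}"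

definition unmixed :: "('r, 'm) ring_scheme \<Rightarrow> 'r set \<Rightarrow> bool" where
  "unmixed R I \<longleftrightarrow>
     (\<forall>P \<in> associated_primes R I. \<forall>Q \<in> associated_primes R I.
        prime_height R P = prime_height R Q)"

text \<open>
  Localization at the complement \<open>S\<close> of a prime \<open>P\<close>. A fraction \<open>a/s\<close> is the class of
  the pair \<open>(a, s)\<close>. The ring need not be a domain, hence the extra factor \<open>u\<close> in the
  relation. In the operations the unions range over all representatives, which all
  yield the same class.
\<close>

definition frac_rel ::
    "('r, 'm) ring_scheme \<Rightarrow> 'r set \<Rightarrow> (('r \<times> 'r) \<times> ('r \<times> 'r)) set" where
  "frac_rel R P =
     {((a, s), (b, t)) | a s b t.
        a \<in> carrier R \<and> s \<in> carrier R - P \<and> b \<in> carrier R \<and> t \<in> carrier R - P \<and>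
        (\<exists>u \<in> carrier R - P. u \<otimes>\<^bsub>R\<^esub> (a \<otimes>\<^bsub>R\<^esub> t \<ominus>\<^bsub>R\<^esub> b \<otimes>\<^bsub>R\<^esub> s) = \<zero>\<^bsub>R\<^esub>)}"

definition localization_at :: "('r, 'm) ring_scheme \<Rightarrow> 'r set \<Rightarrow> ('r \<times> 'r) set ring" where
  "localization_at R P =
     \<lparr>carrier = (carrier R \<times> (carrier R - P)) // frac_rel R P,
      monoid.mult = (\<lambda>X Y. \<Union>(a, s) \<in> X. \<Union>(b, t) \<in> Y.
        frac_rel R P `` {(a \<otimes>\<^bsub>R\<^esub> b, s \<otimes>\<^bsub>R\<^esub> t)}),
      one = frac_rel R P `` {(\<one>\<^bsub>R\<^esub>, \<one>\<^bsub>R\<^esub>)},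
      zero = frac_rel R P `` {(\<zero>\<^bsub>R\<^esub>, \<one>\<^bsub>R\<^esub>)},
      add = (\<lambda>X Y. \<Union>(a, s) \<in> X. \<Union>(b, t) \<in> Y.
        frac_rel R P `` {(a \<otimes>\<^bsub>R\<^esub> t \<oplus>\<^bsub>R\<^esub> b \<otimes>\<^bsub>R\<^esub> s, s \<otimes>\<^bsub>R\<^esub> t)})\<rparr>"

text \<open>
  The first condition says that each entry is a nonzerodivisor modulo the ideal generated
  by the preceding ones, the second that the quotient by the whole sequence is nonzero.
\<close>

definition regular_sequence :: "('r, 'm) ring_scheme \<Rightarrow> 'r list \<Rightarrow> bool" where
  "regular_sequence R xs \<longleftrightarrow>
     set xs \<subseteq> carrier R \<and>
     (\<forall>i < length xs. \<forall>r \<in> carrier R.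
        (xs ! i) \<otimes>\<^bsub>R\<^esub> r \<in> Idl\<^bsub>R\<^esub> (set (take i xs)) \<longrightarrow> r \<in> Idl\<^bsub>R\<^esub> (set (take i xs))) \<and>
     Idl\<^bsub>R\<^esub> (set xs) \<noteq> carrier R"

definition depth :: "('r, 'm) ring_scheme \<Rightarrow> 'r set \<Rightarrow> enat" where
  "depth R I = Sup {enat (length xs) | xs. regular_sequence R xs \<and> set xs \<subseteq> I}"

definition cohen_macaulay_local_ring :: "('r, 'm) ring_scheme \<Rightarrow> bool" where
  "cohen_macaulay_local_ring R \<longleftrightarrow>
     cring R \<and> noetherian_ring R \<and>
     (\<exists>M. {N. maximalideal N R} = {M} \<and> depth R M = krull_dim R)"

definition cohen_macaulay_ring :: "('r, 'm) ring_scheme \<Rightarrow> bool" where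
  "cohen_macaulay_ring R \<longleftrightarrow>
     cring R \<and> noetherian_ring R \<and>
     (\<forall>M. maximalideal M R \<longrightarrow> cohen_macaulay_local_ring (localization_at R M))"


section \<open>Binomial edge ideals\<close>

datatype 'a indet = X 'a | Y 'a

type_synonym ('a, 'k) mpoly = "('a indet \<Rightarrow>\<^sub>0 nat) \<Rightarrow>\<^sub>0 'k"

definition indet :: "'a indet \<Rightarrow> ('a, 'k::field) mpoly" where
  "indet z = Poly_Mapping.single (Poly_Mapping.single z 1) 1"

text \<open>
  The polynomial ring \<open>K[x\<^sub>i, y\<^sub>i : i \<in> V]\<close>, realised inside the polynomials in the
  indeterminates indexed by the whole type \<^typ>\<open>'a\<close>: all monomials that occur involve only
  indeterminates indexed by \<open>V\<close>. The first argument only fixes the coefficient field.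
\<close>

definition edge_ring :: "'k::field itself \<Rightarrow> 'a set \<Rightarrow> ('a, 'k) mpoly ring" where
  "edge_ring K V =
     \<lparr>carrier = {p. \<forall>m \<in> Poly_Mapping.keys p. Poly_Mapping.keys m \<subseteq> X ` V \<union> Y ` V},
      monoid.mult = (*), one = 1, zero = 0, add = (+)\<rparr>"

definition binomial_edge_ideal ::
    "'k::field itself \<Rightarrow> 'a::linorder graph \<Rightarrow> ('a, 'k) mpoly set" where
  "binomial_edge_ideal K G =
     Idl\<^bsub>edge_ring K (verts G)\<^esub>
       {indet (X i) * indet (Y j) - indet (X j) * indet (Y i) | i j. {i, j} \<in> edges G \<and> i < j}"

end

theory Submission
  imports Defs "HOL-Computational_Algebra.Polynomial"
begin

text \<open>
  One direction compares heights of minimal primes, the other rests on an explicit Noether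
  normalization.

  \<^bold>\<open>Minimal primes.\<close> For a set \<open>S\<close> of vertices of \<open>G\<close> let \<open>P\<^sub>S\<close> be the kernel of the substitution that
  kills \<open>x\<^sub>i, y\<^sub>i\<close> for \<open>i \<in> S\<close> and otherwise replaces \<open>y\<^sub>i\<close> by \<open>x\<^sub>i y\<^sub>r\<close>, where \<open>r\<close> is a chosen vertex in the
  component of \<open>i\<close> in \<open>G - S\<close>. Its height is \<open>|S| + |V| - c(S)\<close>, with \<open>c(S)\<close> the number of components
  (\<open>height_PS\<close>): a chain of kernels of partial substitutions has this length, and no chain is
  longer, since the \<open>x\<^sub>i\<close> with \<open>i \<notin> S\<close> and the \<open>y\<^sub>r\<close> are algebraically independent modulo \<open>P\<^sub>S\<close>. If every
  vertex of \<open>S\<close> has neighbours in two components of \<open>G - S\<close>, then \<open>P\<^sub>S\<close> is minimal over \<open>J\<^sub>G\<close>, hence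
  associated (\<open>separated_by_associated_prime\<close>). Suppose \<open>H\<close> is connected with \<open>n\<close> vertices, but not
  complete. A minimal separator \<open>S\<close> of two nonadjacent vertices has this property in \<open>H\<close>, and \<open>S \<union> {v}\<close>
  has it in \<open>G\<close>, with the same components left. If \<open>J\<^sub>H\<close> is unmixed, comparison with the empty set
  gives \<open>c(S) = |S| + 1\<close>. In \<open>G\<close> the heights for \<open>S \<union> {v}\<close> and the empty set are then \<open>n + 1\<close> and \<open>n\<close>, so
  \<open>J\<^sub>G\<close> is not unmixed.

  \<^bold>\<open>Complete graphs.\<close> If \<open>H\<close> is complete, so is \<open>G\<close>, and \<open>J\<^sub>G\<close> is the ideal of 2-minors of a generic
  matrix with \<open>N\<close> columns \<open>(x\<^sub>i, y\<^sub>i)\<close>, \<open>0 \<le> i < N\<close>. The quotient is a free module with basis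
  \<open>1, x\<^sub>1, \<dots>, x\<^sub>N\<^sub>-\<^sub>1\<close> over the polynomial ring in the \<open>N + 1\<close> parameters \<open>\<theta>\<^sub>0 = x\<^sub>0\<close>, \<open>\<theta>\<^sub>i = x\<^sub>i - y\<^sub>i\<^sub>-\<^sub>1\<close>,
  \<open>\<theta>\<^sub>N = y\<^sub>N\<^sub>-\<^sub>1\<close>. The basis generates because products \<open>x\<^sub>i x\<^sub>j\<^sub>+\<^sub>1\<close> and \<open>x\<^sub>i\<^sub>+\<^sub>1 x\<^sub>j\<close> agree modulo what is already
  generated (\<open>generated\<close>), and it is independent because under a suitable parametrization the
  summands have different degrees (\<open>basis_independent\<close>). In particular \<open>J\<^sub>G\<close> is prime, hence unmixed.

  \<^bold>\<open>Cohen-Macaulayness.\<close> Let \<open>P\<close> be a prime containing \<open>J\<^sub>G\<close> and \<open>T\<close> a maximal set of parameters that are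
  algebraically independent modulo \<open>P\<close>. Each of the other \<open>N + 1 - |T|\<close> parameters \<open>\<theta>\<^sub>i\<close> satisfies a nonzero
  polynomial in \<open>T\<close> and \<open>\<theta>\<^sub>i\<close> modulo \<open>P\<close>. These polynomials involve separate variables, so by freeness
  they form a regular sequence once the nonzero polynomials in \<open>T\<close>, none of which lies in \<open>P\<close>, are
  inverted (\<open>regular_sequence_of_full_length\<close>). On the other hand, no chain of primes between \<open>J\<^sub>G\<close> and
  \<open>P\<close> is longer than \<open>N + 1 - |T|\<close>. As depth never exceeds dimension, both equal \<open>N + 1 - |T|\<close> for the
  local ring at \<open>P\<close>.

  All bounds on chains of primes come from one count. Elements chosen along a chain, together with
  elements independent modulo its top, are algebraically independent modulo its bottom
  (\<open>prime_chain_alg_indep\<close>), and algebraically independent polynomials cannot outnumber the variables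
  (\<open>injective_psubst_card_le\<close>).
\<close>

hide_const (open) UnivPoly.coeff UnivPoly.monom

alias keys = Poly_Mapping.keys
alias lookup = Poly_Mapping.lookup
alias single = Poly_Mapping.single

section \<open>Polynomials and evaluation homomorphisms\<close>

type_synonym ('v, 'k) mp = "('v \<Rightarrow>\<^sub>0 nat) \<Rightarrow>\<^sub>0 'k"

definition Cst :: "'k::field \<Rightarrow> ('v, 'k) mp" where
  "Cst c = single 0 c"

definition Var :: "'v \<Rightarrow> ('v, 'k::field) mp" where
  "Var z = single (single z 1) 1"

definition polys_in :: "'v set \<Rightarrow> ('v, 'k::field) mp set" where
  "polys_in W = {p. \<forall>m \<in> keys p. keys m \<subseteq> W}"

lemma Cst_0 [simp]: "Cst 0 = 0" and Cst_1 [simp]: "Cst 1 = 1"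
  and Cst_add: "Cst (a + b) = Cst a + Cst b" and Cst_mult: "Cst (a * b) = Cst a * Cst b"
  by (simp_all add: Cst_def single_add mult_single)

lemma Cst_eq_0_iff [simp]: "Cst c = 0 \<longleftrightarrow> c = 0"
  unfolding Cst_def using inj_single[of "0 :: 'v \<Rightarrow>\<^sub>0 nat"]
  by (metis lookup_single_eq lookup_zero single_zero)

lemma polys_in_Cst [simp]: "Cst c \<in> polys_in W"
  by (auto simp: polys_in_def Cst_def split: if_splits)

lemma polys_in_0 [simp]: "0 \<in> polys_in W" and polys_in_1 [simp]: "1 \<in> polys_in W"
  by (auto simp: polys_in_def)

lemma polys_in_Var: "z \<in> W \<Longrightarrow> Var z \<in> polys_in W"
  by (auto simp: polys_in_def Var_def split: if_splits)

lemma polys_in_add [intro]: "p \<in> polys_in W \<Longrightarrow> q \<in> polys_in W \<Longrightarrow> p + q \<in> polys_in W"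
  using Poly_Mapping.keys_add[of p q] unfolding polys_in_def by blast

lemma keys_add_monomial: "keys (a + b :: 'v \<Rightarrow>\<^sub>0 nat) = keys a \<union> keys b"
  by (auto simp: in_keys_iff lookup_add)

lemma polys_in_mult [intro]:
  assumes "p \<in> polys_in W" "q \<in> polys_in W" shows "p * q \<in> polys_in W"
  unfolding polys_in_def
proof (intro CollectI ballI)
  fix m assume "m \<in> keys (p * q)"
  then obtain a b where "m = a + b" "a \<in> keys p" "b \<in> keys q"
    using keys_mult[of p q] by blast
  then show "keys m \<subseteq> W" using assms by (auto simp: polys_in_def keys_add_monomial)
qed

lemma polys_in_uminus [intro]: "p \<in> polys_in W \<Longrightarrow> - p \<in> polys_in W"
  by (auto simp: polys_in_def in_keys_iff)

lemma polys_in_diff [intro]: "p \<in> polys_in W \<Longrightarrow> q \<in> polys_in W \<Longrightarrow> p - q \<in> polys_in W"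
  using polys_in_add[of p W "- q"] polys_in_uminus[of q W] by simp

lemma polys_in_sum [intro]: "(\<And>i. i \<in> I \<Longrightarrow> f i \<in> polys_in W) \<Longrightarrow> sum f I \<in> polys_in W"
  by (induction I rule: infinite_finite_induct) auto

lemma polys_in_prod [intro]: "(\<And>i. i \<in> I \<Longrightarrow> f i \<in> polys_in W) \<Longrightarrow> prod f I \<in> polys_in W"
  by (induction I rule: infinite_finite_induct) auto

lemma polys_in_power [intro]: "p \<in> polys_in W \<Longrightarrow> p ^ n \<in> polys_in W"
  by (induction n) auto

lemma polys_in_mono: "W \<subseteq> W' \<Longrightarrow> polys_in W \<subseteq> polys_in W'"
  by (auto simp: polys_in_def)

lemma polys_in_UNIV [simp]: "polys_in UNIV = UNIV"
  by (auto simp: polys_in_def)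

lemma sum_monomials: "p = (\<Sum>m\<in>keys p. single m (lookup p m))"
  by (rule poly_mapping_eqI)
    (auto simp: lookup_sum lookup_single when_def in_keys_iff)

definition mono_eval :: "('v \<Rightarrow> 'b) \<Rightarrow> ('v \<Rightarrow>\<^sub>0 nat) \<Rightarrow> 'b::comm_ring_1" where
  "mono_eval \<sigma> m = (\<Prod>z\<in>keys m. \<sigma> z ^ lookup m z)"

lemma mono_eval_superset:
  "finite A \<Longrightarrow> keys m \<subseteq> A \<Longrightarrow> mono_eval \<sigma> m = (\<Prod>z\<in>A. \<sigma> z ^ lookup m z)"
  unfolding mono_eval_def by (rule prod.mono_neutral_left) (auto simp: in_keys_iff)

lemma mono_eval_add: "mono_eval \<sigma> (a + b) = mono_eval \<sigma> a * mono_eval \<sigma> b"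
proof -
  let ?A = "keys a \<union> keys b"
  show ?thesis
    by (simp add: mono_eval_superset[of ?A] keys_add_monomial lookup_add power_add prod.distrib)
qed

lemma mono_eval_0 [simp]: "mono_eval \<sigma> 0 = 1"
  by (simp add: mono_eval_def)

lemma single_eq_Cst_mult_mono:
  "single m c = Cst c * mono_eval Var (m :: 'v \<Rightarrow>\<^sub>0 nat)" for c :: "'k::field"
proof -
  have pow: "(Var z :: ('v, 'k) mp) ^ n = single (single z n) 1" for z n
    by (induction n) (auto simp: Var_def mult_single single_add[symmetric])
  have "(\<Prod>z\<in>A. (Var z :: ('v, 'k) mp) ^ f z) = single (\<Sum>z\<in>A. single z (f z)) 1"
    for f and A :: "'v set"
    by (induction A rule: infinite_finite_induct) (auto simp: pow mult_single)
  then have "mono_eval (Var :: 'v \<Rightarrow> ('v, 'k) mp) m = single m 1"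
    using sum_monomials[of m, symmetric] by (simp add: mono_eval_def)
  then show ?thesis by (simp add: Cst_def mult_single)
qed

lemma polys_in_induct [consumes 1, case_names Cst Var add mult]:
  assumes p: "p \<in> polys_in W" and Cst: "\<And>c. Q (Cst c)" and Var: "\<And>z. z \<in> W \<Longrightarrow> Q (Var z)"
    and add: "\<And>p q. p \<in> polys_in W \<Longrightarrow> q \<in> polys_in W \<Longrightarrow> Q p \<Longrightarrow> Q q \<Longrightarrow> Q (p + q)"
    and mult: "\<And>p q. p \<in> polys_in W \<Longrightarrow> q \<in> polys_in W \<Longrightarrow> Q p \<Longrightarrow> Q q \<Longrightarrow> Q (p * q)"
  shows "Q p"
proof -
  have pow: "Q (Var z ^ n)" if "z \<in> W" for z n
  proof (induction n)
    case 0 then show ?case using Cst[of 1] by simp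
  next
    case (Suc n) then show ?case using mult[OF polys_in_Var[OF that] polys_in_power[OF polys_in_Var[OF that]] Var[OF that]] by simp
  qed
  have pr: "Q (\<Prod>z\<in>A. Var z ^ f z)" if "A \<subseteq> W" "finite A" for A f using that(2,1)
  proof (induction A rule: finite_induct)
    case empty then show ?case using Cst[of 1] by simp
  next
    case (insert x F)
    then have "x \<in> W" "F \<subseteq> W" by auto
    then have "Var x ^ f x \<in> polys_in W" "(\<Prod>z\<in>F. Var z ^ f z) \<in> polys_in W"
      by (auto intro!: polys_in_power polys_in_prod polys_in_Var)
    from mult[OF this pow[OF \<open>x \<in> W\<close>]] insert \<open>F \<subseteq> W\<close> show ?case by simp
  qed
  have m: "Q (mono_eval Var m)" if "keys m \<subseteq> W" for m
    unfolding mono_eval_def by (rule pr) (use that in auto)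
  have mi: "mono_eval Var m \<in> polys_in W" if "keys m \<subseteq> W" for m
    unfolding mono_eval_def using that by (auto intro!: polys_in_prod polys_in_power polys_in_Var)
  have "Q (\<Sum>m\<in>A. Cst (f m) * mono_eval Var m)"
    if "finite A" "\<forall>m\<in>A. keys m \<subseteq> W" for A f
    using that
  proof (induction A rule: finite_induct)
    case empty then show ?case using Cst[of 0] by simp
  next
    case (insert x F)
    then have 1: "Cst (f x) * mono_eval Var x \<in> polys_in W" "Q (Cst (f x) * mono_eval Var x)"
      using mult[OF polys_in_Cst mi Cst m] mi[of x] by auto
    have 2: "(\<Sum>m\<in>F. Cst (f m) * mono_eval Var m) \<in> polys_in W"
      using insert.prems by (intro polys_in_sum polys_in_mult polys_in_Cst mi) auto
    show ?case using add[OF 1(1) 2 1(2)] insert by simp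
  qed
  from this[of "keys p" "lookup p"] p show ?thesis
    unfolding single_eq_Cst_mult_mono[symmetric] sum_monomials[symmetric] by (simp add: polys_in_def)
qed

lemma polys_in_empty: "p \<in> polys_in {} \<Longrightarrow> \<exists>c. p = Cst c"
  by (induction rule: polys_in_induct) (auto simp: Cst_add[symmetric] Cst_mult[symmetric])


subsection \<open>Evaluation\<close>

definition rhom :: "('r::comm_ring_1 \<Rightarrow> 's::comm_ring_1) \<Rightarrow> bool" where
  "rhom f \<longleftrightarrow> f 1 = 1 \<and> (\<forall>x y. f (x + y) = f x + f y) \<and> (\<forall>x y. f (x * y) = f x * f y)"

lemma rhomD: assumes "rhom f"
  shows "f 1 = 1" "f (x + y) = f x + f y" "f (x * y) = f x * f y" "f 0 = 0"
    "f (- x) = - f x" "f (x - y) = f x - f y" "f (x ^ n) = f x ^ n"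
proof -
  show 1: "f 1 = 1" and 2: "\<And>x y. f (x + y) = f x + f y" and 3: "\<And>x y. f (x * y) = f x * f y"
    using assms by (auto simp: rhom_def)
  show 4: "f 0 = 0" using 2[of 0 0] by simp
  show 5: "f (- x) = - f x" for x using 2[of x "- x"] 4 by (simp add: eq_neg_iff_add_eq_0 add.commute)
  show "f (x - y) = f x - f y" using 2[of x "- y"] 5 by simp
  show "f (x ^ n) = f x ^ n" by (induction n) (auto simp: 1 3)
qed

lemma rhom_sum: assumes "rhom f" shows "f (sum g A) = (\<Sum>i\<in>A. f (g i))"
  by (induction A rule: infinite_finite_induct) (auto simp: rhomD[OF assms])

lemma rhom_prod: assumes "rhom f" shows "f (prod g A) = (\<Prod>i\<in>A. f (g i))"
  by (induction A rule: infinite_finite_induct) (auto simp: rhomD[OF assms])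

lemma rhom_comp: "rhom f \<Longrightarrow> rhom g \<Longrightarrow> rhom (\<lambda>x. f (g x))"
  by (simp add: rhom_def)

lemma rhom_id: "rhom (\<lambda>x. x)"
  by (simp add: rhom_def)

lemma rhom_Cst: "rhom Cst"
  by (simp add: rhom_def Cst_add Cst_mult)

lemma rhom_const_poly: "rhom (\<lambda>c. [:c:])"
  by (simp add: rhom_def one_pCons)

definition mp_eval :: "('k::field \<Rightarrow> 'b) \<Rightarrow> ('v \<Rightarrow> 'b) \<Rightarrow> ('v, 'k) mp \<Rightarrow> 'b::comm_ring_1" where
  "mp_eval \<kappa> \<sigma> p =
     (\<Sum>m\<in>keys p. \<kappa> (lookup p m) * mono_eval \<sigma> m)"

lemma mp_eval_superset:
  assumes "rhom \<kappa>" "finite A" "keys p \<subseteq> A"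
  shows "mp_eval \<kappa> \<sigma> p = (\<Sum>m\<in>A. \<kappa> (lookup p m) * mono_eval \<sigma> m)"
  unfolding mp_eval_def using assms by (intro sum.mono_neutral_left) (auto simp: in_keys_iff rhomD(4)[OF assms(1)])

lemma mp_eval_add: assumes "rhom \<kappa>"
  shows "mp_eval \<kappa> \<sigma> (p + q) = mp_eval \<kappa> \<sigma> p + mp_eval \<kappa> \<sigma> q"
proof -
  let ?A = "keys p \<union> keys q"
  show ?thesis using Poly_Mapping.keys_add[of p q]
    by (simp add: mp_eval_superset[OF assms, of ?A] lookup_add rhomD(2)[OF assms] sum.distrib algebra_simps)
qed

lemma mp_eval_single: "rhom \<kappa> \<Longrightarrow> mp_eval \<kappa> \<sigma> (single m c) = \<kappa> c * mono_eval \<sigma> m"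
  by (subst mp_eval_superset[of _ "{m}"]) auto

lemma mp_eval_0: "rhom \<kappa> \<Longrightarrow> mp_eval \<kappa> \<sigma> 0 = 0"
  by (simp add: mp_eval_def)

lemma mp_eval_sum: "rhom \<kappa> \<Longrightarrow> mp_eval \<kappa> \<sigma> (sum f A) = (\<Sum>i\<in>A. mp_eval \<kappa> \<sigma> (f i))"
  by (induction A rule: infinite_finite_induct) (auto simp: mp_eval_0 mp_eval_add)

lemma mp_eval_mult: assumes "rhom \<kappa>"
  shows "mp_eval \<kappa> \<sigma> (p * q) = mp_eval \<kappa> \<sigma> p * mp_eval \<kappa> \<sigma> q"
proof -
  let ?s = "\<lambda>p m. single m (lookup p m)"
  have "mp_eval \<kappa> \<sigma> (p * q) = mp_eval \<kappa> \<sigma> ((\<Sum>m\<in>keys p. ?s p m) * (\<Sum>m\<in>keys q. ?s q m))"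
    using sum_monomials[of p, symmetric] sum_monomials[of q, symmetric] by simp
  also have "\<dots> = (\<Sum>m\<in>keys p. \<Sum>n\<in>keys q.
       (\<kappa> (lookup p m) * mono_eval \<sigma> m) * (\<kappa> (lookup q n) * mono_eval \<sigma> n))"
    by (simp add: sum_product mp_eval_sum[OF assms] mult_single mp_eval_single[OF assms]
        rhomD(3)[OF assms] mono_eval_add mult_ac)
  also have "\<dots> = mp_eval \<kappa> \<sigma> p * mp_eval \<kappa> \<sigma> q"
    by (simp add: mp_eval_def sum_product)
  finally show ?thesis .
qed

lemma mp_eval_Cst: "rhom \<kappa> \<Longrightarrow> mp_eval \<kappa> \<sigma> (Cst c) = \<kappa> c"
  by (simp add: Cst_def mp_eval_single)

lemma mp_eval_Var: assumes "rhom \<kappa>" shows "mp_eval \<kappa> \<sigma> (Var z) = \<sigma> z"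
  by (simp add: Var_def mp_eval_single[OF assms] rhomD(1)[OF assms] mono_eval_def)

lemma rhom_mp_eval: assumes "rhom \<kappa>" shows "rhom (mp_eval \<kappa> \<sigma>)"
  using mp_eval_Cst[OF assms, of \<sigma> 1]
  by (simp add: rhom_def[of "mp_eval \<kappa> \<sigma>"] mp_eval_add[OF assms] mp_eval_mult[OF assms] rhomD(1)[OF assms])

lemma rhom_eq_on_polys_in:
  assumes "rhom f" "rhom g" "\<And>c. f (Cst c) = g (Cst c)" "\<And>z. z \<in> W \<Longrightarrow> f (Var z) = g (Var z)"
    "p \<in> polys_in W"
  shows "f p = g p"
  using assms(5) by (induction rule: polys_in_induct) (auto simp: assms(3,4) rhomD[OF assms(1)] rhomD[OF assms(2)])

abbreviation psubst :: "('v \<Rightarrow> ('w, 'k::field) mp) \<Rightarrow> ('v, 'k) mp \<Rightarrow> ('w, 'k) mp" where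
  "psubst \<equiv> mp_eval Cst"

lemmas rhom_psubst = rhom_mp_eval[OF rhom_Cst]
lemmas psubst_simps [simp] = mp_eval_Cst[OF rhom_Cst] mp_eval_Var[OF rhom_Cst]
  rhomD[OF rhom_psubst]

lemma mp_eval_in:
  assumes "p \<in> polys_in W" "\<And>z. z \<in> W \<Longrightarrow> \<sigma> z \<in> polys_in U"
  shows "psubst \<sigma> p \<in> polys_in U"
  using assms(1) by (induction rule: polys_in_induct) (auto simp: assms(2))

lemma psubst_comp:
  "psubst \<tau> (psubst \<sigma> p) = psubst (\<lambda>z. psubst \<tau> (\<sigma> z)) p"
  by (rule rhom_eq_on_polys_in[OF rhom_comp[OF rhom_psubst rhom_psubst] rhom_psubst, where W = UNIV]) auto

lemma psubst_cong:
  assumes "p \<in> polys_in W" "\<And>z. z \<in> W \<Longrightarrow> \<sigma> z = \<tau> z" shows "psubst \<sigma> p = psubst \<tau> p"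
  by (rule rhom_eq_on_polys_in[of _ _ W]) (simp_all add: assms rhom_psubst)

lemma psubst_Var_id: assumes "p \<in> polys_in W" "\<And>z. z \<in> W \<Longrightarrow> \<sigma> z = Var z" shows "psubst \<sigma> p = p"
  by (rule rhom_eq_on_polys_in[of _ "\<lambda>x. x" W]) (simp_all add: assms rhom_psubst rhom_id)

lemma indet_eq_Var: "indet = Var"
  by (simp add: indet_def Var_def fun_eq_iff)


section \<open>Injective substitutions and the number of variables\<close>

definition box_monos :: "'v set \<Rightarrow> nat \<Rightarrow> ('v \<Rightarrow>\<^sub>0 nat) set" where
  "box_monos W d = {m. keys m \<subseteq> W \<and> (\<forall>z. lookup m z \<le> d)}"

lemma bij_betw_box_monos:
  assumes "finite W"
  shows "bij_betw (\<lambda>m. restrict (lookup m) W) (box_monos W d) (W \<rightarrow>\<^sub>E {..d})"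
proof (rule bij_betwI')
  fix m n assume mn: "m \<in> box_monos W d" "n \<in> box_monos W d"
  show "(restrict (lookup m) W = restrict (lookup n) W) = (m = n)"
  proof
    assume eq: "restrict (lookup m) W = restrict (lookup n) W"
    show "m = n"
    proof (rule poly_mapping_eqI)
      fix z show "lookup m z = lookup n z"
      proof (cases "z \<in> W")
        case True
        then show ?thesis using fun_cong[OF eq, of z] by simp
      next
        case False
        then have "z \<notin> keys m" "z \<notin> keys n" using mn by (auto simp: box_monos_def)
        then show ?thesis by (simp add: in_keys_iff)
      qed
    qed
  qed simp
next
  fix m assume "m \<in> box_monos W d"
  then show "restrict (lookup m) W \<in> W \<rightarrow>\<^sub>E {..d}"
    by (auto simp: box_monos_def)
next
  fix f assume f: "f \<in> W \<rightarrow>\<^sub>E {..d}"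
  define m where "m = Abs_poly_mapping (\<lambda>z. if z \<in> W then f z else 0)"
  have m: "lookup m z = (if z \<in> W then f z else 0)" for z
    unfolding m_def by (subst lookup_Abs_poly_mapping) (auto intro: finite_subset[OF _ assms])
  have "m \<in> box_monos W d" using f by (auto simp: box_monos_def m in_keys_iff split: if_splits)
  moreover have "f = restrict (lookup m) W"
    using f by (auto simp: m fun_eq_iff PiE_def extensional_def)
  ultimately show "\<exists>m\<in>box_monos W d. f = restrict (lookup m) W" by blast
qed

lemma card_box_monos:
  assumes "finite W" shows "finite (box_monos W d)" "card (box_monos W d) = (d + 1) ^ card W"
proof -
  have "finite (W \<rightarrow>\<^sub>E {..d})" by (intro finite_PiE assms) auto
  then show "finite (box_monos W d)" using bij_betw_finite[OF bij_betw_box_monos[OF assms]] by blast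
  show "card (box_monos W d) = (d + 1) ^ card W"
    using bij_betw_same_card[OF bij_betw_box_monos[OF assms]] by (simp add: card_PiE assms)
qed

definition box_polys :: "'v set \<Rightarrow> nat \<Rightarrow> ('v, 'k::field) mp set" where
  "box_polys W d = {p. keys p \<subseteq> box_monos W d}"

lemma box_polys_mult:
  assumes "p \<in> box_polys W a" "q \<in> box_polys W b" shows "p * q \<in> box_polys W (a + b)"
  unfolding box_polys_def
proof (intro CollectI subsetI)
  fix m assume "m \<in> keys (p * q)"
  then obtain x y where "m = x + y" "x \<in> keys p" "y \<in> keys q"
    using keys_mult[of p q] by blast
  then show "m \<in> box_monos W (a + b)"
    using assms by (auto simp: box_polys_def box_monos_def keys_add_monomial lookup_add subset_iff intro!: add_mono)
qed

lemma box_polys_1: "1 \<in> box_polys W a"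
  by (auto simp: box_polys_def box_monos_def)

lemma box_polys_power: "p \<in> box_polys W a \<Longrightarrow> p ^ n \<in> box_polys W (n * a)"
  by (induction n) (auto intro: box_polys_1 box_polys_mult)

lemma box_polys_mono: "p \<in> box_polys W a \<Longrightarrow> a \<le> b \<Longrightarrow> p \<in> box_polys W b"
  by (auto simp: box_polys_def box_monos_def subset_iff intro: order_trans)

lemma box_polys_prod:
  assumes "finite A" "\<And>i. i \<in> A \<Longrightarrow> f i \<in> box_polys W a" shows "prod f A \<in> box_polys W (card A * a)"
  using assms by (induction A rule: finite_induct) (auto intro: box_polys_1 box_polys_mult)

lemma polys_in_box_polys:
  assumes "p \<in> polys_in W" obtains a where "p \<in> box_polys W a"
proof
  let ?S = "\<Union>m\<in>keys p. lookup m ` keys m"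
  show "p \<in> box_polys W (Max (insert 0 ?S))"
    unfolding box_polys_def box_monos_def
  proof (safe)
    fix m z assume "m \<in> keys p" "z \<in> keys m"
    then show "z \<in> W" using assms by (auto simp: polys_in_def)
  next
    fix m z assume m: "m \<in> keys p"
    show "lookup m z \<le> Max (insert 0 ?S)"
    proof (cases "z \<in> keys m")
      case True
      with m have "lookup m z \<in> ?S" by blast
      then show ?thesis by (intro Max_ge) auto
    qed (simp add: in_keys_iff)
  qed
qed

interpretation mp_vs: vector_space "\<lambda>c p. Cst c * (p :: ('v, 'k::field) mp)"
  by unfold_locales (auto simp: Cst_add Cst_mult algebra_simps)

lemma box_polys_span:
  assumes "finite W" "(p :: ('v, 'k::field) mp) \<in> box_polys W d"
  shows "p \<in> mp_vs.span (mono_eval Var ` box_monos W d)"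
proof -
  have "(\<Sum>m\<in>keys p. Cst (lookup p m) * mono_eval Var m)
    \<in> mp_vs.span (mono_eval Var ` box_monos W d)"
    using assms(2) by (intro mp_vs.span_sum mp_vs.span_scale mp_vs.span_base) (auto simp: box_polys_def)
  then show ?thesis unfolding single_eq_Cst_mult_mono[symmetric] sum_monomials[symmetric] .
qed

lemma mono_eval_in_box:
  assumes "finite A" "keys m \<subseteq> A" "\<And>z. lookup m z \<le> d"
    "\<And>z. z \<in> A \<Longrightarrow> h z \<in> box_polys W a"
  shows "mono_eval h m \<in> box_polys W (card A * (d * a))"
  unfolding mono_eval_superset[OF assms(1,2)]
  by (intro box_polys_prod assms(1) box_polys_mono[OF box_polys_power[OF assms(4)]]) (auto simp: assms(3))

lemma psubst_mono_eval: "psubst h (mono_eval Var m) = mono_eval h m"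
  unfolding mono_eval_def by (simp add: rhom_prod[OF rhom_psubst])

text \<open>The monomials with exponents at most \<open>d\<close> go to linearly independent polynomials whose
  exponents are bounded by a multiple of \<open>d\<close>. There are \<open>(d + 1)\<^sup>q\<close> of them in a space whose dimension
  grows like \<open>d\<close> to the power \<open>card W\<close>, so for large \<open>d\<close> there is no room for them unless
  \<open>q \<le> card W\<close>.\<close>

lemma injective_psubst_card_le:
  fixes h :: "nat \<Rightarrow> ('w, 'k::field) mp"
  assumes W: "finite W" and h: "\<And>i. i < q \<Longrightarrow> h i \<in> polys_in W"
    and inj: "\<And>b. b \<in> polys_in {..<q} \<Longrightarrow> psubst h b = 0 \<Longrightarrow> b = 0"
  shows "q \<le> card W"
proof (rule ccontr)
  assume "\<not> q \<le> card W"
  define e where "e = card W"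
  have "\<forall>i\<in>{..<q}. \<exists>a. h i \<in> box_polys W a" using h polys_in_box_polys by (metis lessThan_iff)
  then obtain a' where a': "\<And>i. i < q \<Longrightarrow> h i \<in> box_polys W (a' i)" by (metis lessThan_iff)
  define a where "a = (\<Sum>i<q. a' i)"
  have a: "h i \<in> box_polys W a" if "i < q" for i
    by (rule box_polys_mono[OF a'[OF that]]) (unfold a_def, rule member_le_sum, use that in auto)
  have bound: "(d + 1) ^ q \<le> (q * (d * a) + 1) ^ e" for d
  proof -
    let ?M = "box_monos {..<q} d" and ?N = "box_monos W (q * (d * a))"
    have M: "finite ?M" "card ?M = (d + 1) ^ q" by (simp_all add: card_box_monos)
    have N: "finite ?N" "card ?N = (q * (d * a) + 1) ^ e"
      by (simp_all add: card_box_monos W e_def)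
    have comb: "u m = 0" if u: "(\<Sum>m\<in>?M. Cst (u m) * mono_eval h m) = 0" and m: "m \<in> ?M" for u m
    proof -
      let ?b = "\<Sum>m\<in>?M. single m (u m)"
      have "psubst h ?b = 0"
        using u by (simp add: single_eq_Cst_mult_mono rhom_sum[OF rhom_psubst] psubst_mono_eval)
      moreover have "?b \<in> polys_in {..<q}"
        by (intro polys_in_sum) (auto simp: polys_in_def box_monos_def split: if_splits)
      ultimately have "?b = 0" using inj by blast
      then have "lookup ?b m = 0" by simp
      then show ?thesis using m M(1) by (simp add: lookup_sum lookup_single when_def)
    qed
    have inj: "inj_on (mono_eval h) ?M"
    proof (rule inj_onI, rule ccontr)
      fix m n assume mn: "m \<in> ?M" "n \<in> ?M" "mono_eval h m = mono_eval h n" "m \<noteq> n"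
      define u :: "(nat \<Rightarrow>\<^sub>0 nat) \<Rightarrow> 'k" where "u = (\<lambda>x. if x = m then 1 else if x = n then - 1 else 0)"
      have "(\<Sum>x\<in>?M. Cst (u x) * mono_eval h x) = (\<Sum>x\<in>{m, n}. Cst (u x) * mono_eval h x)"
        using mn M(1) by (intro sum.mono_neutral_right) (auto simp: u_def)
      also have "\<dots> = 0" using mn rhomD(5)[OF rhom_Cst, of "1::'k"] by (simp add: u_def)
      finally show False using comb[of u m] mn by (simp add: u_def)
    qed
    have "mp_vs.independent (mono_eval h ` ?M)"
      using comb[of "\<lambda>m. _ (mono_eval h m)"] M(1) inj
      by (auto simp: mp_vs.dependent_finite sum.reindex)
    moreover have "mono_eval h ` ?M \<subseteq> mp_vs.span (mono_eval Var ` ?N)"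
    proof safe
      fix m assume "m \<in> ?M"
      then have "mono_eval h m \<in> box_polys W (card {..<q} * (d * a))"
        by (intro mono_eval_in_box a) (auto simp: box_monos_def)
      then show "mono_eval h m \<in> mp_vs.span (mono_eval Var ` ?N)" using box_polys_span[OF W] by simp
    qed
    ultimately have "card (mono_eval h ` ?M) \<le> card (mono_eval Var ` ?N :: ('w, 'k) mp set)"
      using mp_vs.independent_span_bound N(1) by blast
    also have "\<dots> \<le> card ?N" by (rule card_image_le[OF N(1)])
    finally show ?thesis using inj M N by (simp add: card_image)
  qed
  (* This c satisfies q * (d * a) + 1 \<le> c * (d + 1), and d = c ^ e is too large for the bound. *)
  define c where "c = q * a + 1"
  define d where "d = c ^ e"
  have "q * (d * a) + 1 \<le> c * (d + 1)" by (simp add: c_def algebra_simps)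
  then have "(d + 1) ^ q \<le> (c * (d + 1)) ^ e" using bound[of d] power_mono le_trans by blast
  also have "\<dots> = d * (d + 1) ^ e" by (simp only: d_def power_mult_distrib)
  also have "\<dots> < (d + 1) ^ Suc e" by simp
  also have "\<dots> \<le> (d + 1) ^ q" using \<open>\<not> q \<le> card W\<close> by (intro power_increasing) (auto simp: e_def)
  finally show False by simp
qed


section \<open>Chains of primes and algebraic independence\<close>

definition polyR :: "'v set \<Rightarrow> ('v, 'k::field) mp ring" where
  "polyR W = \<lparr>carrier = polys_in W, monoid.mult = (*), one = 1, zero = 0, add = (+)\<rparr>"

lemma polyR_simps [simp]:
  "carrier (polyR W) = polys_in W" "x \<otimes>\<^bsub>polyR W\<^esub> y = x * y" "\<one>\<^bsub>polyR W\<^esub> = 1"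
  "\<zero>\<^bsub>polyR W\<^esub> = 0" "x \<oplus>\<^bsub>polyR W\<^esub> y = x + y"
  by (simp_all add: polyR_def)

lemma edge_ring_eq_polyR: "edge_ring K V = polyR (X ` V \<union> Y ` V)"
  by (simp add: edge_ring_def polyR_def polys_in_def)

lemma cring_polyR: "cring (polyR W)"
proof (rule cringI)
  show "abelian_group (polyR W)"
  proof (rule abelian_groupI)
    fix x assume "x \<in> carrier (polyR W)"
    then show "\<exists>y\<in>carrier (polyR W). y \<oplus>\<^bsub>polyR W\<^esub> x = \<zero>\<^bsub>polyR W\<^esub>"
      by (intro bexI[of _ "- x"]) auto
  qed (auto simp: algebra_simps)
  show "comm_monoid (polyR W)"
    by (rule comm_monoidI) (auto simp: algebra_simps)
qed (auto simp: algebra_simps)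

lemma (in cring) idealI':
  assumes "I \<subseteq> carrier R" "\<zero> \<in> I" "\<And>x y. x \<in> I \<Longrightarrow> y \<in> I \<Longrightarrow> x \<oplus> y \<in> I"
    "\<And>x r. x \<in> I \<Longrightarrow> r \<in> carrier R \<Longrightarrow> r \<otimes> x \<in> I"
  shows "ideal I R"
proof (rule idealI)
  show "ring R" by (rule ring_axioms)
  show "subgroup I (add_monoid R)"
  proof (rule group.subgroupI)
    show "Group.group (add_monoid R)" by (rule a_group)
    fix a assume a: "a \<in> I"
    then have c: "a \<in> carrier R" using assms(1) by auto
    then have "(\<ominus> \<one>) \<otimes> a = \<ominus> a" by (simp add: l_minus)
    then have "\<ominus> a \<in> I" using assms(4)[OF a, of "\<ominus> \<one>"] by simp
    then show "inv\<^bsub>add_monoid R\<^esub> a \<in> I" by (simp add: a_inv_def)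
  qed (use assms in auto)
qed (use assms m_comm in \<open>auto simp: subset_iff\<close>)

lemma ideal_polyRI:
  assumes "I \<subseteq> polys_in W" "0 \<in> I" "\<And>x y. x \<in> I \<Longrightarrow> y \<in> I \<Longrightarrow> x + y \<in> I"
    "\<And>x r. x \<in> I \<Longrightarrow> r \<in> polys_in W \<Longrightarrow> r * x \<in> I"
  shows "ideal I (polyR W)"
  by (rule cring.idealI'[OF cring_polyR]) (use assms in auto)

lemma ideal_polyRD:
  assumes "ideal I (polyR W)"
  shows "I \<subseteq> polys_in W" "0 \<in> I" "x \<in> I \<Longrightarrow> y \<in> I \<Longrightarrow> x + y \<in> I" "x \<in> I \<Longrightarrow> y \<in> I \<Longrightarrow> x - y \<in> I"
    "x \<in> I \<Longrightarrow> r \<in> polys_in W \<Longrightarrow> r * x \<in> I" "x \<in> I \<Longrightarrow> r \<in> polys_in W \<Longrightarrow> x * r \<in> I"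
proof -
  interpret ideal I "polyR W" by fact
  show 1: "I \<subseteq> polys_in W" using a_subset by simp
  show "0 \<in> I" using additive_subgroup.zero_closed[OF is_additive_subgroup] by simp
  have 2: "x + y \<in> I" if "x \<in> I" "y \<in> I" for x y
    using additive_subgroup.a_closed[OF is_additive_subgroup that] by simp
  have 3: "r * x \<in> I" if "x \<in> I" "r \<in> polys_in W" for x r
    using I_l_closed[of x r] that by simp
  show "x \<in> I \<Longrightarrow> y \<in> I \<Longrightarrow> x + y \<in> I" by (rule 2)
  show "x \<in> I \<Longrightarrow> r \<in> polys_in W \<Longrightarrow> r * x \<in> I" by (rule 3)
  show "x * r \<in> I" if "x \<in> I" "r \<in> polys_in W"
    using 3[OF that] by (simp add: mult.commute)
  show "x - y \<in> I" if "x \<in> I" "y \<in> I"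
    using 2[OF that(1) 3[OF that(2) polys_in_uminus[OF polys_in_1]]] by simp
qed

lemma ideal_polyR_sum:
  assumes "ideal I (polyR W)" "\<And>i. i \<in> A \<Longrightarrow> f i \<in> I" shows "sum f A \<in> I"
  using assms(2) by (induction A rule: infinite_finite_induct) (auto intro: ideal_polyRD[OF assms(1)])

lemma primeideal_polyRI:
  assumes "P \<subseteq> polys_in W" "0 \<in> P" "\<And>x y. x \<in> P \<Longrightarrow> y \<in> P \<Longrightarrow> x + y \<in> P"
    "\<And>x r. x \<in> P \<Longrightarrow> r \<in> polys_in W \<Longrightarrow> r * x \<in> P" "1 \<notin> P"
    "\<And>x y. x \<in> polys_in W \<Longrightarrow> y \<in> polys_in W \<Longrightarrow> x * y \<in> P \<Longrightarrow> x \<in> P \<or> y \<in> P"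
  shows "primeideal P (polyR W)"
proof (rule primeidealI)
  show "ideal P (polyR W)" using assms by (intro ideal_polyRI) auto
  show "carrier (polyR W) \<noteq> P" using assms(5) polys_in_1 by auto
qed (use assms cring_polyR in auto)

lemma primeideal_polyRD:
  assumes "primeideal P (polyR W)"
  shows "ideal P (polyR W)" "1 \<notin> P"
    "x \<in> polys_in W \<Longrightarrow> y \<in> polys_in W \<Longrightarrow> x * y \<in> P \<Longrightarrow> x \<in> P \<or> y \<in> P"
proof -
  interpret primeideal P "polyR W" by fact
  show I: "ideal P (polyR W)" by (rule is_ideal)
  show "1 \<notin> P"
  proof
    assume "1 \<in> P"
    then have "polys_in W \<subseteq> P" using ideal_polyRD(5)[OF I, of 1] by auto
    then show False using ideal_polyRD(1)[OF I] I_notcarr by auto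
  qed
  show "x \<in> polys_in W \<Longrightarrow> y \<in> polys_in W \<Longrightarrow> x * y \<in> P \<Longrightarrow> x \<in> P \<or> y \<in> P" using I_prime[of x y] by simp
qed

lemma primeideal_kernel:
  assumes "rhom (f :: ('v, 'k::field) mp \<Rightarrow> 'b::idom)"
  shows "primeideal {p \<in> polys_in W. f p = 0} (polyR W)"
  by (rule primeideal_polyRI) (auto simp: rhomD[OF assms])


subsection \<open>Isolating one variable\<close>

text \<open>The variable \<open>q\<close> becomes the variable of a univariate polynomial. The coefficients stay in the same
  type of multivariate polynomials, where they no longer involve \<open>q\<close>.\<close>

definition as_poly :: "'v \<Rightarrow> ('v, 'k::field) mp \<Rightarrow> ('v, 'k) mp poly" where
  "as_poly q = mp_eval (\<lambda>c. [:Cst c:]) (\<lambda>i. if i = q then [:0, 1:] else [:Var i:])"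

lemma rhom_Cst_poly: "rhom (\<lambda>c. [:Cst c:])"
  by (rule rhom_comp[OF rhom_const_poly rhom_Cst])

lemma rhom_as_poly: "rhom (as_poly q)"
  unfolding as_poly_def by (rule rhom_mp_eval[OF rhom_Cst_poly])

lemma as_poly_Cst [simp]: "as_poly q (Cst c) = [:Cst c:]"
  and as_poly_Var: "as_poly q (Var i) = (if i = q then [:0, 1:] else [:Var i:])"
  by (simp_all add: as_poly_def mp_eval_Cst mp_eval_Var rhom_Cst_poly)

lemma rhom_poly: "rhom (\<lambda>p. poly p x)"
  by (simp add: rhom_def)

lemma poly_as_poly [simp]: "poly (as_poly q b) (Var q) = b"
  by (rule rhom_eq_on_polys_in[OF rhom_comp[OF rhom_poly rhom_as_poly] rhom_id, where W = UNIV])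
    (auto simp: as_poly_Var)

lemma coeff_as_poly_in:
  assumes "b \<in> polys_in W" shows "coeff (as_poly q b) j \<in> polys_in (W - {q})"
  using assms
proof (induction arbitrary: j rule: polys_in_induct)
  case (Cst c) then show ?case by (cases j) auto
next
  case (Var z) then show ?case by (auto simp: as_poly_Var coeff_pCons polys_in_Var split: nat.split)
next
  case (add p q) then show ?case by (auto simp: rhomD[OF rhom_as_poly])
next
  case (mult p q) then show ?case by (auto simp: rhomD[OF rhom_as_poly] coeff_mult)
qed

lemma as_poly_eq_const: assumes "b \<in> polys_in W" "q \<notin> W" shows "as_poly q b = [:b:]"
  by (rule rhom_eq_on_polys_in[OF rhom_as_poly rhom_const_poly _ _ assms(1)])
    (use assms(2) in \<open>auto simp: as_poly_Var\<close>)

lemma rhom_poly_map_poly: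
  assumes "rhom f" shows "f (poly p x) = poly (map_poly f p) (f x)"
  by (induction p) (auto simp: map_poly_pCons rhomD[OF assms])


subsection \<open>Algebraic independence along a chain of primes\<close>

definition alg_indep :: "nat \<Rightarrow> (nat \<Rightarrow> ('v, 'k::field) mp) \<Rightarrow> ('v, 'k) mp set \<Rightarrow> bool" where
  "alg_indep q h P \<longleftrightarrow> (\<forall>b\<in>polys_in {..<q}. psubst h b \<in> P \<longrightarrow> b = 0)"

text \<open>Write a relation modulo \<open>P\<close> as a polynomial in \<open>h\<^sub>q\<close>. Modulo \<open>Q\<close> only its constant coefficient
  remains, a relation among the first \<open>q\<close> elements, so this coefficient is \<open>0\<close>. As \<open>h\<^sub>q\<close> is not in the
  prime \<open>P\<close>, one factor \<open>h\<^sub>q\<close> can be cancelled, and the argument repeats.\<close>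

lemma alg_indep_Suc:
  fixes h :: "nat \<Rightarrow> ('v, 'k::field) mp"
  assumes P: "primeideal P (polyR W)" and Q: "primeideal Q (polyR W)" and PQ: "P \<subseteq> Q"
    and h: "\<And>i. i \<le> q \<Longrightarrow> h i \<in> polys_in W" and hq: "h q \<in> Q" "h q \<notin> P"
    and ind: "alg_indep q h Q"
  shows "alg_indep (Suc q) h P"
proof -
  note ID = ideal_polyRD[OF primeideal_polyRD(1)[OF P]] ideal_polyRD[OF primeideal_polyRD(1)[OF Q]]
  have in_W: "psubst h a \<in> polys_in W" if "a \<in> polys_in {..<q}" for a
    using that h by (intro mp_eval_in) auto
  have main: "p = 0" if "\<forall>j. coeff p j \<in> polys_in {..<q}" "poly (map_poly (psubst h) p) (h q) \<in> P" for p
    using that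
  proof (induction p)
    case (pCons a p)
    have a: "a \<in> polys_in {..<q}" using pCons.prems(1)[rule_format, of 0] by simp
    have p: "\<forall>j. coeff p j \<in> polys_in {..<q}"
      using pCons.prems(1) by (metis coeff_pCons_Suc)
    let ?r = "poly (map_poly (psubst h) p) (h q)"
    have r: "?r \<in> polys_in W"
      unfolding poly_altdef using in_W p h by (auto simp: coeff_map_poly intro!: polys_in_sum polys_in_mult polys_in_power)
    have eq: "poly (map_poly (psubst h) (pCons a p)) (h q) = psubst h a + h q * ?r"
      by (simp add: map_poly_pCons)
    have "psubst h a + h q * ?r \<in> Q" "h q * ?r \<in> Q" using pCons.prems(2) eq PQ hq(1) r ID by auto
    then have "psubst h a \<in> Q" using ID(10)[of "psubst h a + h q * ?r" "h q * ?r"] by simp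
    then have a0: "a = 0" using ind a by (auto simp: alg_indep_def)
    then have "h q * ?r \<in> P" using pCons.prems(2) eq by simp
    then have "?r \<in> P" using primeideal_polyRD(3)[OF P] hq(2) h r by blast
    then show ?case using pCons.IH p a0 by simp
  qed simp
  show ?thesis unfolding alg_indep_def
  proof (intro ballI impI)
    fix b :: "(nat, 'k) mp" assume b: "b \<in> polys_in {..<Suc q}" "psubst h b \<in> P"
    have "coeff (as_poly q b) j \<in> polys_in {..<q}" for j
      using coeff_as_poly_in[OF b(1), of q j] by (simp add: lessThan_Suc polys_in_def)
    moreover have "psubst h b = poly (map_poly (psubst h) (as_poly q b)) (h q)"
      using rhom_poly_map_poly[OF rhom_psubst, of h "as_poly q b" "Var q"] by simp
    ultimately have "as_poly q b = 0" using main b(2) by metis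
    then show "b = 0" using poly_as_poly[of q b] by simp
  qed
qed

lemma alg_indep_cong:
  "(\<And>i. i < q \<Longrightarrow> h i = h' i) \<Longrightarrow> alg_indep q h P \<longleftrightarrow> alg_indep q h' P"
  using psubst_cong[of _ "{..<q}" h h'] by (auto simp: alg_indep_def)

text \<open>Each step down the chain gains one element: any member of \<open>P\<^sub>i\<^sub>+\<^sub>1\<close> outside \<open>P\<^sub>i\<close>.\<close>

lemma prime_chain_alg_indep:
  fixes h :: "nat \<Rightarrow> ('v, 'k::field) mp"
  assumes "prime_chain (polyR W) k P" "alg_indep q h (P k)" "\<And>i. i < q \<Longrightarrow> h i \<in> polys_in W"
  shows "\<exists>h'. (\<forall>i<q + k. h' i \<in> polys_in W) \<and> alg_indep (q + k) h' (P 0)"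
  using assms
proof (induction k arbitrary: P)
  case (Suc k)
  have pr: "primeideal (P i) (polyR W)" if "i \<le> Suc k" for i using Suc.prems(1) that by (auto simp: prime_chain_def)
  have lt: "P 0 \<subset> P 1" using Suc.prems(1) by (auto simp: prime_chain_def)
  have "prime_chain (polyR W) k (\<lambda>i. P (Suc i))" using Suc.prems(1) by (auto simp: prime_chain_def)
  from Suc.IH[OF this] Suc.prems obtain h' where h': "\<forall>i<q + k. h' i \<in> polys_in W" "alg_indep (q + k) h' (P 1)"
    by auto
  obtain f where f: "f \<in> P 1" "f \<notin> P 0" using lt by auto
  define h'' where "h'' = h'(q + k := f)"
  have "alg_indep (q + k) h'' (P 1)" using h'(2) alg_indep_cong[of "q + k" h'' h'] by (simp add: h''_def)
  moreover have "f \<in> polys_in W" using f ideal_polyRD(1)[OF primeideal_polyRD(1)[OF pr[of 1]]] by auto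
  ultimately have "alg_indep (Suc (q + k)) h'' (P 0)"
    using h'(1) f lt pr by (intro alg_indep_Suc[of "P 0" W "P 1"]) (auto simp: h''_def)
  moreover have "\<forall>i<Suc (q + k). h'' i \<in> polys_in W" using h'(1) \<open>f \<in> polys_in W\<close> by (auto simp: h''_def)
  ultimately show ?case by (intro exI[of _ h'']) auto
qed auto

text \<open>The extended family stays independent under \<open>\<sigma>\<close>, because the kernel of \<open>\<sigma>\<close> lies in \<open>P\<^sub>0\<close>. With the
  identity for \<open>\<sigma>\<close> this bounds heights; with a parametrization it bounds dimensions of quotients.\<close>

lemma prime_chain_length_bound:
  fixes h :: "nat \<Rightarrow> ('v, 'k::field) mp" and \<sigma> :: "'v \<Rightarrow> ('w, 'k) mp"
  assumes ch: "prime_chain (polyR W) k P" and h: "alg_indep q h (P k)" "\<And>i. i < q \<Longrightarrow> h i \<in> polys_in W"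
    and U: "finite U" "\<And>z. z \<in> W \<Longrightarrow> \<sigma> z \<in> polys_in U"
    and ker: "\<And>p. p \<in> polys_in W \<Longrightarrow> psubst \<sigma> p = 0 \<Longrightarrow> p \<in> P 0"
  shows "q + k \<le> card U"
proof -
  obtain h' where h': "\<forall>i<q + k. h' i \<in> polys_in W" "alg_indep (q + k) h' (P 0)"
    using prime_chain_alg_indep[OF ch h] by blast
  show ?thesis
  proof (rule injective_psubst_card_le[OF U(1), of _ "\<lambda>i. psubst \<sigma> (h' i)"])
    show "psubst \<sigma> (h' i) \<in> polys_in U" if "i < q + k" for i
      using h'(1) that U(2) by (intro mp_eval_in) auto
    fix b :: "(nat, 'k) mp" assume b: "b \<in> polys_in {..<q + k}" "psubst (\<lambda>i. psubst \<sigma> (h' i)) b = 0"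
    have "psubst h' b \<in> polys_in W" using b(1) h'(1) by (intro mp_eval_in) auto
    then have "psubst h' b \<in> P 0" using ker b(2) by (simp add: psubst_comp)
    then show "b = 0" using h'(2) b(1) by (auto simp: alg_indep_def)
  qed
qed


section \<open>Hilbert's basis theorem and associated primes\<close>

definition gen :: "'v set \<Rightarrow> (nat \<Rightarrow> ('v, 'k::field) mp) \<Rightarrow> nat \<Rightarrow> ('v, 'k) mp set" where
  "gen W b n = {(\<Sum>i<n. c i * b i) | c. \<forall>i<n. c i \<in> polys_in W}"

lemma genI: "(\<And>i. i < n \<Longrightarrow> c i \<in> polys_in W) \<Longrightarrow> (\<Sum>i<n. c i * b i) \<in> gen W b n"
  by (auto simp: gen_def)

lemma ideal_gen:
  fixes b :: "nat \<Rightarrow> ('v, 'k::field) mp"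
  assumes "\<And>i. i < n \<Longrightarrow> b i \<in> polys_in W" shows "ideal (gen W b n) (polyR W)"
proof (rule ideal_polyRI)
  show "gen W b n \<subseteq> polys_in W" using assms by (auto simp: gen_def intro!: polys_in_sum)
  show "0 \<in> gen W b n" using genI[of n "\<lambda>_. 0" W b] by simp
next
  fix x y assume "x \<in> gen W b n" "y \<in> gen W b n"
  then obtain c d where "x = (\<Sum>i<n. c i * b i)" "\<forall>i<n. c i \<in> polys_in W"
    "y = (\<Sum>i<n. d i * b i)" "\<forall>i<n. d i \<in> polys_in W" by (auto simp: gen_def)
  then show "x + y \<in> gen W b n"
    using genI[of n "\<lambda>i. c i + d i" W b] by (simp add: sum.distrib distrib_right polys_in_add)
next
  fix x r :: "('v, 'k) mp" assume "x \<in> gen W b n" and r: "r \<in> polys_in W"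
  then obtain c where "x = (\<Sum>i<n. c i * b i)" "\<forall>i<n. c i \<in> polys_in W" by (auto simp: gen_def)
  then show "r * x \<in> gen W b n"
    using genI[of n "\<lambda>i. r * c i" W b] r by (simp add: sum_distrib_left mult.assoc polys_in_mult)
qed

lemma gen_base: assumes "i < n" shows "b i \<in> gen W b n"
proof -
  have "(\<Sum>j<n. (if j = i then 1 else 0) * b j) = (\<Sum>j<n. if j = i then b j else 0)"
    by (rule sum.cong) auto
  then show ?thesis using genI[of n "\<lambda>j. if j = i then 1 else 0" W b] assms by simp
qed

lemma gen_cong:
  assumes "\<And>i. i < n \<Longrightarrow> b i = b' i" shows "gen W b n = gen W b' n"
proof -
  have "(\<Sum>i<n. c i * b i) = (\<Sum>i<n. c i * b' i)" for c using assms by (intro sum.cong) auto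
  then show ?thesis by (simp add: gen_def)
qed

lemma gen_least: assumes "ideal I (polyR W)" "\<And>i. i < n \<Longrightarrow> b i \<in> I" shows "gen W b n \<subseteq> I"
  using assms by (auto simp: gen_def intro!: ideal_polyR_sum[OF assms(1)] ideal_polyRD(5)[OF assms(1)])

lemma gen_mono:
  assumes "m \<le> n" "\<And>i. i < n \<Longrightarrow> b i \<in> polys_in W" shows "gen W b m \<subseteq> gen W b n"
  by (rule gen_least[OF ideal_gen]) (use assms gen_base[of _ n b W] in auto)

lemma Idl_eq_gen:
  assumes "\<And>i. i < n \<Longrightarrow> b i \<in> polys_in W" shows "Idl\<^bsub>polyR W\<^esub> (b ` {..<n}) = gen W b n"
proof -
  interpret cring "polyR W" by (rule cring_polyR)
  have sub: "b ` {..<n} \<subseteq> carrier (polyR W)" using assms by auto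
  show ?thesis
  proof
    show "Idl\<^bsub>polyR W\<^esub> (b ` {..<n}) \<subseteq> gen W b n"
      by (rule genideal_minimal[OF ideal_gen]) (use assms gen_base[of _ n b W] in auto)
    show "gen W b n \<subseteq> Idl\<^bsub>polyR W\<^esub> (b ` {..<n})"
      by (rule gen_least[OF genideal_ideal[OF sub]]) (use genideal_self[OF sub] in auto)
  qed
qed

text \<open>The second argument only fixes the coefficient field.\<close>

definition fg_ideals :: "'v set \<Rightarrow> 'k::field itself \<Rightarrow> bool" where
  "fg_ideals W K \<longleftrightarrow> (\<forall>I :: ('v, 'k) mp set. ideal I (polyR W) \<longrightarrow>
     (\<exists>b n. (\<forall>i<n. b i \<in> I) \<and> I \<subseteq> gen W b n))"

text \<open>The union of the ideals generated by initial segments is an ideal, and its finitely many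
  generators already lie in one of them.\<close>

lemma fg_ideals_stationary:
  fixes a :: "nat \<Rightarrow> ('v, 'k::field) mp"
  assumes "fg_ideals W TYPE('k)" and a: "\<And>i. a i \<in> polys_in W"
  obtains n where "a n \<in> gen W a n"
proof -
  have inc: "gen W a m \<subseteq> gen W a n" if "m \<le> n" for m n by (rule gen_mono[OF that a])
  have gid: "ideal (gen W a n) (polyR W)" for n by (rule ideal_gen[OF a])
  have "ideal (\<Union>n. gen W a n) (polyR W)"
  proof (rule ideal_polyRI)
    fix x y assume "x \<in> (\<Union>n. gen W a n)" "y \<in> (\<Union>n. gen W a n)"
    then obtain m n where "x \<in> gen W a m" "y \<in> gen W a n" by auto
    then have "x \<in> gen W a (max m n)" "y \<in> gen W a (max m n)"
      using inc[of m "max m n"] inc[of n "max m n"] by auto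
    then have "x + y \<in> gen W a (max m n)" by (rule ideal_polyRD(3)[OF gid])
    then show "x + y \<in> (\<Union>n. gen W a n)" by blast
  next
    fix x r :: "('v, 'k) mp" assume "x \<in> (\<Union>n. gen W a n)" "r \<in> polys_in W"
    then show "r * x \<in> (\<Union>n. gen W a n)" using ideal_polyRD(5)[OF gid] by blast
  qed (use ideal_polyRD(1,2)[OF gid] in auto)
  with assms(1) obtain b n where b: "\<forall>i<n. b i \<in> (\<Union>n. gen W a n)" "(\<Union>n. gen W a n) \<subseteq> gen W b n"
    unfolding fg_ideals_def by blast
  have "\<forall>i\<in>{..<n}. \<exists>m. b i \<in> gen W a m" using b(1) by auto
  then obtain m where m: "\<And>i. i < n \<Longrightarrow> b i \<in> gen W a (m i)" by (metis lessThan_iff)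
  define M where "M = (\<Sum>i<n. m i)"
  have "b i \<in> gen W a M" if "i < n" for i
  proof -
    have "m i \<le> M" unfolding M_def by (rule member_le_sum) (use that in auto)
    then show ?thesis using m[OF that] inc[of "m i" M] by auto
  qed
  then have "gen W b n \<subseteq> gen W a M" by (intro gen_least gid)
  moreover have "a M \<in> gen W a (Suc M)" by (rule gen_base) simp
  ultimately have "a M \<in> gen W a M" using b(2) by blast
  then show ?thesis by (rule that)
qed

text \<open>Hilbert's argument. If an ideal of \<open>S[z]\<close> were not finitely generated, choose \<open>g\<^sub>0, g\<^sub>1, \<dots>\<close>
  in it, each of least degree outside the ideal generated by its predecessors. Some leading
  coefficient is a combination of the earlier ones, and subtracting the corresponding combination
  of polynomials lowers the degree.\<close>

lemma fg_ideals_insert: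
  fixes W :: "'v set"
  assumes fg: "fg_ideals W TYPE('k::field)" and z: "z \<notin> W"
  shows "fg_ideals (insert z W) TYPE('k)"
  unfolding fg_ideals_def
proof (intro allI impI)
  fix I :: "('v, 'k) mp set" assume I: "ideal I (polyR (insert z W))"
  let ?U = "insert z W"
  define ev where "ev = (\<lambda>p :: ('v, 'k) mp poly. poly p (Var z))"
  define S where "S = {p :: ('v, 'k) mp poly. \<forall>j. coeff p j \<in> polys_in W}"
  have ev_hom: "rhom ev" unfolding ev_def by (rule rhom_poly)
  have evS: "ev p \<in> polys_in ?U" if "p \<in> S" for p
    using that polys_in_mono[of W ?U] unfolding ev_def poly_altdef S_def
    by (auto intro!: polys_in_sum polys_in_mult polys_in_power polys_in_Var)
  have S_as: "as_poly z f \<in> S" "ev (as_poly z f) = f" if "f \<in> polys_in ?U" for f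
    using coeff_as_poly_in[OF that, of z] z by (auto simp: S_def ev_def)
  show "\<exists>b n. (\<forall>i<n. b i \<in> I) \<and> I \<subseteq> gen ?U b n"
  proof (rule ccontr)
    assume nfg: "\<not> (\<exists>b n. (\<forall>i<n. b i \<in> I) \<and> I \<subseteq> gen ?U b n)"
    define G where "G = (\<lambda>(f :: nat \<Rightarrow> ('v, 'k) mp poly) n. gen ?U (\<lambda>i. ev (f i)) n)"
    define C where "C = (\<lambda>f n r. r \<in> S \<and> ev r \<in> I \<and> ev r \<notin> G f n)"
    define P where "P = (\<lambda>f n r. C f n r \<and> (\<forall>r'. C f n r' \<longrightarrow> degree r \<le> degree r'))"
    have G_cong: "G f n = G g n" if "\<And>i. i < n \<Longrightarrow> f i = g i" for f g n
      unfolding G_def by (rule gen_cong) (simp add: that)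
    have "\<exists>f. \<forall>n. P f n (f n)"
    proof (rule dependent_wellorder_choice)
      fix r and f g :: "nat \<Rightarrow> ('v, 'k) mp poly" and n :: nat assume "\<And>i. i < n \<Longrightarrow> f i = g i"
      then show "P f n r = P g n r" using G_cong[of n f g] by (simp add: P_def C_def)
    next
      fix n and f :: "nat \<Rightarrow> ('v, 'k) mp poly" assume f: "\<And>i. i < n \<Longrightarrow> P f i (f i)"
      have fI: "ev (f i) \<in> I" if "i < n" for i using f[OF that] unfolding P_def C_def by (elim conjE)
      have "\<not> I \<subseteq> G f n"
      proof
        assume "I \<subseteq> G f n"
        with fI have "\<exists>b n. (\<forall>i<n. b i \<in> I) \<and> I \<subseteq> gen ?U b n"
          unfolding G_def by (intro exI[of _ "\<lambda>i. ev (f i)"] exI[of _ n]) simp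
        with nfg show False by (rule notE)
      qed
      then obtain x where x: "x \<in> I" "x \<notin> G f n" by blast
      then have "C f n (as_poly z x)" using S_as[of x] ideal_polyRD(1)[OF I] by (auto simp: C_def)
      then show "\<exists>r. P f n r" using ex_has_least_nat[of "C f n" _ degree] unfolding P_def by blast
    qed
    then obtain g where g: "\<And>n. P g n (g n)" by blast
    have gS: "g n \<in> S" and gI: "ev (g n) \<in> I" and gG: "ev (g n) \<notin> G g n"
      and gmin: "C g n r \<Longrightarrow> degree (g n) \<le> degree r" for n r
      using g[of n] unfolding P_def C_def by (elim conjE, blast)+
    have evU: "ev (g i) \<in> polys_in ?U" for i using evS gS by blast
    have mono: "degree (g m) \<le> degree (g n)" if "m \<le> n" for m n
    proof (rule gmin)
      have "G g m \<subseteq> G g n" unfolding G_def by (rule gen_mono[OF that evU])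
      then show "C g m (g n)" using gS gI gG by (auto simp: C_def)
    qed
    define a where "a n = lead_coeff (g n)" for n
    have aW: "a i \<in> polys_in W" for i using gS[of i] by (simp add: a_def S_def)
    obtain n where "a n \<in> gen W a n" by (rule fg_ideals_stationary[OF fg aW])
    then obtain c where c: "\<forall>i<n. c i \<in> polys_in W" "a n = (\<Sum>i<n. c i * a i)" by (auto simp: gen_def)
    define d where "d i = degree (g i)" for i
    (* The degrees d i increase with i, so g i can be lifted to degree d n. *)
    define t where "t = (\<Sum>i<n. Polynomial.monom (c i) (d n - d i) * g i)"
    define h where "h = g n - t"
    have evt: "ev t \<in> G g n"
    proof -
      have "ev t = (\<Sum>i<n. ev (Polynomial.monom (c i) (d n - d i)) * ev (g i))"
        by (simp add: t_def rhom_sum[OF ev_hom] rhomD[OF ev_hom])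
      moreover have "Polynomial.monom (c i) (d n - d i) \<in> S" if "i < n" for i
        using c(1) that by (auto simp: S_def)
      ultimately show ?thesis unfolding G_def by (auto intro!: genI evS)
    qed
    have "t \<in> S"
      unfolding S_def t_def using gS c(1)
      by (auto simp: coeff_sum coeff_mult S_def intro!: polys_in_sum polys_in_mult)
    then have hS: "h \<in> S" using gS[of n] by (auto simp: h_def S_def)
    have Gid: "ideal (G g n) (polyR ?U)" unfolding G_def by (rule ideal_gen[OF evU])
    have "G g n \<subseteq> I" unfolding G_def by (rule gen_least[OF I gI])
    then have hI: "ev h \<in> I" using ideal_polyRD(4)[OF I gI[of n]] evt by (auto simp: h_def rhomD[OF ev_hom])
    have hG: "ev h \<notin> G g n"
    proof
      assume "ev h \<in> G g n"
      then have "ev h + ev t \<in> G g n" using ideal_polyRD(3)[OF Gid] evt by blast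
      then show False using gG[of n] by (simp add: h_def rhomD[OF ev_hom])
    qed
    have deg_t: "degree t \<le> d n"
      unfolding t_def
    proof (rule degree_sum_le)
      fix i assume i: "i \<in> {..<n}"
      have "degree (Polynomial.monom (c i) (d n - d i) * g i) \<le> degree (Polynomial.monom (c i) (d n - d i)) + degree (g i)"
        by (rule degree_mult_le)
      also have "\<dots> \<le> (d n - d i) + d i" unfolding d_def[of i] by (intro add_mono degree_monom_le) auto
      finally show "degree (Polynomial.monom (c i) (d n - d i) * g i) \<le> d n" using mono[of i n] i by (simp add: d_def)
    qed simp
    have "coeff (Polynomial.monom (c i) (d n - d i) * g i) (d n) = c i * a i" if "i < n" for i
      using mono[of i n] that by (simp add: coeff_monom_mult d_def a_def)
    then have "coeff t (d n) = a n" by (simp add: t_def coeff_sum c(2))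
    then have "coeff h (d n) = 0" by (simp add: h_def a_def d_def)
    moreover have "degree h \<le> d n" unfolding h_def using deg_t by (intro degree_diff_le) (auto simp: d_def)
    ultimately have "h = 0 \<or> degree h < d n"
      by (metis le_neq_implies_less leading_coeff_0_iff)
    moreover have "d n \<le> degree h" unfolding d_def by (rule gmin) (simp add: C_def hS hI hG)
    moreover have "h \<noteq> 0" using hG ideal_polyRD(2)[OF Gid] rhomD(4)[OF ev_hom] by auto
    ultimately show False by simp
  qed
qed

theorem fg_ideals_finite:
  assumes "finite W" shows "fg_ideals W TYPE('k::field)"
  using assms
proof (induction W rule: finite_induct)
  case empty
  show ?case unfolding fg_ideals_def
  proof (intro allI impI)
    fix I :: "('a, 'k) mp set" assume I: "ideal I (polyR {})"
    show "\<exists>b n. (\<forall>i<n. b i \<in> I) \<and> I \<subseteq> gen {} b n"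
    proof (cases "I \<subseteq> {0}")
      case True
      then show ?thesis by (intro exI[of _ 0] exI[of _ "\<lambda>_. 0"]) (auto simp: gen_def)
    next
      case False
      then obtain x where x: "x \<in> I" "x \<noteq> 0" by auto
      then obtain c where c: "x = Cst c" using ideal_polyRD(1)[OF I] polys_in_empty by blast
      then have "Cst (inverse c) * x = 1" using x(2) by (simp add: Cst_mult[symmetric])
      then have "1 \<in> I" using ideal_polyRD(5)[OF I x(1), of "Cst (inverse c)"] by simp
      moreover have "I \<subseteq> gen {} (\<lambda>_. 1) 1"
        using ideal_polyRD(1)[OF I] by (auto simp: gen_def)
      ultimately show ?thesis by (intro exI[of _ "\<lambda>_. 1"] exI[of _ 1]) auto
    qed
  qed
next
  case (insert z W)
  then show ?case by (intro fg_ideals_insert)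
qed

theorem noetherian_polyR:
  assumes "finite W" shows "noetherian_ring (polyR W :: ('v, 'k::field) mp ring)"
proof (rule ring.noetherian_ringI)
  show "ring (polyR W :: ('v, 'k) mp ring)" using cring_polyR cring.axioms(1) by blast
  fix I :: "('v, 'k) mp set" assume I: "ideal I (polyR W)"
  then obtain b n where b: "\<forall>i<n. b i \<in> I" "I \<subseteq> gen W b n"
    using fg_ideals_finite[OF assms] unfolding fg_ideals_def by blast
  have in_W: "b i \<in> polys_in W" if "i < n" for i using b(1) that ideal_polyRD(1)[OF I] by auto
  have "I = gen W b n" using b gen_least[OF I] by blast
  also have "\<dots> = Idl\<^bsub>polyR W\<^esub> (b ` {..<n})" by (rule Idl_eq_gen[symmetric]) (rule in_W)
  finally show "\<exists>A\<subseteq>carrier (polyR W). finite A \<and> I = Idl\<^bsub>polyR W\<^esub> A"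
    using in_W by (intro exI[of _ "b ` {..<n}"]) auto
qed

lemma maximal_ideal_in_family:
  fixes F :: "('v, 'k::field) mp set set"
  assumes "finite W" "F \<noteq> {}" "\<And>I. I \<in> F \<Longrightarrow> ideal I (polyR W)"
  shows "\<exists>M\<in>F. \<forall>I\<in>F. M \<subseteq> I \<longrightarrow> I = M"
proof -
  interpret noetherian_ring "polyR W :: ('v, 'k) mp ring" by (rule noetherian_polyR[OF assms(1)])
  show ?thesis
  proof (rule subset_Zorn)
    fix C assume C: "subset.chain F C"
    show "\<exists>U\<in>F. \<forall>I\<in>C. I \<subseteq> U"
    proof (cases "C = {}")
      case False
      have "subset.chain {I. ideal I (polyR W)} C" using C assms(3) by (auto simp: subset.chain_def)
      then have "\<Union>C \<in> C" using ideal_chain_is_trivial[OF False] by blast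
      then show ?thesis using C by (intro bexI[of _ "\<Union>C"]) (auto simp: subset.chain_def)
    qed (use assms(2) in auto)
  qed
qed

text \<open>A maximal member \<open>J : f\<close> of the family of colon ideals contained in \<open>P\<close> is prime: multiplying
  \<open>f\<close> by a further element can only enlarge the colon ideal, so it either leaves it unchanged or
  makes it leave \<open>P\<close>. Minimality of \<open>P\<close> then forces \<open>J : f = P\<close>.\<close>

lemma minimal_prime_associated:
  fixes P :: "('v, 'k::field) mp set"
  assumes W: "finite W" and J: "ideal J (polyR W)" and P: "primeideal P (polyR W)" and JP: "J \<subseteq> P"
    and minimal: "\<And>Q. primeideal Q (polyR W) \<Longrightarrow> J \<subseteq> Q \<Longrightarrow> Q \<subseteq> P \<Longrightarrow> Q = P"
  shows "P \<in> associated_primes (polyR W) J"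
proof -
  define col where "col f = {r \<in> polys_in W. r * f \<in> J}" for f
  have col_ideal: "ideal (col f) (polyR W)" if "f \<in> polys_in W" for f
    by (rule ideal_polyRI)
      (auto simp: col_def distrib_right mult.assoc ideal_polyRD[OF J])
  have Jcol: "J \<subseteq> col f" if "f \<in> polys_in W" for f
    using that ideal_polyRD[OF J] by (auto simp: col_def)
  let ?F = "{col f | f. f \<in> polys_in W \<and> col f \<subseteq> P}"
  have "col 1 \<in> ?F" using JP by (auto simp: col_def intro!: exI[of _ 1])
  then have ne: "?F \<noteq> {}" by blast
  have F_ideal: "ideal I (polyR W)" if "I \<in> ?F" for I using that col_ideal by blast
  have "\<exists>M\<in>?F. \<forall>I\<in>?F. M \<subseteq> I \<longrightarrow> I = M"
    by (rule maximal_ideal_in_family[OF W ne]) (rule F_ideal)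
  then obtain M where "M \<in> ?F" and M: "\<forall>I\<in>?F. M \<subseteq> I \<longrightarrow> I = M" by (elim bexE)
  then obtain f where f: "f \<in> polys_in W" "M = col f" "col f \<subseteq> P" by blast
  have max: "col (g * f) = col f" if "g \<in> polys_in W" "col (g * f) \<subseteq> P" for g
  proof -
    have "col f \<subseteq> col (g * f)"
      using that(1) ideal_polyRD(5)[OF J, of _ g] by (auto simp: col_def mult.left_commute[of _ g f])
    moreover have "col (g * f) \<in> ?F" using that f(1) by (blast intro: polys_in_mult)
    ultimately show ?thesis using M f(2) by simp
  qed
  note Pp = primeideal_polyRD(3)[OF P]
  have "primeideal (col f) (polyR W)"
  proof (rule primeideal_polyRI)
    show "1 \<notin> col f" using f(3) primeideal_polyRD(2)[OF P] by auto
    fix a b assume ab: "a \<in> polys_in W" "b \<in> polys_in W" "a * b \<in> col f"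
    show "a \<in> col f \<or> b \<in> col f"
    proof (cases "col (a * f) \<subseteq> P")
      case True
      then have "b \<in> col f" using max[OF ab(1) True] ab by (auto simp: col_def mult_ac)
      then show ?thesis by blast
    next
      case False
      then obtain s where s: "s \<in> polys_in W" "s * (a * f) \<in> J" "s \<notin> P" by (auto simp: col_def)
      (* As s is not in P, passing from f to s * f stays in the family. *)
      have "col (s * f) \<subseteq> P"
      proof
        fix r assume r: "r \<in> col (s * f)"
        then have "r * s \<in> P" using f(3) s(1) by (auto simp: col_def mult.assoc)
        then show "r \<in> P" using Pp[of r s] s r by (auto simp: col_def)
      qed
      from max[OF s(1) this] have "a \<in> col f" using s ab by (auto simp: col_def mult_ac)
      then show ?thesis by blast
    qed
  qed (use ideal_polyRD[OF col_ideal[OF f(1)]] in auto)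
  then have "col f = P" using minimal Jcol f by blast
  then show ?thesis using P f(1) by (auto simp: associated_primes_def col_def)
qed


section \<open>The primes attached to vertex sets\<close>

text \<open>A linear order on the indeterminates provides the \<^class>\<open>idom\<close> instance of the polynomials
  in them.\<close>

instantiation indet :: (linorder) linorder
begin

definition less_eq_indet :: "'a indet \<Rightarrow> 'a indet \<Rightarrow> bool" where
  "less_eq_indet s t = (case s of X a \<Rightarrow> (case t of X b \<Rightarrow> a \<le> b | Y b \<Rightarrow> True)
     | Y a \<Rightarrow> (case t of X b \<Rightarrow> False | Y b \<Rightarrow> a \<le> b))"

definition less_indet :: "'a indet \<Rightarrow> 'a indet \<Rightarrow> bool" where
  "less_indet s t \<longleftrightarrow> s \<le> t \<and> \<not> t \<le> s"

instance
  by intro_classes (auto simp: less_eq_indet_def less_indet_def split: indet.splits)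

end

lemma Var_nonzero [simp]: "Var z \<noteq> 0"
  unfolding Var_def by (metis lookup_single_eq lookup_zero zero_neq_one)

lemma Var_eq_iff [simp]: "(Var z :: ('v, 'k::field) mp) = Var w \<longleftrightarrow> z = w"
proof
  assume "(Var z :: ('v, 'k) mp) = Var w"
  then have "keys (Var z :: ('v, 'k) mp) = keys (Var w :: ('v, 'k) mp)" by simp
  then have "single z (1::nat) = single w 1" by (simp add: Var_def)
  then have "keys (single z (1::nat)) = keys (single w (1::nat))" by simp
  then show "z = w" by simp
qed simp

subsection \<open>Monomial substitutions\<close>

text \<open>Distinct monomials go to distinct monomials, so nothing cancels.\<close>

lemma psubst_monomial_injective:
  fixes \<sigma> :: "'v \<Rightarrow> ('w, 'k::field) mp"
  assumes mono: "\<And>m. keys m \<subseteq> W \<Longrightarrow> mono_eval \<sigma> m = single (\<epsilon> m) 1"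
    and inj: "inj_on \<epsilon> {m. keys m \<subseteq> W}"
    and p: "p \<in> polys_in W" "psubst \<sigma> p = 0"
  shows "p = 0"
proof (rule poly_mapping_eqI)
  fix m
  have W: "keys n \<subseteq> W" if "n \<in> keys p" for n
    using p(1) that by (auto simp: polys_in_def)
  show "lookup p m = lookup 0 m"
  proof (cases "m \<in> keys p")
    case True
    have "psubst \<sigma> p = (\<Sum>n\<in>keys p. single (\<epsilon> n) (lookup p n))"
      unfolding mp_eval_def by (rule sum.cong) (auto simp: mono W Cst_def mult_single)
    then have "lookup (psubst \<sigma> p) (\<epsilon> m) =
        (\<Sum>n\<in>keys p. lookup p n when \<epsilon> n = \<epsilon> m)"
      by (simp add: lookup_sum lookup_single)
    then have "0 = (\<Sum>n\<in>keys p. lookup p n when \<epsilon> n = \<epsilon> m)"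
      using p(2) by simp
    also have "\<dots> = (\<Sum>n\<in>keys p. if n = m then lookup p n else 0)"
      using inj_onD[OF inj] W True by (intro sum.cong) (auto simp: when_def)
    also have "\<dots> = lookup p m" using True by simp
    finally show ?thesis by simp
  qed (simp add: in_keys_iff)
qed

lemma mono_eval_single:
  fixes e :: "'v \<Rightarrow> ('w \<Rightarrow>\<^sub>0 nat)"
  assumes "\<And>z. z \<in> keys m \<Longrightarrow> \<sigma> z = single (e z) (1::'k::field)"
  shows "\<exists>E. mono_eval \<sigma> m = single E 1 \<and>
    (\<forall>t. lookup E t = (\<Sum>z\<in>keys m. lookup m z * lookup (e z) t))"
proof (intro exI conjI allI)
  have pow: "single a (1::'k) ^ n = single (\<Sum>k<n. a) 1" for a :: "'w \<Rightarrow>\<^sub>0 nat" and n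
    by (induction n) (auto simp: mult_single add.commute)
  have pr: "(\<Prod>z\<in>A. single (f z) (1::'k)) = single (sum f A) 1" for f :: "'v \<Rightarrow> ('w \<Rightarrow>\<^sub>0 nat)" and A
    by (induction A rule: infinite_finite_induct) (auto simp: mult_single)
  let ?E = "\<Sum>z\<in>keys m. \<Sum>k<lookup m z. e z"
  have "mono_eval \<sigma> m = (\<Prod>z\<in>keys m. single (\<Sum>k<lookup m z. e z) 1)"
    unfolding mono_eval_def by (rule prod.cong) (auto simp: assms pow)
  then show "mono_eval \<sigma> m = single ?E 1" by (simp only: pr)
  show "lookup ?E t = (\<Sum>z\<in>keys m. lookup m z * lookup (e z) t)" for t
    by (simp add: lookup_sum)
qed


lemma prime_chain_snoc:
  assumes "prime_chain R n C" "C n \<subset> Q" "primeideal Q R"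
  shows "prime_chain R (Suc n) (C(Suc n := Q))"
  using assms by (auto simp: prime_chain_def le_Suc_eq less_Suc_eq)

subsection \<open>A family of parametrized primes\<close>

text \<open>The function \<open>r\<close> chooses a representative in each block of a partition of \<open>V - S\<close>. The blocks of
  interest are the components of a graph after deletion of \<open>S\<close>.\<close>

locale vertex_set =
  fixes V S :: "'a::linorder set" and r :: "'a \<Rightarrow> 'a"
  assumes fin: "finite V" and SV: "S \<subseteq> V"
    and r_in: "i \<in> V - S \<Longrightarrow> r i \<in> V - S" and r_idem: "i \<in> V - S \<Longrightarrow> r (r i) = r i"
begin

abbreviation "U \<equiv> X ` V \<union> Y ` V"

definition nonreps :: "'a set" where "nonreps = {i \<in> V - S. r i \<noteq> i}"

text \<open>The variables in \<open>Z\<close> are killed, and for \<open>i\<close> in \<open>D\<close> the pair \<open>(x\<^sub>i, y\<^sub>i)\<close> becomes proportional to the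
  pair of its representative. Enlarging \<open>Z\<close> and \<open>D\<close> by one element at a time gives a chain of prime
  kernels that ends in \<open>PS\<close>.\<close>

definition param :: "'a indet set \<Rightarrow> 'a set \<Rightarrow> 'a indet \<Rightarrow> ('a indet, 'k::field) mp" where
  "param Z D z = (case z of
      X i \<Rightarrow> if X i \<in> Z then 0 else Var (X i)
    | Y i \<Rightarrow> if i \<in> S then (if Y i \<in> Z then 0 else Var (Y i))
             else Var (X i) * Var (Y (if i \<in> D then r i else i)))"

definition param_kernel :: "'a indet set \<Rightarrow> 'a set \<Rightarrow> ('a indet, 'k::field) mp set" where
  "param_kernel Z D = {p \<in> polys_in U. psubst (param Z D) p = 0}"

definition PS :: "('a indet, 'k::field) mp set" where
  "PS = param_kernel (X ` S \<union> Y ` S) nonreps"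

lemma prime_param_kernel: "primeideal (param_kernel Z D) (polyR U)"
  unfolding param_kernel_def by (rule primeideal_kernel[OF rhom_psubst])

lemma param_kernel_less_insert_var:
  assumes Z: "Z \<subseteq> X ` S \<union> Y ` S" and z: "z \<in> X ` S \<union> Y ` S" "z \<notin> Z" and D: "D \<subseteq> nonreps"
  shows "(param_kernel Z D :: ('a indet, 'k::field) mp set) \<subset> param_kernel (insert z Z) D"
proof
  let ?k = "\<lambda>w. if w = z then 0 else Var w :: ('a indet, 'k) mp"
  have eq: "psubst ?k (param Z D w) = param (insert z Z) D w" if "w \<in> U" for w
    using that Z z D r_in unfolding param_def nonreps_def
    by (cases w) (auto split: if_splits)
  have "psubst (param (insert z Z) D) p = psubst ?k (psubst (param Z D) p)" if "p \<in> polys_in U" for p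
    unfolding psubst_comp by (rule psubst_cong[OF that]) (simp add: eq)
  then show "(param_kernel Z D :: ('a indet, 'k) mp set) \<subseteq> param_kernel (insert z Z) D" by (auto simp: param_kernel_def)
  have "z \<in> U" using z SV by auto
  then have "(Var z :: ('a indet, 'k) mp) \<in> param_kernel (insert z Z) D" "(Var z :: ('a indet, 'k) mp) \<notin> param_kernel Z D"
    using z Z by (auto simp: param_kernel_def param_def polys_in_Var)
  then show "(param_kernel Z D :: ('a indet, 'k) mp set) \<noteq> param_kernel (insert z Z) D" by blast
qed

text \<open>The kernel gains the minor of the columns of \<open>i\<close> and its representative.\<close>

lemma param_kernel_less_insert_vertex:
  assumes Z: "Z \<subseteq> X ` S \<union> Y ` S" and D: "D \<subseteq> nonreps" and i: "i \<in> nonreps" "i \<notin> D"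
  shows "(param_kernel Z D :: ('a indet, 'k::field) mp set) \<subset> param_kernel Z (insert i D)"
proof
  let ?k = "\<lambda>w. if w = Y i then Var (Y (r i)) else Var w :: ('a indet, 'k) mp"
  have iV: "i \<in> V - S" "r i \<noteq> i" "r i \<in> V - S" "r (r i) = r i"
    using i r_in r_idem by (auto simp: nonreps_def)
  have nr: "r j \<noteq> i" if "j \<in> V - S" for j using r_idem[OF that] iV by auto
  have riD: "r i \<notin> D" using D iV by (auto simp: nonreps_def)
  have eq: "psubst ?k (param Z D w) = param Z (insert i D) w" if "w \<in> U" for w
    using that Z D iV nr unfolding param_def nonreps_def
    by (cases w) (auto split: if_splits)
  have "psubst (param Z (insert i D)) p = psubst ?k (psubst (param Z D) p)" if "p \<in> polys_in U" for p
    unfolding psubst_comp by (rule psubst_cong[OF that]) (simp add: eq)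
  then show "(param_kernel Z D :: ('a indet, 'k) mp set) \<subseteq> param_kernel Z (insert i D)" by (auto simp: param_kernel_def)
  (* The witness for strictness. *)
  let ?f = "Var (X (r i)) * Var (Y i) - Var (X i) * Var (Y (r i)) :: ('a indet, 'k) mp"
  have inU: "?f \<in> polys_in U" using iV by (auto intro!: polys_in_diff polys_in_mult polys_in_Var)
  have XZ: "X i \<notin> Z" "X (r i) \<notin> Z" using Z iV by auto
  have "psubst (param Z D) ?f = Var (X i) * Var (X (r i)) * (Var (Y i) - Var (Y (r i)))"
    using iV XZ i riD by (simp add: param_def algebra_simps)
  also have "\<dots> \<noteq> 0" using iV by simp
  finally have "?f \<notin> param_kernel Z D" by (simp add: param_kernel_def)
  moreover have "psubst (param Z (insert i D)) ?f = 0"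
    using iV XZ riD by (simp add: param_def algebra_simps)
  then have "?f \<in> param_kernel Z (insert i D)" using inU by (simp add: param_kernel_def)
  ultimately show "(param_kernel Z D :: ('a indet, 'k) mp set) \<noteq> param_kernel Z (insert i D)" by blast
qed

lemma chain_to_PS:
  "\<exists>C. prime_chain (polyR U :: ('a indet, 'k::field) mp ring) (2 * card S + card nonreps) C
     \<and> C (2 * card S + card nonreps) = PS"
proof -
  let ?Z = "X ` S \<union> Y ` S"
  have finS: "finite S" "finite nonreps" using fin SV finite_subset by (auto simp: nonreps_def)
  have Z: "\<exists>C. prime_chain (polyR U :: ('a indet, 'k) mp ring) (card Z) C \<and> C (card Z) = param_kernel Z {}"
    if "finite Z" "Z \<subseteq> ?Z" for Z
    using that
  proof (induction Z rule: finite_induct)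
    case empty
    show ?case by (rule exI[of _ "\<lambda>_. param_kernel {} {}"]) (simp add: prime_chain_def prime_param_kernel)
  next
    case (insert z Z)
    then obtain C where C: "prime_chain (polyR U :: ('a indet, 'k) mp ring) (card Z) C" "C (card Z) = param_kernel Z {}" by auto
    have "C (card Z) \<subset> param_kernel (insert z Z) {}" unfolding C(2) using insert by (intro param_kernel_less_insert_var) auto
    note ch = prime_chain_snoc[OF C(1) this prime_param_kernel]
    have "card (insert z Z) = Suc (card Z)" using insert by simp
    then show ?case using ch by (metis fun_upd_same)
  qed
  have card_Z: "card ?Z = 2 * card S"
    using finS(1) by (subst card_Un_disjoint) (auto simp: card_image inj_on_def)
  have D: "\<exists>C. prime_chain (polyR U :: ('a indet, 'k) mp ring) (2 * card S + card D) C \<and> C (2 * card S + card D) = param_kernel ?Z D"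
    if "finite D" "D \<subseteq> nonreps" for D
    using that
  proof (induction D rule: finite_induct)
    case empty
    show ?case using Z[of ?Z] finS card_Z by auto
  next
    case (insert i D)
    let ?n = "2 * card S + card D"
    obtain C where C: "prime_chain (polyR U :: ('a indet, 'k) mp ring) ?n C" "C ?n = param_kernel ?Z D" using insert by auto
    have "C ?n \<subset> param_kernel ?Z (insert i D)" unfolding C(2) using insert by (intro param_kernel_less_insert_vertex) auto
    note ch = prime_chain_snoc[OF C(1) this prime_param_kernel]
    have "2 * card S + card (insert i D) = Suc ?n" using insert by simp
    then show ?case using ch by (metis fun_upd_same)
  qed
  show ?thesis unfolding PS_def by (rule D) (use finS in auto)
qed

abbreviation "free_vars \<equiv> X ` (V - S) \<union> Y ` r ` (V - S)"

lemma param_PS: "param (X ` S \<union> Y ` S) nonreps z =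
    (case z of X i \<Rightarrow> if i \<in> S then 0 else Var (X i) | Y i \<Rightarrow> if i \<in> S then 0 else Var (X i) * Var (Y (if i \<in> nonreps then r i else i)))"
  by (auto simp: param_def split: indet.splits)

lemma PS_iff: "p \<in> PS \<longleftrightarrow> p \<in> polys_in U \<and> psubst (param (X ` S \<union> Y ` S) nonreps) p = 0"
  by (simp add: PS_def param_kernel_def)

text \<open>The exponents of a monomial in the free variables can be read off from those of its image.\<close>

lemma free_vars_independent:
  fixes p :: "('a indet, 'k::field) mp"
  assumes p: "p \<in> polys_in free_vars" "p \<in> PS"
  shows "p = 0"
proof -
  let ?s = "param (X ` S \<union> Y ` S) nonreps :: 'a indet \<Rightarrow> ('a indet, 'k) mp"
  define e :: "'a indet \<Rightarrow> ('a indet \<Rightarrow>\<^sub>0 nat)" where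
    "e z = (case z of X i \<Rightarrow> single (X i) 1
       | Y i \<Rightarrow> single (X i) 1 + single (Y i) 1)" for z
  have rr: "r i = i" "i \<notin> S" if "i \<in> r ` (V - S)" for i using that r_in r_idem by auto
  have s: "?s z = single (e z) 1" if "z \<in> free_vars" for z
  proof (cases z)
    case (X i)
    then show ?thesis using that by (auto simp: param_PS e_def Var_def)
  next
    case (Y i)
    then have "i \<in> r ` (V - S)" using that by auto
    then have "i \<notin> S" "i \<notin> nonreps" using rr[of i] by (auto simp: nonreps_def)
    then show ?thesis using Y by (simp add: param_PS e_def Var_def mult_single)
  qed
  have ex: "\<exists>E. mono_eval ?s m = single E 1 \<and>
      (\<forall>t. lookup E t = (\<Sum>z\<in>keys m. lookup m z * lookup (e z) t))"
    if "keys m \<subseteq> free_vars" for m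
  proof -
    have "?s z = single (e z) 1" if "z \<in> keys m" for z
      by (rule s[OF subsetD[OF \<open>keys m \<subseteq> free_vars\<close> that]])
    then show ?thesis by (rule mono_eval_single)
  qed
  define \<epsilon> where "\<epsilon> m = (SOME E. mono_eval ?s m = single E 1 \<and>
      (\<forall>t. lookup E t = (\<Sum>z\<in>keys m. lookup m z * lookup (e z) t)))" for m
  have \<epsilon>: "mono_eval ?s m = single (\<epsilon> m) 1"
    and look: "lookup (\<epsilon> m) t = (\<Sum>z\<in>keys m. lookup m z * lookup (e z) t)"
    if "keys m \<subseteq> free_vars" for m t
    using someI_ex[OF ex[OF that]] unfolding \<epsilon>_def by (elim conjE, simp)+
  have sum_at: "(\<Sum>z\<in>keys m. lookup m z * (if z = w then 1 else 0)) = lookup m w"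
    for m :: "'a indet \<Rightarrow>\<^sub>0 nat" and w
  proof -
    have "(\<Sum>z\<in>keys m. lookup m z * (if z = w then 1 else 0)) =
        (\<Sum>z\<in>keys m. if z = w then lookup m z else 0)"
      by (rule sum.cong) auto
    then show ?thesis by (simp add: in_keys_iff)
  qed
  have lookY: "lookup (\<epsilon> m) (Y i) = lookup m (Y i)" if "keys m \<subseteq> free_vars" for m i
    unfolding look[OF that] sum_at[of m "Y i", symmetric]
    by (rule sum.cong) (auto simp: e_def lookup_add lookup_single when_def split: indet.split)
  have lookX: "lookup (\<epsilon> m) (X i) = lookup m (X i) + lookup m (Y i)"
    if "keys m \<subseteq> free_vars" for m i
    unfolding look[OF that] sum_at[of m "Y i", symmetric] sum_at[of m "X i", symmetric] sum.distrib[symmetric]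
    by (rule sum.cong) (auto simp: e_def lookup_add lookup_single when_def split: indet.split)
  have "inj_on \<epsilon> {m. keys m \<subseteq> free_vars}"
  proof (rule inj_onI)
    fix m n assume mn: "m \<in> {m. keys m \<subseteq> free_vars}" "n \<in> {m. keys m \<subseteq> free_vars}" "\<epsilon> m = \<epsilon> n"
    have "lookup m z = lookup n z" for z
    proof (cases z)
      case (X i) then show ?thesis using lookX[of m i] lookX[of n i] lookY[of m i] lookY[of n i] mn by simp
    next
      case (Y i) then show ?thesis using lookY[of m i] lookY[of n i] mn by simp
    qed
    then show "m = n" by (rule poly_mapping_eqI)
  qed
  then show ?thesis using psubst_monomial_injective[OF \<epsilon>] p by (simp add: PS_iff)
qed

end

text \<open>This translates independence of a set of variables into the indexed form used for chains.\<close>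

lemma alg_indep_Vars:
  fixes P :: "('v, 'k::field) mp set"
  assumes "finite W" and ind: "\<And>p. p \<in> polys_in W \<Longrightarrow> p \<in> P \<Longrightarrow> p = 0"
  obtains h where "alg_indep (card W) h P" "\<And>i. i < card W \<Longrightarrow> h i \<in> polys_in W"
proof -
  obtain g where g: "bij_betw g {..<card W} W" using assms(1) ex_bij_betw_nat_finite atLeast0LessThan by metis
  define h where "h = (\<lambda>i. Var (g i) :: ('v, 'k) mp)"
  define g' where "g' = the_inv_into {..<card W} g"
  have g': "g' (g i) = i" if "i < card W" for i
    unfolding g'_def using g that by (simp add: bij_betw_def the_inv_into_f_f)
  have hW: "h i \<in> polys_in W" if "i < card W" for i
    using g that by (auto simp: h_def bij_betw_def intro!: polys_in_Var)
  have "alg_indep (card W) h P"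
    unfolding alg_indep_def
  proof (intro ballI impI)
    fix b :: "(nat, 'k) mp" assume b: "b \<in> polys_in {..<card W}" "psubst h b \<in> P"
    have "psubst h b \<in> polys_in W" using b(1) hW by (intro mp_eval_in) auto
    then have "psubst h b = 0" using ind b(2) by blast
    then have "psubst (\<lambda>z. Var (g' z) :: (nat, 'k) mp) (psubst h b) = 0" by simp
    moreover have "psubst (\<lambda>z. Var (g' z)) (psubst h b) = b"
      unfolding psubst_comp by (rule psubst_Var_id[OF b(1)]) (simp add: h_def g')
    ultimately show "b = 0" by simp
  qed
  then show ?thesis using that hW by blast
qed

lemma prime_height_eqI:
  assumes "\<exists>C. prime_chain R n C \<and> C n = P" "\<And>k C. prime_chain R k C \<Longrightarrow> C k = P \<Longrightarrow> k \<le> n"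
  shows "prime_height R P = enat n"
  unfolding prime_height_def
proof (rule antisym)
  show "Sup {enat n | n. \<exists>C. prime_chain R n C \<and> C n = P} \<le> enat n"
    using assms(2) by (intro Sup_least) auto
  show "enat n \<le> Sup {enat n | n. \<exists>C. prime_chain R n C \<and> C n = P}"
    using assms(1) by (intro Sup_upper) auto
qed

context vertex_set begin

text \<open>The chain of kernels gives the lower bound. The upper bound holds because the free variables
  are independent modulo \<open>PS\<close>, and \<open>2 * card V\<close> minus their number is the claimed value.\<close>

lemma height_PS: "prime_height (polyR U :: ('a indet, 'k::field) mp ring) PS = enat (2 * card S + card nonreps)"
proof (rule prime_height_eqI[OF chain_to_PS])
  fix k and C :: "nat \<Rightarrow> ('a indet, 'k) mp set"
  assume C: "prime_chain (polyR U) k C" "C k = PS"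
  have finW: "finite free_vars" using fin by auto
  obtain h where h: "alg_indep (card free_vars) h (PS :: ('a indet, 'k) mp set)"
    "\<And>i. i < card free_vars \<Longrightarrow> h i \<in> polys_in free_vars"
    using alg_indep_Vars[OF finW free_vars_independent] by blast
  have sub: "free_vars \<subseteq> U" using r_in by auto
  have "card free_vars + k \<le> card U"
  proof (rule prime_chain_length_bound[OF C(1), where h = h and \<sigma> = Var])
    show "alg_indep (card free_vars) h (C k)" using h C by simp
    show "h i \<in> polys_in U" if "i < card free_vars" for i using h(2)[OF that] polys_in_mono[OF sub] by blast
    show "finite U" using fin by auto
    show "p \<in> C 0" if "psubst Var p = 0" for p :: "('a indet, 'k) mp"
    proof -
      have "p = 0" using that psubst_Var_id[of p UNIV Var] by simp
      moreover have "primeideal (C 0) (polyR U)" using C by (simp add: prime_chain_def)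
      ultimately show ?thesis using ideal_polyRD(2)[OF primeideal_polyRD(1)] by blast
    qed
  qed (auto intro: polys_in_Var)
  moreover have "card U = 2 * card V"
    using fin by (subst card_Un_disjoint) (auto simp: card_image inj_on_def)
  moreover have "card free_vars = card (V - S) + card (r ` (V - S))"
    using fin by (subst card_Un_disjoint) (auto simp: card_image inj_on_def)
  moreover have "card (V - S) = card (r ` (V - S)) + card nonreps"
  proof -
    have "V - S = r ` (V - S) \<union> nonreps"
    proof (intro equalityI subsetI)
      fix x assume x: "x \<in> V - S"
      show "x \<in> r ` (V - S) \<union> nonreps"
      proof (cases "r x = x")
        case True
        then have "x = r x" by simp
        then show ?thesis using x by blast
      qed (use x in \<open>simp add: nonreps_def\<close>)
    next
      fix x assume "x \<in> r ` (V - S) \<union> nonreps"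
      then show "x \<in> V - S" using r_in unfolding nonreps_def by blast
    qed
    moreover have "r ` (V - S) \<inter> nonreps = {}"
    proof (intro equals0I, elim IntE imageE)
      fix x y assume "x \<in> nonreps" "x = r y" "y \<in> V - S"
      then show False using r_idem[of y] by (simp add: nonreps_def)
    qed
    moreover have "finite (r ` (V - S))" "finite nonreps" using fin by (simp_all add: nonreps_def)
    ultimately show ?thesis using card_Un_disjoint[of "r ` (V - S)" nonreps] by metis
  qed
  moreover have "card V = card S + card (V - S)"
    using card_Un_disjoint[of S "V - S"] fin SV finite_subset[OF SV fin] by (simp add: Un_absorb1)
  ultimately show "k \<le> 2 * card S + card nonreps" by linarith
qed

end


section \<open>Minimal primes of binomial edge ideals\<close>

definition bin :: "'a \<Rightarrow> 'a \<Rightarrow> ('a indet, 'k::field) mp" where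
  "bin i j = Var (X i) * Var (Y j) - Var (X j) * Var (Y i)"

text \<open>Two minors that share a column combine to a third minor times a variable of that column, so
  modulo a prime one of the two factors can be cancelled.\<close>

lemma bin_exchange:
  "Var (X k) * bin i j - Var (X j) * bin i k = Var (X i) * bin k j"
  "Var (Y k) * bin i j - Var (Y j) * bin i k = Var (Y i) * bin k j"
  by (simp_all add: bin_def algebra_simps)

lemma bin_swap: "bin j i = - bin i j" and bin_refl [simp]: "bin i i = 0"
  by (simp_all add: bin_def)

lemma bin_in_polys: "i \<in> V \<Longrightarrow> j \<in> V \<Longrightarrow> bin i j \<in> polys_in (X ` V \<union> Y ` V)"
  by (auto simp: bin_def intro!: polys_in_diff polys_in_mult polys_in_Var)

lemma edge_verts:
  assumes "simple_graph G" "{i, j} \<in> edges G" shows "i \<in> verts G" "j \<in> verts G" "i \<noteq> j"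
  using assms by (auto simp: simple_graph_def)

abbreviation gvars :: "'a graph \<Rightarrow> 'a indet set" where
  "gvars G \<equiv> X ` verts G \<union> Y ` verts G"

lemma binomial_edge_ideal_props:
  fixes K :: "'k::field itself" and G :: "'a::linorder graph"
  assumes G: "simple_graph G"
  shows "ideal (binomial_edge_ideal K G) (polyR (gvars G))"
    and "{i, j} \<in> edges G \<Longrightarrow> bin i j \<in> binomial_edge_ideal K G"
    and "ideal I (polyR (gvars G)) \<Longrightarrow> (\<And>i j. {i, j} \<in> edges G \<Longrightarrow> bin i j \<in> I) \<Longrightarrow> binomial_edge_ideal K G \<subseteq> I"
proof -
  let ?B = "{indet (X i) * indet (Y j) - indet (X j) * indet (Y i) | i j. {i, j} \<in> edges G \<and> i < j} :: ('a, 'k) mpoly set"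
  have B: "?B = {bin i j | i j. {i, j} \<in> edges G \<and> i < j}" by (simp add: bin_def indet_eq_Var)
  have J: "binomial_edge_ideal K G = Idl\<^bsub>polyR (gvars G)\<^esub> ?B"
    by (simp add: binomial_edge_ideal_def edge_ring_eq_polyR)
  interpret cring "polyR (gvars G) :: ('a indet, 'k) mp ring" by (rule cring_polyR)
  have sub: "?B \<subseteq> carrier (polyR (gvars G))"
    unfolding B using edge_verts[OF G] by (auto intro!: bin_in_polys)
  show id: "ideal (binomial_edge_ideal K G) (polyR (gvars G))" unfolding J by (rule genideal_ideal[OF sub])
  have lt: "bin i j \<in> binomial_edge_ideal K G" if "{i, j} \<in> edges G" "i < j" for i j
    unfolding J using that by (intro subsetD[OF genideal_self[OF sub]]) (unfold B, blast)
  show "bin i j \<in> binomial_edge_ideal K G" if e: "{i, j} \<in> edges G"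
  proof (cases "i < j")
    case False
    then have "j < i" using edge_verts(3)[OF G e] by simp
    then have "bin j i \<in> binomial_edge_ideal K G" using lt e by (simp add: insert_commute)
    then have "0 - bin j i \<in> binomial_edge_ideal K G" using ideal_polyRD(2,4)[OF id] by blast
    then show ?thesis by (simp add: bin_swap[of j i])
  qed (use lt e in simp)
  assume "ideal I (polyR (gvars G))" "\<And>i j. {i, j} \<in> edges G \<Longrightarrow> bin i j \<in> I"
  then show "binomial_edge_ideal K G \<subseteq> I" unfolding J by (intro genideal_minimal) (unfold B, auto)
qed

context vertex_set begin

lemma param_PS_notin: "i \<in> V - S \<Longrightarrow> param (X ` S \<union> Y ` S) nonreps (X i) = Var (X i)"
  "i \<in> V - S \<Longrightarrow> param (X ` S \<union> Y ` S) nonreps (Y i) = Var (X i) * Var (Y (r i))"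
  unfolding param_PS by (auto simp: nonreps_def)

lemma param_PS_in: "i \<in> S \<Longrightarrow> param (X ` S \<union> Y ` S) nonreps (X i) = 0"
  "i \<in> S \<Longrightarrow> param (X ` S \<union> Y ` S) nonreps (Y i) = 0"
  unfolding param_PS by auto

lemma prime_PS: "primeideal PS (polyR U)"
  unfolding PS_def by (rule prime_param_kernel)

lemma Var_X_notin_PS: "i \<in> V - S \<Longrightarrow> Var (X i) \<notin> PS"
  by (simp add: PS_iff param_PS_notin)

lemma bin_in_PS_iff:
  assumes "i \<in> V - S" "j \<in> V - S" shows "bin i j \<in> PS \<longleftrightarrow> r i = r j"
proof -
  have "psubst (param (X ` S \<union> Y ` S) nonreps) (bin i j) = Var (X i) * Var (X j) * (Var (Y (r j)) - Var (Y (r i)))"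
    using assms by (simp add: bin_def param_PS_notin algebra_simps)
  then show ?thesis using assms bin_in_polys[of i V j] by (auto simp: PS_iff)
qed

text \<open>The listed elements say that, modulo \<open>Q\<close>, \<open>x\<^sub>r y\<^sub>i = x\<^sub>i y\<^sub>r\<close> for the representative \<open>r\<close> of \<open>i\<close>. So
  every polynomial becomes, after multiplication by some \<open>u\<close> outside \<open>PS\<close>, a polynomial in the free
  variables, and \<open>PS\<close> contains no such polynomial except \<open>0\<close>.\<close>

lemma PS_subset:
  fixes Q :: "('a indet, 'k::field) mp set"
  assumes Q: "primeideal Q (polyR U)" and QP: "Q \<subseteq> PS"
    and S: "\<And>i. i \<in> S \<Longrightarrow> Var (X i) \<in> Q" "\<And>i. i \<in> S \<Longrightarrow> Var (Y i) \<in> Q"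
    and b: "\<And>i. i \<in> V - S \<Longrightarrow> bin (r i) i \<in> Q"
  shows "PS \<subseteq> Q"
proof
  fix f :: "('a indet, 'k) mp" assume f: "f \<in> PS"
  note QI = ideal_polyRD[OF primeideal_polyRD(1)[OF Q]]
  note PI = ideal_polyRD[OF primeideal_polyRD(1)[OF prime_PS]]
  have sub: "polys_in free_vars \<subseteq> polys_in U" using r_in by (intro polys_in_mono) auto
  define F where "F = (polys_in free_vars :: ('a indet, 'k) mp set)"
  have F_simps: "x * y \<in> F" "x + y \<in> F" if "x \<in> F" "y \<in> F" for x y
    using that by (auto simp: F_def)
  have FU: "x \<in> polys_in U" if "x \<in> F" for x using that sub by (auto simp: F_def)
  have main: "\<exists>u g. u \<in> F \<and> u \<notin> PS \<and> g \<in> F \<and> u * f - g \<in> Q" if "f \<in> polys_in U" for f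
    using that
  proof (induction rule: polys_in_induct)
    case (Cst c)
    show ?case using QI(2) primeideal_polyRD(2)[OF prime_PS]
      by (intro exI[of _ 1] exI[of _ "Cst c"]) (auto simp: F_def)
  next
    case (Var z)
    have one: "1 \<in> F" "1 \<notin> PS" "0 \<in> F" using primeideal_polyRD(2)[OF prime_PS] by (auto simp: F_def)
    consider "z \<in> X ` S \<union> Y ` S" | i where "i \<in> V - S" "z = X i" | i where "i \<in> V - S" "z = Y i"
      using Var by auto
    then show ?case
    proof cases
      case 1
      then have "1 * Var z - 0 \<in> Q" using S by auto
      then show ?thesis using one by blast
    next
      case 2
      then have "1 * Var z - Var z \<in> Q" "Var z \<in> F" using QI(2) by (auto simp: F_def intro!: polys_in_Var)
      then show ?thesis using one by blast
    next
      case 3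
      have "Var (X (r i)) * Var z - Var (X i) * Var (Y (r i)) \<in> Q"
        using b[OF 3(1)] by (simp add: bin_def 3(2))
      moreover have "Var (X (r i)) \<in> F" "Var (X i) * Var (Y (r i)) \<in> F"
        using 3 r_in by (auto simp: F_def intro!: polys_in_mult polys_in_Var)
      moreover have "Var (X (r i)) \<notin> PS" by (rule Var_X_notin_PS[OF r_in[OF 3(1)]])
      ultimately show ?thesis by blast
    qed
  next
    case (add p q)
    then obtain u g u' g' where *: "u \<in> F" "u \<notin> PS" "g \<in> F" "u * p - g \<in> Q" "u' \<in> F" "u' \<notin> PS" "g' \<in> F" "u' * q - g' \<in> Q"
      by blast
    have "u' * (u * p - g) + u * (u' * q - g') \<in> Q"
      by (intro QI(3) QI(5) * FU)
    then have "(u * u') * (p + q) - (u' * g + u * g') \<in> Q" by (simp add: algebra_simps)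
    moreover have "u * u' \<notin> PS" using primeideal_polyRD(3)[OF prime_PS FU FU] * by blast
    ultimately show ?case
      by (intro exI[of _ "u * u'"] exI[of _ "u' * g + u * g'"] conjI) (auto intro!: F_simps *)
  next
    case (mult p q)
    then obtain u g u' g' where *: "u \<in> F" "u \<notin> PS" "g \<in> F" "u * p - g \<in> Q" "u' \<in> F" "u' \<notin> PS" "g' \<in> F" "u' * q - g' \<in> Q"
      by blast
    have "(u * p) * (u' * q - g') + g' * (u * p - g) \<in> Q"
      by (intro QI(3) QI(5) * FU polys_in_mult mult.hyps)
    then have "(u * u') * (p * q) - g * g' \<in> Q" by (simp add: algebra_simps)
    moreover have "u * u' \<notin> PS" using primeideal_polyRD(3)[OF prime_PS FU FU] * by blast
    ultimately show ?case
      by (intro exI[of _ "u * u'"] exI[of _ "g * g'"] conjI) (auto intro!: F_simps *)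
  qed
  have fU: "f \<in> polys_in U" using f PI(1) by auto
  then obtain u g where *: "u \<in> F" "u \<notin> PS" "g \<in> F" "u * f - g \<in> Q" using main by blast
  have "u * f - (u * f - g) \<in> PS"
    by (rule PI(4)[OF PI(5)[OF f FU[OF *(1)]] subsetD[OF QP *(4)]])
  then have "g \<in> PS" by simp
  then have "g = 0" using free_vars_independent *(3) by (simp add: F_def)
  then have "u * f \<in> Q" using *(4) by simp
  then show "f \<in> Q" using primeideal_polyRD(3)[OF Q FU[OF *(1)] fU] *(2) QP by blast
qed

end


subsection \<open>Components after deleting vertices\<close>

definition reach :: "'a graph \<Rightarrow> 'a set \<Rightarrow> ('a \<times> 'a) set" where
  "reach G S = {(a, b). a \<in> verts G - S \<and> b \<in> verts G - S \<and> {a, b} \<in> edges G}\<^sup>*"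

definition rep :: "'a::linorder graph \<Rightarrow> 'a set \<Rightarrow> 'a \<Rightarrow> 'a" where
  "rep G S i = Min {j \<in> verts G - S. (i, j) \<in> reach G S}"

text \<open>The cut sets of the theory of binomial edge ideals: putting any vertex of \<open>S\<close> back joins at least
  two components of \<open>G - S\<close>.\<close>

definition separated_by :: "'a graph \<Rightarrow> 'a set \<Rightarrow> bool" where
  "separated_by G S \<longleftrightarrow> S \<subseteq> verts G \<and> (\<forall>i\<in>S. \<exists>j k. j \<in> verts G - S \<and> k \<in> verts G - S \<and>
     {i, j} \<in> edges G \<and> {i, k} \<in> edges G \<and> (j, k) \<notin> reach G S)"

lemma reach_refl [simp]: "(i, i) \<in> reach G S"
  by (simp add: reach_def)

lemma reach_trans: "(i, j) \<in> reach G S \<Longrightarrow> (j, k) \<in> reach G S \<Longrightarrow> (i, k) \<in> reach G S"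
  unfolding reach_def by (rule rtrancl_trans)

lemma reach_sym: assumes "(i, j) \<in> reach G S" shows "(j, i) \<in> reach G S"
proof -
  have "sym {(a, b). a \<in> verts G - S \<and> b \<in> verts G - S \<and> {a, b} \<in> edges G}"
    by (auto simp: sym_def insert_commute)
  from symD[OF sym_rtrancl[OF this]] show ?thesis using assms unfolding reach_def .
qed

lemma rep_props:
  assumes "simple_graph G" "i \<in> verts G - S"
  shows "rep G S i \<in> verts G - S" "(i, rep G S i) \<in> reach G S"
proof -
  have "finite {j \<in> verts G - S. (i, j) \<in> reach G S}" using assms(1) by (simp add: simple_graph_def)
  moreover have "i \<in> {j \<in> verts G - S. (i, j) \<in> reach G S}" using assms(2) by simp
  ultimately have "rep G S i \<in> {j \<in> verts G - S. (i, j) \<in> reach G S}"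
    unfolding rep_def by (intro Min_in) auto
  then show "rep G S i \<in> verts G - S" "(i, rep G S i) \<in> reach G S" by auto
qed

lemma rep_eq_iff:
  assumes "simple_graph G" "i \<in> verts G - S" "j \<in> verts G - S"
  shows "rep G S i = rep G S j \<longleftrightarrow> (i, j) \<in> reach G S"
proof
  assume "rep G S i = rep G S j"
  then show "(i, j) \<in> reach G S"
    using rep_props(2)[OF assms(1,2)] rep_props(2)[OF assms(1,3)] reach_sym reach_trans by metis
next
  assume ij: "(i, j) \<in> reach G S"
  have "(i, k) \<in> reach G S \<longleftrightarrow> (j, k) \<in> reach G S" for k
    using ij reach_sym reach_trans by metis
  then show "rep G S i = rep G S j" by (simp add: rep_def)
qed

lemma vertex_set_rep:
  assumes "simple_graph G" "S \<subseteq> verts G" shows "vertex_set (verts G) S (rep G S)"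
proof
  show "finite (verts G)" using assms(1) by (simp add: simple_graph_def)
  fix i assume i: "i \<in> verts G - S"
  show "rep G S i \<in> verts G - S" by (rule rep_props(1)[OF assms(1) i])
  then show "rep G S (rep G S i) = rep G S i"
    using rep_eq_iff[OF assms(1), of "rep G S i" S i] rep_props(2)[OF assms(1) i] i reach_sym by metis
qed (fact assms(2))

text \<open>The number of vertices outside \<open>S\<close> minus the number of components of \<open>G - S\<close>.\<close>

definition ncomp_defect :: "'a::linorder graph \<Rightarrow> 'a set \<Rightarrow> nat" where
  "ncomp_defect G S = card {i \<in> verts G - S. rep G S i \<noteq> i}"

text \<open>Every vertex of \<open>S\<close> has neighbours in two components of \<open>G - S\<close>, so a prime between \<open>J\<^sub>G\<close>
  and \<open>PS\<close> contains the variables of \<open>S\<close>; following paths, it contains the binomials of all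
  pairs of vertices in one component.\<close>

lemma separated_by_associated_prime:
  fixes K :: "'k::field itself" and G :: "'a::linorder graph"
  assumes G: "simple_graph G" and S: "separated_by G S"
  shows "\<exists>P \<in> associated_primes (edge_ring K (verts G)) (binomial_edge_ideal K G).
    prime_height (edge_ring K (verts G)) P = enat (2 * card S + ncomp_defect G S)"
proof -
  have SV: "S \<subseteq> verts G" using S by (simp add: separated_by_def)
  interpret vertex_set "verts G" S "rep G S" by (rule vertex_set_rep[OF G SV])
  let ?J = "binomial_edge_ideal K G" and ?P = "PS :: ('a indet, 'k) mp set"
  note J = binomial_edge_ideal_props[OF G, where K = K]
  have JP: "?J \<subseteq> ?P"
  proof (rule J(3)[OF primeideal_polyRD(1)[OF prime_PS]])
    fix i j assume e: "{i, j} \<in> edges G"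
    note V = edge_verts[OF G e]
    show "bin i j \<in> ?P"
    proof (cases "i \<in> S \<or> j \<in> S")
      case True
      then have "psubst (param (X ` S \<union> Y ` S) nonreps) (bin i j :: ('a indet, 'k) mp) = 0"
        by (auto simp: bin_def param_PS_in)
      then show ?thesis using V bin_in_polys by (auto simp: PS_iff)
    next
      case False
      then have ij: "i \<in> verts G - S" "j \<in> verts G - S" using V by auto
      have "(i, j) \<in> reach G S" unfolding reach_def using ij e by blast
      then show ?thesis using ij rep_eq_iff[OF G ij] by (simp add: bin_in_PS_iff)
    qed
  qed
  have "?P \<in> associated_primes (polyR (gvars G)) ?J"
  proof (rule minimal_prime_associated[OF _ J(1) prime_PS JP])
    show "finite (gvars G)" using fin by simp
    fix Q :: "('a indet, 'k) mp set"
    assume Q: "primeideal Q (polyR (gvars G))" and JQ: "?J \<subseteq> Q" and QP: "Q \<subseteq> ?P"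
    note QI = ideal_polyRD[OF primeideal_polyRD(1)[OF Q]]
    note Qp = primeideal_polyRD(3)[OF Q]
    have VarU: "Var (X i) \<in> polys_in (gvars G)" "Var (Y i) \<in> polys_in (gvars G)" if "i \<in> verts G" for i
      using that by (auto intro!: polys_in_Var)
    have e: "bin i j \<in> Q" if "{i, j} \<in> edges G" for i j using J(2)[OF that] JQ by blast
    have SQ: "Var (X i) \<in> Q \<and> Var (Y i) \<in> Q" if i: "i \<in> S" for i
    proof -
      obtain j k where jk: "j \<in> verts G - S" "k \<in> verts G - S" "{i, j} \<in> edges G" "{i, k} \<in> edges G" "(j, k) \<notin> reach G S"
        using S i unfolding separated_by_def by blast
      have kj: "bin k j \<notin> Q" "bin k j \<in> polys_in (gvars G)"
        using bin_in_PS_iff[OF jk(2,1)] rep_eq_iff[OF G jk(1,2)] jk(5) QP bin_in_polys[of k "verts G" j] jk by auto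
      have "Var (X k) * bin i j - Var (X j) * bin i k \<in> Q" "Var (Y k) * bin i j - Var (Y j) * bin i k \<in> Q"
        using jk e VarU by (auto intro!: QI(4) QI(5))
      then show ?thesis unfolding bin_exchange using Qp kj VarU i SV by blast
    qed
    have path: "bin a b \<in> Q" if "(a, b) \<in> reach G S" "a \<in> verts G - S" for a b
      using that(1) unfolding reach_def
    proof (induction rule: rtrancl_induct)
      case base then show ?case using QI(2) by simp
    next
      case (step b c)
      then have bc: "b \<in> verts G - S" "c \<in> verts G - S" "{b, c} \<in> edges G" by auto
      have "bin b a \<in> Q" using step.IH QI(4)[OF QI(2) step.IH] by (simp add: bin_swap[of a b])
      then have "Var (X a) * bin b c - Var (X c) * bin b a \<in> Q"
        using e[OF bc(3)] that(2) bc by (intro QI(4) QI(5) VarU) auto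
      moreover have "Var (X b) \<notin> Q" using Var_X_notin_PS[OF bc(1)] QP by blast
      ultimately show ?case unfolding bin_exchange
        using Qp[OF VarU(1), of b "bin a c"] bin_in_polys[of a "verts G" c] that(2) bc by blast
    qed
    have "?P \<subseteq> Q"
    proof (rule PS_subset[OF Q QP])
      fix i assume i: "i \<in> verts G - S"
      show "bin (rep G S i) i \<in> Q" by (rule path[OF reach_sym[OF rep_props(2)[OF G i]] rep_props(1)[OF G i]])
    qed (use SQ in auto)
    then show "Q = ?P" using QP by blast
  qed
  moreover have "prime_height (polyR (gvars G)) ?P = enat (2 * card S + ncomp_defect G S)"
    using height_PS by (simp add: ncomp_defect_def nonreps_def)
  ultimately show ?thesis unfolding edge_ring_eq_polyR by blast
qed


subsection \<open>Separators and cones\<close>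

text \<open>A path that leaves the component of \<open>u\<close> in \<open>G - S\<close> has to enter \<open>i\<close> from that component.\<close>

lemma reach_remove_vertex:
  assumes G: "simple_graph G" and S: "S \<subseteq> verts G" and i: "i \<in> S" and u: "u \<in> verts G - S"
    and ux: "(u, x) \<in> reach G (S - {i})"
  shows "(u, x) \<in> reach G S \<or> (\<exists>j \<in> verts G - S. (u, j) \<in> reach G S \<and> {i, j} \<in> edges G)"
  using ux unfolding reach_def[of G "S - {i}"]
proof (induction rule: rtrancl_induct)
  case base then show ?case by simp
next
  case (step x y)
  show ?case
  proof (cases "(u, x) \<in> reach G S")
    case True
    have x: "x \<in> verts G - S"
    proof (cases "x = u")
      case False
      then have "(u, x) \<in> {(a, b). a \<in> verts G - S \<and> b \<in> verts G - S \<and> {a, b} \<in> edges G}\<^sup>+"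
        using True unfolding reach_def by (simp add: rtrancl_eq_or_trancl)
      then show ?thesis by (auto elim: tranclE)
    qed (use u in simp)
    show ?thesis
    proof (cases "y = i")
      case True
      then show ?thesis using x \<open>(u, x) \<in> reach G S\<close> step.hyps by (auto simp: insert_commute)
    next
      case False
      then have "y \<in> verts G - S" "{x, y} \<in> edges G" using step.hyps by auto
      then have "(x, y) \<in> reach G S" unfolding reach_def using x by blast
      from reach_trans[OF True this] show ?thesis by (rule disjI1)
    qed
  qed (use step.IH in blast)
qed

text \<open>All vertices other than \<open>u\<close> and \<open>w\<close> together separate them. In a separator of least size no vertex
  can be omitted, so each has neighbours in the component of \<open>u\<close> and in that of \<open>w\<close>.\<close>

lemma minimal_separator:
  assumes H: "simple_graph H" and uw: "u \<in> verts H" "w \<in> verts H" "u \<noteq> w" "{u, w} \<notin> edges H"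
  obtains S where "separated_by H S" "u \<in> verts H - S" "w \<in> verts H - S" "(u, w) \<notin> reach H S"
proof -
  let ?F = "\<lambda>S. S \<subseteq> verts H - {u, w} \<and> (u, w) \<notin> reach H S"
  have "?F (verts H - {u, w})"
  proof -
    have empty: "{(a, b). a \<in> verts H - (verts H - {u, w}) \<and> b \<in> verts H - (verts H - {u, w}) \<and> {a, b} \<in> edges H} = {}"
      using uw edge_verts(3)[OF H] by (auto simp: insert_commute)
    show ?thesis unfolding reach_def empty using uw by simp
  qed
  from ex_has_least_nat[of ?F, OF this, of card]
  obtain S where S: "?F S" and min: "\<forall>T. ?F T \<longrightarrow> card S \<le> card T" by - (erule exE, erule conjE, rule that)
  have finS: "finite S" using S H finite_subset[of S "verts H"] by (auto simp: simple_graph_def)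
  have SV: "S \<subseteq> verts H" and u: "u \<in> verts H - S" and w: "w \<in> verts H - S" using S uw by auto
  have "separated_by H S"
    unfolding separated_by_def
  proof (intro conjI ballI SV)
    fix i assume i: "i \<in> S"
    have "card (S - {i}) < card S" using finS i by (rule card_Diff1_less)
    then have uw': "(u, w) \<in> reach H (S - {i})" using min[rule_format, of "S - {i}"] S by auto
    have nr: "(u, w) \<notin> reach H S" "(w, u) \<notin> reach H S" using S reach_sym[of w u H S] by auto
    from reach_remove_vertex[OF H SV i u uw'] nr(1)
    have "\<exists>j \<in> verts H - S. (u, j) \<in> reach H S \<and> {i, j} \<in> edges H" by simp
    then obtain j where j: "j \<in> verts H - S" "(u, j) \<in> reach H S" "{i, j} \<in> edges H" by (elim bexE conjE)
    from reach_remove_vertex[OF H SV i w reach_sym[OF uw']] nr(2)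
    have "\<exists>k \<in> verts H - S. (w, k) \<in> reach H S \<and> {i, k} \<in> edges H" by simp
    then obtain k where k: "k \<in> verts H - S" "(w, k) \<in> reach H S" "{i, k} \<in> edges H" by (elim bexE conjE)
    have "(j, k) \<notin> reach H S"
    proof
      assume "(j, k) \<in> reach H S"
      from reach_trans[OF reach_trans[OF j(2) this] reach_sym[OF k(2)]] have "(u, w) \<in> reach H S" .
      then show False using S by simp
    qed
    then show "\<exists>j k. j \<in> verts H - S \<and> k \<in> verts H - S \<and> {i, j} \<in> edges H \<and> {i, k} \<in> edges H \<and> (j, k) \<notin> reach H S"
      using j k by blast
  qed
  then show ?thesis using that u w S by blast
qed

lemma simple_graph_cone:
  assumes "simple_graph H" "v \<notin> verts H" shows "simple_graph (cone v H)"
  using assms unfolding simple_graph_def cone_def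
  by (auto simp: card_insert_if)

lemma reach_cone:
  assumes H: "simple_graph H" and v: "v \<notin> verts H" and vS: "v \<in> S"
  shows "reach (cone v H) S = reach H (S - {v})"
proof -
  have "{(a, b). a \<in> verts (cone v H) - S \<and> b \<in> verts (cone v H) - S \<and> {a, b} \<in> edges (cone v H)} =
    {(a, b). a \<in> verts H - (S - {v}) \<and> b \<in> verts H - (S - {v}) \<and> {a, b} \<in> edges H}"
    using v vS by (auto simp: cone_def doubleton_eq_iff)
  then show ?thesis by (simp add: reach_def)
qed

lemma connected_cone:
  assumes "v \<notin> verts H" shows "connected_graph (cone v H)"
  unfolding connected_graph_def
proof (intro conjI ballI)
  fix u w assume uw: "u \<in> verts (cone v H)" "w \<in> verts (cone v H)"
  let ?R = "{(a, b). {a, b} \<in> edges (cone v H)}"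
  have "(x, v) \<in> ?R\<^sup>* \<and> (v, x) \<in> ?R\<^sup>*" if "x \<in> verts (cone v H)" for x
    using that by (cases "x = v") (auto simp: cone_def insert_commute intro!: r_into_rtrancl)
  then show "(u, w) \<in> ?R\<^sup>*" using uw by (meson rtrancl_trans)
qed (simp add: cone_def)

lemma connected_ncomp_defect:
  assumes G: "simple_graph G" and c: "connected_graph G" shows "ncomp_defect G {} + 1 = card (verts G)"
proof -
  have fin: "finite (verts G)" and ne: "verts G \<noteq> {}"
    using G c by (auto simp: simple_graph_def connected_graph_def)
  have "{(a, b). {a, b} \<in> edges G} = {(a, b). a \<in> verts G - {} \<and> b \<in> verts G - {} \<and> {a, b} \<in> edges G}"
    using edge_verts[OF G] by auto
  then have all: "(a, b) \<in> reach G {}" if "a \<in> verts G" "b \<in> verts G" for a b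
    using c that unfolding connected_graph_def reach_def by simp
  obtain x where x: "x \<in> verts G" using ne by blast
  define q where "q = rep G {} x"
  have rep: "rep G {} i = q" if "i \<in> verts G" for i
    unfolding q_def using rep_eq_iff[OF G, of i "{}" x] all that x by simp
  have q: "q \<in> verts G" using rep_props(1)[OF G, of x "{}"] x by (simp add: q_def)
  have "{i \<in> verts G - {}. rep G {} i \<noteq> i} = verts G - {q}" using rep by auto
  then show ?thesis using q fin by (simp add: ncomp_defect_def card_gt_0_iff) (metis card_gt_0_iff Suc_pred empty_iff)
qed

text \<open>Passing from \<open>S\<close> in \<open>H\<close> to \<open>S \<union> {v}\<close> in the cone keeps the components and raises the height by \<open>2\<close>,
  whereas for the empty set the height grows only by \<open>1\<close>.\<close>

theorem unmixed_cone_imp_complete: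
  fixes K :: "'k::field itself" and H :: "'a::linorder graph"
  assumes H: "simple_graph H" and con: "connected_graph H" and v: "v \<notin> verts H"
    and uH: "unmixed (edge_ring K (verts H)) (binomial_edge_ideal K H)"
    and uG: "unmixed (edge_ring K (verts (cone v H))) (binomial_edge_ideal K (cone v H))"
  shows "complete_graph H"
proof (rule ccontr)
  assume "\<not> complete_graph H"
  then obtain u w where uw: "u \<in> verts H" "w \<in> verts H" "u \<noteq> w" "{u, w} \<notin> edges H"
    by (auto simp: complete_graph_def)
  obtain S where S: "separated_by H S" "u \<in> verts H - S" "w \<in> verts H - S" "(u, w) \<notin> reach H S"
    by (rule minimal_separator[OF H uw])
  let ?G = "cone v H" and ?T = "insert v S"
  have G: "simple_graph ?G" by (rule simple_graph_cone[OF H v])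
  have SV: "S \<subseteq> verts H" using S(1) by (simp add: separated_by_def)
  then have vS: "v \<notin> S" using v by auto
  have diff: "verts ?G - ?T = verts H - S" using v by (auto simp: cone_def)
  have rc: "reach ?G ?T = reach H S" using reach_cone[OF H v, of ?T] vS by simp
  have eG: "{v, x} \<in> edges ?G" if "x \<in> verts H" for x using that by (auto simp: cone_def insert_commute)
  have sub: "edges H \<subseteq> edges ?G" by (auto simp: cone_def)
  have T: "separated_by ?G ?T"
    unfolding separated_by_def diff rc
  proof (intro conjI ballI)
    show "?T \<subseteq> verts ?G" using SV by (auto simp: cone_def)
    fix i assume "i \<in> ?T"
    then consider "i = v" | "i \<in> S" by auto
    then show "\<exists>j k. j \<in> verts H - S \<and> k \<in> verts H - S \<and> {i, j} \<in> edges ?G \<and> {i, k} \<in> edges ?G \<and> (j, k) \<notin> reach H S"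
    proof cases
      case 1 then show ?thesis using S eG by blast
    next
      case 2 then show ?thesis using S(1) sub unfolding separated_by_def by blast
    qed
  qed
  have e: "separated_by H {}" "separated_by ?G {}" by (simp_all add: separated_by_def)
  have eq: "2 * card A + ncomp_defect F A = 2 * card B + ncomp_defect F B"
    if "simple_graph F" "separated_by F A" "separated_by F B"
      "unmixed (edge_ring K (verts F)) (binomial_edge_ideal K F)" for A B and F :: "'a graph"
    using separated_by_associated_prime[OF that(1,2), of K] separated_by_associated_prime[OF that(1,3), of K] that(4)
    unfolding unmixed_def by (metis enat.inject)
  have "rep ?G ?T i = rep H S i" for i by (simp add: rep_def diff rc)
  then have "ncomp_defect ?G ?T = ncomp_defect H S" by (simp add: ncomp_defect_def diff)
  moreover have "card ?T = Suc (card S)" using vS finite_subset[OF SV] H by (simp add: simple_graph_def)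
  moreover have "card (verts ?G) = Suc (card (verts H))" using v H by (auto simp: cone_def simple_graph_def)
  moreover note eq[OF H S(1) e(1) uH] eq[OF G T e(2) uG]
    connected_ncomp_defect[OF H con] connected_ncomp_defect[OF G connected_cone[OF v]]
  ultimately show False by simp
qed


section \<open>The ideal of 2-minors as a free module over a polynomial ring\<close>

subsection \<open>Independence by degrees\<close>

text \<open>The degree of a nonzero \<open>k\<close>-th summand is congruent to \<open>k\<close> modulo \<open>n\<close>, so leading terms of
  different summands cannot cancel.\<close>

lemma pcompose_combination_eq_0:
  fixes D :: "'r::idom poly"
  assumes n: "degree D = n" "0 < n" and E: "\<And>k. k < n \<Longrightarrow> degree (E k) = k" "\<And>k. k < n \<Longrightarrow> E k \<noteq> 0"
    and sum: "(\<Sum>k<n. pcompose (p k) D * E k) = 0" and k: "k < n"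
  shows "p k = 0"
proof (rule ccontr)
  assume pk: "p k \<noteq> 0"
  define A where "A = {k. k < n \<and> p k \<noteq> 0}"
  define d where "d k = degree (p k) * n + k" for k
  have A: "finite A" "A \<noteq> {}" using pk k by (auto simp: A_def)
  have term_nz: "pcompose (p j) D * E j \<noteq> 0" "degree (pcompose (p j) D * E j) = d j" if "j \<in> A" for j
  proof -
    have j: "j < n" "p j \<noteq> 0" using that by (auto simp: A_def)
    have nz: "pcompose (p j) D \<noteq> 0" using j(2) n by (simp add: pcompose_eq_0_iff)
    then show "pcompose (p j) D * E j \<noteq> 0" using E(2)[OF j(1)] by simp
    show "degree (pcompose (p j) D * E j) = d j"
      using degree_mult_eq[OF nz E(2)[OF j(1)]] E(1)[OF j(1)] n by (simp add: degree_pcompose d_def)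
  qed
  have "Max (d ` A) \<in> d ` A" using A by (intro Max_in) auto
  then obtain j where j: "j \<in> A" "d j = Max (d ` A)" by auto
  have less: "d i < d j" if "i \<in> A" "i \<noteq> j" for i
  proof -
    have "d i \<le> d j" using that A j by simp
    moreover have "d i \<noteq> d j"
    proof
      assume "d i = d j"
      then have "d i mod n = d j mod n" by simp
      then show False using that j by (simp add: d_def A_def)
    qed
    ultimately show ?thesis by simp
  qed
  have z: "coeff (pcompose (p i) D * E i) (d j) = 0" if "i < n" "i \<noteq> j" for i
  proof (cases "i \<in> A")
    case True then show ?thesis using less[OF True that(2)] term_nz(2)[OF True] by (intro coeff_eq_0) simp
  next
    case False then show ?thesis using that by (simp add: A_def)
  qed
  have "0 = coeff (\<Sum>k<n. pcompose (p k) D * E k) (d j)" using sum by simp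
  also have "\<dots> = (\<Sum>k<n. coeff (pcompose (p k) D * E k) (d j))" by (rule coeff_sum)
  also have "\<dots> = coeff (pcompose (p j) D * E j) (d j)"
    using j(1) z by (subst sum.remove[of _ j]) (auto simp: A_def intro!: sum.neutral)
  also have "\<dots> = lead_coeff (pcompose (p j) D * E j)" using term_nz(2)[OF j(1)] by simp
  finally show False using term_nz(1)[OF j(1)] by simp
qed

lemma rhom_pcompose: "rhom (\<lambda>p. pcompose p D)"
  by (simp add: rhom_def pcompose_add pcompose_mult) (simp add: one_pCons)

lemma Idl_Un_eq:
  fixes b :: "nat \<Rightarrow> ('v, 'k::field) mp"
  assumes J: "ideal J (polyR W)" and b: "\<And>i. i < n \<Longrightarrow> b i \<in> polys_in W"
  shows "Idl\<^bsub>polyR W\<^esub> (J \<union> b ` {..<n}) =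
    {f \<in> polys_in W. \<exists>c. (\<forall>i<n. c i \<in> polys_in W) \<and> f - (\<Sum>i<n. c i * b i) \<in> J}" (is "_ = ?R")
proof
  interpret cring "polyR W :: ('v, 'k) mp ring" by (rule cring_polyR)
  note JI = ideal_polyRD[OF J]
  have sub: "J \<union> b ` {..<n} \<subseteq> carrier (polyR W)" using JI(1) b by auto
  note GI = ideal_polyRD[OF genideal_ideal[OF sub]] and self = genideal_self[OF sub]
  have R: "f \<in> ?R" if "f \<in> polys_in W" "g \<in> gen W b n" "f - g \<in> J" for f g
    using that by (auto simp: gen_def)
  have gI: "ideal (gen W b n) (polyR W)" by (rule ideal_gen[OF b])
  note gI' = ideal_polyRD[OF gI]
  show "Idl\<^bsub>polyR W\<^esub> (J \<union> b ` {..<n}) \<subseteq> ?R"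
  proof (rule genideal_minimal)
    have R_ex: "\<exists>g\<in>gen W b n. f - g \<in> J" if "f \<in> ?R" for f using that by (auto simp: gen_def)
    show "ideal ?R (polyR W)"
    proof (rule ideal_polyRI)
      show "0 \<in> ?R" by (rule R[of _ 0]) (use gI'(2) JI(2) in auto)
    next
      fix x y assume x: "x \<in> ?R" and y: "y \<in> ?R"
      then obtain g h where gh: "g \<in> gen W b n" "x - g \<in> J" "h \<in> gen W b n" "y - h \<in> J" using R_ex by meson
      have "(x - g) + (y - h) \<in> J" by (rule JI(3)[OF gh(2,4)])
      then have "(x + y) - (g + h) \<in> J" by (simp add: algebra_simps)
      then show "x + y \<in> ?R" using x y by (intro R[OF _ gI'(3)[OF gh(1,3)]]) auto
    next
      fix x r :: "('v, 'k) mp" assume x: "x \<in> ?R" and r: "r \<in> polys_in W"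
      then obtain g where g: "g \<in> gen W b n" "x - g \<in> J" using R_ex by meson
      have "r * (x - g) \<in> J" by (rule JI(5)[OF g(2) r])
      then have "r * x - r * g \<in> J" by (simp add: algebra_simps)
      then show "r * x \<in> ?R" using x r by (intro R[OF _ gI'(5)[OF g(1) r]]) auto
    qed auto
    show "J \<union> b ` {..<n} \<subseteq> ?R"
    proof
      fix x assume "x \<in> J \<union> b ` {..<n}"
      then consider "x \<in> J" | i where "i < n" "x = b i" by auto
      then show "x \<in> ?R"
      proof cases
        case 1 then show ?thesis using JI(1) gI'(2) by (intro R[of x 0]) auto
      next
        case 2 then show ?thesis using b JI(2) gen_base[of i n b W] by (intro R[of x x]) auto
      qed
    qed
  qed
  show "?R \<subseteq> Idl\<^bsub>polyR W\<^esub> (J \<union> b ` {..<n})"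
  proof
    fix f assume "f \<in> ?R"
    then obtain c where c: "\<forall>i<n. c i \<in> polys_in W" "f - (\<Sum>i<n. c i * b i) \<in> J" by blast
    have "(\<Sum>i<n. c i * b i) \<in> Idl\<^bsub>polyR W\<^esub> (J \<union> b ` {..<n})"
      using c(1) self by (intro ideal_polyR_sum[OF genideal_ideal[OF sub]] GI(5)) auto
    moreover have "f - (\<Sum>i<n. c i * b i) \<in> Idl\<^bsub>polyR W\<^esub> (J \<union> b ` {..<n})" using c(2) self by auto
    ultimately have "(f - (\<Sum>i<n. c i * b i)) + (\<Sum>i<n. c i * b i) \<in> Idl\<^bsub>polyR W\<^esub> (J \<union> b ` {..<n})"
      by (intro GI(3))
    then show "f \<in> Idl\<^bsub>polyR W\<^esub> (J \<union> b ` {..<n})" by simp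
  qed
qed


subsection \<open>Generators and basis\<close>

text \<open>The ideal \<open>J\<close> of all 2-minors of the matrix with columns \<open>(x\<^sub>a, y\<^sub>a)\<close>. The enumeration \<open>g\<close> of the
  columns is what makes shifting an index by one meaningful.\<close>

locale complete_binomial =
  fixes V :: "'a::linorder set" and J :: "('a indet, 'k::field) mp set" and n :: nat and g :: "nat \<Rightarrow> 'a"
  assumes g: "bij_betw g {..<n} V" and n: "0 < n"
    and J: "ideal J (polyR (X ` V \<union> Y ` V))"
    and bin_J: "a \<in> V \<Longrightarrow> b \<in> V \<Longrightarrow> bin a b \<in> J"
    and J_least: "ideal I (polyR (X ` V \<union> Y ` V)) \<Longrightarrow> (\<And>a b. a \<in> V \<Longrightarrow> b \<in> V \<Longrightarrow> bin a b \<in> I) \<Longrightarrow> J \<subseteq> I"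
begin

abbreviation "U \<equiv> X ` V \<union> Y ` V"

definition x :: "nat \<Rightarrow> ('a indet, 'k) mp" where "x i = Var (X (g i))"
definition y :: "nat \<Rightarrow> ('a indet, 'k) mp" where "y i = Var (Y (g i))"

text \<open>A system of parameters for the quotient by \<open>J\<close>: the two corner entries of the matrix and the
  differences along its antidiagonals.\<close>

definition \<theta> :: "nat \<Rightarrow> ('a indet, 'k) mp" where
  "\<theta> i = (if i = 0 then x 0 else if i < n then x i - y (i - 1) else y (n - 1))"

definition e :: "nat \<Rightarrow> ('a indet, 'k) mp" where
  "e k = (if k = 0 then 1 else x k)"

definition comb :: "(nat \<Rightarrow> (nat, 'k) mp) \<Rightarrow> ('a indet, 'k) mp" where
  "comb b = (\<Sum>k<n. psubst \<theta> (b k) * e k)"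

lemmas JI = ideal_polyRD[OF J]

lemma g_in: "i < n \<Longrightarrow> g i \<in> V"
  using g by (auto simp: bij_betw_def)

lemma g_surj: "a \<in> V \<Longrightarrow> \<exists>i<n. a = g i"
  using g by (auto simp: bij_betw_def)

lemma x_in: "i < n \<Longrightarrow> x i \<in> polys_in U" and y_in: "i < n \<Longrightarrow> y i \<in> polys_in U"
  using g_in by (auto simp: x_def y_def intro!: polys_in_Var)

lemma e_in: "k < n \<Longrightarrow> e k \<in> polys_in U"
  using x_in by (auto simp: e_def)

lemma \<theta>_in: "i \<in> {..n} \<Longrightarrow> \<theta> i \<in> polys_in U"
  using n x_in y_in by (auto simp: \<theta>_def intro!: polys_in_diff)

lemma psubst_\<theta>_in: "b \<in> polys_in {..n} \<Longrightarrow> psubst \<theta> b \<in> polys_in U"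
  by (rule mp_eval_in) (auto intro: \<theta>_in)

lemma comb_in: "(\<And>k. k < n \<Longrightarrow> b k \<in> polys_in {..n}) \<Longrightarrow> comb b \<in> polys_in U"
  unfolding comb_def by (intro polys_in_sum polys_in_mult psubst_\<theta>_in e_in) auto

lemma comb_add: "comb (\<lambda>k. b k + c k) = comb b + comb c"
  and comb_diff: "comb (\<lambda>k. b k - c k) = comb b - comb c"
  and comb_mult: "comb (\<lambda>k. s * b k) = psubst \<theta> s * comb b"
  and comb_zero: "comb (\<lambda>k. 0) = 0"
  by (simp_all add: comb_def distrib_right left_diff_distrib sum.distrib sum_subtractf sum_distrib_left mult.assoc)

lemma comb_sum: "comb (\<lambda>k. \<Sum>l\<in>A. f l k) = (\<Sum>l\<in>A. comb (f l))"
  by (induction A rule: infinite_finite_induct) (auto simp: comb_zero comb_add)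

definition N :: "('a indet, 'k) mp set" where
  "N = {f \<in> polys_in U. \<exists>b. (\<forall>k<n. b k \<in> polys_in {..n}) \<and> f - comb b \<in> J}"

lemma N_add: assumes "f \<in> N" "h \<in> N" shows "f + h \<in> N"
proof -
  obtain b c where bc: "\<forall>k<n. b k \<in> polys_in {..n}" "f - comb b \<in> J" "\<forall>k<n. c k \<in> polys_in {..n}" "h - comb c \<in> J"
    using assms by (auto simp: N_def)
  have "(f - comb b) + (h - comb c) \<in> J" by (rule JI(3)[OF bc(2,4)])
  then have "(f + h) - comb (\<lambda>k. b k + c k) \<in> J" by (simp add: comb_add algebra_simps)
  moreover have "\<forall>k<n. b k + c k \<in> polys_in {..n}" using bc by auto
  moreover have "f + h \<in> polys_in U" using assms by (auto simp: N_def)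
  ultimately show ?thesis unfolding N_def by (intro CollectI conjI exI[of _ "\<lambda>k. b k + c k"])
qed

lemma N_scale: assumes "f \<in> N" "s \<in> polys_in {..n}" shows "psubst \<theta> s * f \<in> N"
proof -
  obtain b where b: "\<forall>k<n. b k \<in> polys_in {..n}" "f - comb b \<in> J" using assms by (auto simp: N_def)
  have "psubst \<theta> s * (f - comb b) \<in> J" by (rule JI(5)[OF b(2) psubst_\<theta>_in[OF assms(2)]])
  then have "psubst \<theta> s * f - comb (\<lambda>k. s * b k) \<in> J" by (simp add: comb_mult algebra_simps)
  moreover have "\<forall>k<n. s * b k \<in> polys_in {..n}" using b assms(2) by auto
  moreover have "psubst \<theta> s * f \<in> polys_in U" using assms psubst_\<theta>_in by (auto simp: N_def)
  ultimately show ?thesis unfolding N_def by (intro CollectI conjI exI[of _ "\<lambda>k. s * b k"])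
qed

lemma N_uminus: "f \<in> N \<Longrightarrow> - f \<in> N"
  using N_scale[of f "Cst (-1)"] rhomD(5)[OF rhom_Cst, of "1::'k"] by simp

lemma N_diff: "f \<in> N \<Longrightarrow> h \<in> N \<Longrightarrow> f - h \<in> N"
  using N_add[OF _ N_uminus, of f h] by simp

lemma J_N: assumes "f \<in> J" shows "f \<in> N"
proof -
  have "f - comb (\<lambda>k. 0) \<in> J" using assms by (simp add: comb_zero)
  moreover have "\<forall>k<n. (0 :: (nat, 'k) mp) \<in> polys_in {..n}" by simp
  moreover have "f \<in> polys_in U" using assms JI(1) by auto
  ultimately show ?thesis unfolding N_def by (intro CollectI conjI exI[of _ "\<lambda>k. 0"])
qed

lemma N_cong: "f - h \<in> N \<Longrightarrow> h \<in> N \<Longrightarrow> f \<in> N"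
  using N_add[of "f - h" h] by simp

lemma e_N: assumes "k < n" shows "e k \<in> N"
proof -
  have "comb (\<lambda>j. if j = k then 1 else 0) = (\<Sum>j<n. if j = k then e j else 0)"
    unfolding comb_def by (rule sum.cong) auto
  also have "\<dots> = e k" using assms by simp
  finally have "e k - comb (\<lambda>j. if j = k then 1 else 0) \<in> J" using JI(2) by simp
  moreover have "\<forall>j<n. (if j = k then 1 else 0 :: (nat, 'k) mp) \<in> polys_in {..n}" by simp
  ultimately show ?thesis unfolding N_def
    by (intro CollectI conjI exI[of _ "\<lambda>j. if j = k then 1 else 0"] e_in[OF assms])
qed

lemma \<theta>_N: "i \<le> n \<Longrightarrow> f \<in> N \<Longrightarrow> \<theta> i * f \<in> N"
  using N_scale[of f "Var i"] by (simp add: polys_in_Var)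

text \<open>With \<open>x'\<^sub>n = y\<^sub>n\<^sub>-\<^sub>1\<close> and \<open>\<theta>'\<^sub>n = 0\<close> the relation between \<open>x'\<^sub>i\<^sub>+\<^sub>1\<close> and \<open>y\<^sub>i\<close> holds up to the last column.\<close>

definition x' :: "nat \<Rightarrow> ('a indet, 'k) mp" where "x' i = (if i < n then x i else y (n - 1))"
definition \<theta>' :: "nat \<Rightarrow> ('a indet, 'k) mp" where "\<theta>' i = (if i < n then \<theta> i else 0)"

lemma x'_Suc: "i < n \<Longrightarrow> x' (Suc i) = y i + \<theta>' (Suc i)"
proof -
  assume "i < n"
  then consider "Suc i < n" | "i = n - 1" "\<not> Suc i < n" by linarith
  then show ?thesis by cases (auto simp: x'_def \<theta>'_def \<theta>_def)
qed

lemma \<theta>'_N: "i \<le> n \<Longrightarrow> f \<in> N \<Longrightarrow> \<theta>' i * f \<in> N"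
  using \<theta>_N J_N[OF JI(2)] by (auto simp: \<theta>'_def)

lemma one_N: "1 \<in> N"
  using e_N[OF n] by (simp add: e_def)

lemma x_N: assumes "i < n" shows "x i \<in> N"
proof (cases "i = 0")
  case True
  then show ?thesis using \<theta>_N[of 0 1] one_N by (simp add: \<theta>_def)
next
  case False
  then show ?thesis using e_N[OF assms] by (simp add: e_def)
qed

lemma x'_N: "i \<le> n \<Longrightarrow> x' i \<in> N"
  using x_N \<theta>_N[of n 1] one_N n by (auto simp: x'_def \<theta>_def)

text \<open>Modulo \<open>J\<close> and the module already generated, \<open>x\<^sub>i x\<^sub>j\<^sub>+\<^sub>1\<close> equals \<open>x\<^sub>i\<^sub>+\<^sub>1 x\<^sub>j\<close>, so indices can
  be shifted until one factor is a parameter.\<close>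

lemma x'_exchange:
  assumes "i < n" "j < n" shows "x' i * x' (Suc j) - x' (Suc i) * x' j \<in> N"
proof -
  have "x' i * x' (Suc j) - x' (Suc i) * x' j = bin (g i) (g j) + \<theta>' (Suc j) * x i - \<theta>' (Suc i) * x j"
    using assms by (simp add: x'_Suc bin_def) (simp add: x'_def x_def y_def algebra_simps)
  moreover have "bin (g i) (g j) \<in> N" using bin_J g_in assms by (intro J_N) auto
  ultimately show ?thesis using assms by (auto intro!: N_add N_diff \<theta>'_N x_N)
qed

lemma x'_mult_N: "i \<le> n \<Longrightarrow> j \<le> n \<Longrightarrow> x' i * x' j \<in> N"
proof (induction i arbitrary: j)
  case 0
  have "x' 0 = \<theta> 0" using n by (simp add: x'_def \<theta>_def)
  then show ?case using 0 by (simp add: \<theta>_N x'_N)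
next
  case (Suc i)
  show ?case
  proof (cases "j < n")
    case True
    then have "x' i * x' (Suc j) - x' (Suc i) * x' j \<in> N" "x' i * x' (Suc j) \<in> N"
      using Suc x'_exchange[of i j] by auto
    from N_diff[OF this(2,1)] show ?thesis by simp
  next
    case False
    then have "x' j = \<theta> n" using Suc.prems n by (simp add: x'_def \<theta>_def)
    then show ?thesis using \<theta>_N[OF le_refl x'_N[OF Suc.prems(1)]] by (simp add: mult.commute)
  qed
qed

lemma N_sum: "(\<And>k. k \<in> A \<Longrightarrow> f k \<in> N) \<Longrightarrow> sum f A \<in> N"
  by (induction A rule: infinite_finite_induct) (auto intro: N_add J_N[OF JI(2)])

lemma x'_in: "i \<le> n \<Longrightarrow> x' i \<in> polys_in U"
  using x_in y_in n by (simp add: x'_def)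

lemma x'_times_N: assumes "i \<le> n" "f \<in> N" shows "x' i * f \<in> N"
proof -
  obtain b where b: "\<forall>k<n. b k \<in> polys_in {..n}" "f - comb b \<in> J" using assms by (auto simp: N_def)
  have ek: "x' i * e k \<in> N" if "k < n" for k
    using x'_N[OF assms(1)] x'_mult_N[OF assms(1), of k] that by (simp add: e_def x'_def)
  have "x' i * comb b = (\<Sum>k<n. psubst \<theta> (b k) * (x' i * e k))"
    by (simp add: comb_def sum_distrib_left mult_ac)
  also have "\<dots> \<in> N" using b(1) by (intro N_sum N_scale ek) auto
  finally have "x' i * comb b \<in> N" .
  moreover have "x' i * f - x' i * comb b \<in> N"
    using J_N[OF JI(5)[OF b(2) x'_in[OF assms(1)]]] by (simp add: algebra_simps)
  ultimately show ?thesis by (rule N_cong[rotated])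
qed

lemma generated: assumes f: "f \<in> polys_in U"
  obtains b where "\<And>k. k < n \<Longrightarrow> b k \<in> polys_in {..n}" "f - comb b \<in> J"
proof -
  have "\<forall>h\<in>N. f * h \<in> N" using f
  proof (induction rule: polys_in_induct)
    case (Cst c)
    show ?case using N_scale[of _ "Cst c"] by simp
  next
    case (Var z)
    consider i where "i < n" "z = X (g i)" | i where "i < n" "z = Y (g i)" using Var g_surj by blast
    then show ?case
    proof cases
      case 1
      then show ?thesis using x'_times_N[of i] by (simp add: x'_def x_def)
    next
      case 2
      have "Var z = x' (Suc i) - \<theta>' (Suc i)" using x'_Suc[OF 2(1)] 2 by (simp add: y_def)
      then show ?thesis using x'_times_N[of "Suc i"] \<theta>'_N[of "Suc i"] 2 by (auto simp: left_diff_distrib intro!: N_diff)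
    qed
  next
    case (add p q) then show ?case by (auto simp: distrib_right intro: N_add)
  next
    case (mult p q) then show ?case by (auto simp: mult.assoc)
  qed
  then have "f \<in> N" using one_N by force
  then show ?thesis using that by (auto simp: N_def)
qed


subsection \<open>The parametrization\<close>

text \<open>The image of \<open>x\<^sub>i\<close> is the sum of all \<open>w\<^sub>i\<^sub>-\<^sub>k t\<^sup>k\<close> with \<open>k \<le> i\<close>, where \<open>t\<close> is the variable with index \<open>n\<close> and the
  \<open>w\<close> are the others, and \<open>y\<^sub>i\<close> goes to \<open>t\<close> times it. The coordinates are chosen so that \<open>\<theta>\<^sub>i\<close> goes to
  \<open>w\<^sub>i\<close> for \<open>i < n\<close>. The function \<open>Zp\<close> below gives the same images as polynomials in \<open>t\<close>.\<close>

primrec zs :: "nat \<Rightarrow> (nat, 'k) mp" where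
  "zs 0 = Var 0" | "zs (Suc i) = Var (Suc i) + Var n * zs i"

primrec Zp :: "nat \<Rightarrow> (nat, 'k) mp poly" where
  "Zp 0 = [:Var 0:]" | "Zp (Suc i) = pCons (Var (Suc i)) (Zp i)"

definition \<sigma> :: "'a indet \<Rightarrow> (nat, 'k) mp" where
  "\<sigma> z = (case z of X a \<Rightarrow> zs (the_inv_into {..<n} g a) | Y a \<Rightarrow> Var n * zs (the_inv_into {..<n} g a))"

lemma as_poly_zs: "i < n \<Longrightarrow> as_poly n (zs i) = Zp i"
  by (induction i) (auto simp: as_poly_Var rhomD[OF rhom_as_poly])

lemma Zp_degree: "degree (Zp i) = i \<and> Zp i \<noteq> 0"
  by (induction i) auto

lemma \<sigma>_g: "i < n \<Longrightarrow> \<sigma> (X (g i)) = zs i" "i < n \<Longrightarrow> \<sigma> (Y (g i)) = Var n * zs i"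
  using g by (auto simp: \<sigma>_def the_inv_into_f_f bij_betw_def)

lemma \<sigma>_x: "i < n \<Longrightarrow> psubst \<sigma> (x i) = zs i" and \<sigma>_y: "i < n \<Longrightarrow> psubst \<sigma> (y i) = Var n * zs i"
  by (simp_all add: x_def y_def \<sigma>_g)

lemma zs_in: "i < n \<Longrightarrow> zs i \<in> polys_in {..n}"
  by (induction i) (auto intro!: polys_in_add polys_in_mult polys_in_Var)

lemma \<sigma>_in: assumes "z \<in> U" shows "\<sigma> z \<in> polys_in {..n}"
proof -
  consider i where "i < n" "z = X (g i)" | i where "i < n" "z = Y (g i)" using assms g_surj by blast
  then show ?thesis by cases (auto simp: \<sigma>_g zs_in polys_in_Var)
qed

lemma J_\<sigma>: "f \<in> J \<Longrightarrow> psubst \<sigma> f = 0"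
proof -
  have pr: "primeideal {p \<in> polys_in U. psubst \<sigma> p = 0} (polyR U)" by (rule primeideal_kernel[OF rhom_psubst])
  have "J \<subseteq> {p \<in> polys_in U. psubst \<sigma> p = 0}"
  proof (rule J_least[OF primeideal_polyRD(1)[OF pr]])
    fix a b assume "a \<in> V" "b \<in> V"
    moreover from this g_surj obtain i j where "i < n" "a = g i" "j < n" "b = g j" by blast
    ultimately show "bin a b \<in> {p \<in> polys_in U. psubst \<sigma> p = 0}"
      using bin_in_polys[of a V b] by (simp add: bin_def \<sigma>_g algebra_simps)
  qed
  then show "f \<in> J \<Longrightarrow> psubst \<sigma> f = 0" by auto
qed

definition \<Delta> :: "(nat, 'k) mp poly" where "\<Delta> = pCons 0 (Zp (n - 1))"

lemma \<sigma>_\<theta>: "i \<le> n \<Longrightarrow> as_poly n (psubst \<sigma> (\<theta> i)) = (if i < n then [:Var i:] else \<Delta>)"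
proof -
  assume "i \<le> n"
  then consider "i = 0" | j where "i = Suc j" "Suc j < n" | "i = n" "i \<noteq> 0" by (cases i) (auto simp: le_less)
  then show ?thesis
  proof cases
    case 3
    then show ?thesis
      by (simp add: \<theta>_def \<sigma>_y rhomD[OF rhom_as_poly] as_poly_zs as_poly_Var \<Delta>_def)
  qed (use n in \<open>auto simp: \<theta>_def \<sigma>_x \<sigma>_y rhomD[OF rhom_as_poly] as_poly_zs as_poly_Var\<close>)
qed

lemma \<sigma>_psubst_\<theta>:
  assumes "b \<in> polys_in {..n}"
  shows "as_poly n (psubst \<sigma> (psubst \<theta> b)) = pcompose (as_poly n b) \<Delta>"
  by (rule rhom_eq_on_polys_in[OF rhom_comp[OF rhom_as_poly rhom_comp[OF rhom_psubst rhom_psubst]]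
        rhom_comp[OF rhom_pcompose rhom_as_poly] _ _ assms])
    (auto simp: \<sigma>_\<theta> as_poly_Var pcompose_pCons)

text \<open>In the variable \<open>t\<close> the image of \<open>e\<^sub>k\<close> has degree \<open>k\<close> and that of \<open>\<theta>\<^sub>n\<close> has degree \<open>n\<close>, while the other
  parameters are constants.\<close>

lemma basis_independent:
  assumes b: "\<And>k. k < n \<Longrightarrow> b k \<in> polys_in {..n}" and 0: "psubst \<sigma> (comb b) = 0" and k: "k < n"
  shows "b k = 0"
proof -
  let ?E = "\<lambda>k. if k = 0 then 1 else Zp k"
  have E: "as_poly n (psubst \<sigma> (e k)) = ?E k" if "k < n" for k
    using that by (simp add: e_def \<sigma>_x as_poly_zs rhomD[OF rhom_as_poly])
  have "0 = as_poly n (psubst \<sigma> (comb b))" using 0 by (simp add: rhomD[OF rhom_as_poly])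
  also have "\<dots> = (\<Sum>k<n. pcompose (as_poly n (b k)) \<Delta> * ?E k)"
    unfolding comb_def rhom_sum[OF rhom_psubst] rhom_sum[OF rhom_as_poly]
    by (rule sum.cong) (auto simp: rhomD(3)[OF rhom_as_poly] \<sigma>_psubst_\<theta> b E)
  finally have sum: "(\<Sum>k<n. pcompose (as_poly n (b k)) \<Delta> * ?E k) = 0" by simp
  have "as_poly n (b k) = 0"
  proof (rule pcompose_combination_eq_0[OF _ n _ _ sum k])
    show "degree \<Delta> = n" using Zp_degree[of "n - 1"] n by (simp add: \<Delta>_def)
  qed (use Zp_degree in auto)
  then show ?thesis using poly_as_poly[of n "b k"] by simp
qed

text \<open>An element of the kernel is congruent modulo \<open>J\<close> to a combination of the basis; its image
  vanishes, and hence so do its coefficients.\<close>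

lemma J_eq_kernel: "J = {p \<in> polys_in U. psubst \<sigma> p = 0}"
proof
  show "J \<subseteq> {p \<in> polys_in U. psubst \<sigma> p = 0}" using J_\<sigma> JI(1) by auto
  show "{p \<in> polys_in U. psubst \<sigma> p = 0} \<subseteq> J"
  proof
    fix f assume f: "f \<in> {p \<in> polys_in U. psubst \<sigma> p = 0}"
    then obtain b where b: "\<And>k. k < n \<Longrightarrow> b k \<in> polys_in {..n}" "f - comb b \<in> J" using generated by auto
    have 0: "psubst \<sigma> (comb b) = 0" using J_\<sigma>[OF b(2)] f by simp
    have "b k = 0" if "k < n" for k by (rule basis_independent[OF b(1) 0 that])
    then have "comb b = 0" by (simp add: comb_def)
    then show "f \<in> J" using b(2) by simp
  qed
qed

lemma prime_J: "primeideal J (polyR U)"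
  unfolding J_eq_kernel by (rule primeideal_kernel[OF rhom_psubst])

end


section \<open>Regular sequences modulo the ideal of 2-minors\<close>

text \<open>Consider the highest coefficient of \<open>q\<close> outside \<open>I\<close>. Multiplied by the leading coefficient of
  \<open>p\<close> it equals a coefficient of \<open>p * q\<close> up to elements of \<open>I\<close>.\<close>

lemma coefficients_in_saturated_ideal:
  fixes p q :: "('v, 'k::field) mp poly"
  assumes I: "ideal I (polyR W)" and p: "\<And>j. coeff p j \<in> polys_in W" and q: "\<And>j. coeff q j \<in> polys_in W"
    and sat: "\<And>a. a \<in> polys_in W \<Longrightarrow> lead_coeff p * a \<in> I \<Longrightarrow> a \<in> I"
    and pq: "\<And>j. coeff (p * q) j \<in> I"
  shows "coeff q j \<in> I"
proof (rule ccontr)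
  note II = ideal_polyRD[OF I]
  assume "coeff q j \<notin> I"
  define A where "A = {i. coeff q i \<notin> I}"
  have "A \<subseteq> {..degree q}" using coeff_eq_0[of q] II(2) by (auto simp: A_def not_le[symmetric] intro: ccontr)
  then have A: "finite A" "A \<noteq> {}" using finite_subset \<open>coeff q j \<notin> I\<close> by (auto simp: A_def)
  define m where "m = Max A"
  have m: "coeff q m \<notin> I" using Max_in[OF A] by (simp add: m_def A_def)
  have above: "coeff q i \<in> I" if "m < i" for i
    using Max_ge[OF A(1), of i] that by (auto simp: m_def A_def)
  let ?d = "degree p"
  have "coeff (p * q) (?d + m) = (\<Sum>i\<le>?d + m. coeff p i * coeff q (?d + m - i))" by (rule coeff_mult)
  also have "\<dots> = lead_coeff p * coeff q m + (\<Sum>i\<in>{..?d + m} - {?d}. coeff p i * coeff q (?d + m - i))"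
    by (subst sum.remove[of _ ?d]) auto
  finally have eq: "lead_coeff p * coeff q m =
    coeff (p * q) (?d + m) - (\<Sum>i\<in>{..?d + m} - {?d}. coeff p i * coeff q (?d + m - i))" by simp
  have "coeff p i * coeff q (?d + m - i) \<in> I" if "i \<in> {..?d + m} - {?d}" for i
  proof (cases "i < ?d")
    case True
    then show ?thesis using above[of "?d + m - i"] p by (intro II(5)) auto
  next
    case False
    then have "coeff p i = 0" using that by (intro coeff_eq_0) auto
    then show ?thesis using II(2) by simp
  qed
  then have "(\<Sum>i\<in>{..?d + m} - {?d}. coeff p i * coeff q (?d + m - i)) \<in> I"
    by (intro ideal_polyR_sum[OF I])
  then have "lead_coeff p * coeff q m \<in> I" unfolding eq by (intro II(4) pq)
  then show False using sat q m by blast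
qed

text \<open>View everything as polynomials in \<open>v\<^sub>i\<close>. The predecessors of \<open>G\<^sub>i\<close> are constants, so membership in
  the ideal they generate is tested on coefficients, and the leading coefficient of \<open>G\<^sub>i\<close> is a nonzero
  polynomial in \<open>T\<close>. The factor \<open>s\<close> says that the polynomials in \<open>T\<close> count as units.\<close>

lemma separate_variables_regular:
  fixes G :: "nat \<Rightarrow> (nat, 'k::field) mp" and v :: "nat \<Rightarrow> nat"
  assumes T: "T \<subseteq> W" and v: "\<And>l. l \<le> i \<Longrightarrow> v l \<in> W - T" "inj_on v {..i}"
    and G: "\<And>l. l \<le> i \<Longrightarrow> G l \<in> polys_in (insert (v l) T)" "G i \<noteq> 0"
    and b: "b \<in> polys_in W" and Gb: "G i * b \<in> gen W G i"
  shows "\<exists>s \<in> polys_in T. s \<noteq> 0 \<and> s * b \<in> gen W G i"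
proof -
  have GW: "G l \<in> polys_in W" if "l \<le> i" for l
    using G(1)[OF that] v(1)[OF that] T polys_in_mono[of "insert (v l) T" W] by auto
  have TW: "s \<in> polys_in W" if "s \<in> polys_in T" for s :: "(nat, 'k) mp" using that polys_in_mono[OF T] by blast
  define I where "I = gen W G i"
  have I: "ideal I (polyR W)" unfolding I_def by (rule ideal_gen) (rule GW, simp)
  note II = ideal_polyRD[OF I]
  define A where "A = {a \<in> polys_in W. \<exists>s \<in> polys_in T. s \<noteq> 0 \<and> s * a \<in> I}"
  have IA: "a \<in> A" if "a \<in> I" for a
    unfolding A_def using that II(1) by (intro CollectI conjI bexI[of _ 1]) auto
  have A: "ideal A (polyR W)"
  proof (rule ideal_polyRI)
    show "0 \<in> A" using IA II(2) by blast
  next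
    fix x y assume xy: "x \<in> A" "y \<in> A"
    then obtain s t where st: "s \<in> polys_in T" "s \<noteq> 0" "s * x \<in> I" "t \<in> polys_in T" "t \<noteq> 0" "t * y \<in> I"
      by (auto simp: A_def)
    have "t * (s * x) + s * (t * y) \<in> I" by (intro II(3) II(5) st TW)
    then have "(s * t) * (x + y) \<in> I" by (simp add: algebra_simps)
    moreover have "s * t \<noteq> 0" "s * t \<in> polys_in T" using st by auto
    moreover have "x + y \<in> polys_in W" using xy by (auto simp: A_def)
    ultimately show "x + y \<in> A" unfolding A_def by (intro CollectI conjI bexI[of _ "s * t"])
  next
    fix x r :: "(nat, 'k) mp" assume x: "x \<in> A" and r: "r \<in> polys_in W"
    then obtain s where s: "s \<in> polys_in T" "s \<noteq> 0" "s * x \<in> I" by (auto simp: A_def)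
    have "r * (s * x) \<in> I" by (rule II(5)[OF s(3) r])
    then have "s * (r * x) \<in> I" by (simp add: mult_ac)
    moreover have "r * x \<in> polys_in W" using x r by (auto simp: A_def)
    ultimately show "r * x \<in> A" using s unfolding A_def by (intro CollectI conjI bexI[of _ s])
  qed (auto simp: A_def)
  note AI = ideal_polyRD[OF A]
  define z where "z = v i"
  have z: "z \<in> W" "z \<notin> T" using v(1)[of i] by (auto simp: z_def)
  let ?p = "as_poly z (G i)" and ?q = "as_poly z b"
  have cf: "coeff (as_poly z c) j \<in> polys_in W" if "c \<in> polys_in W" for c :: "(nat, 'k) mp" and j
    using coeff_as_poly_in[OF that, of z j] polys_in_mono[of "W - {z}" W] by auto
  have p_coeff: "coeff ?p j \<in> polys_in T" for j
    using coeff_as_poly_in[OF G(1)[of i], of z j] z(2) by (simp add: z_def)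
  have p_nz: "?p \<noteq> 0" using G(2) by (metis poly_as_poly poly_0)
  have sat: "a \<in> A" if a: "a \<in> polys_in W" "lead_coeff ?p * a \<in> A" for a
  proof -
    from a(2) obtain s where s: "s \<in> polys_in T" "s \<noteq> 0" "s * (lead_coeff ?p * a) \<in> I" by (auto simp: A_def)
    have "s * lead_coeff ?p \<noteq> 0" "s * lead_coeff ?p \<in> polys_in T" using s p_nz p_coeff by auto
    then show ?thesis using s(3) a(1) unfolding A_def
      by (intro CollectI conjI bexI[of _ "s * lead_coeff ?p"]) (simp_all add: mult.assoc)
  qed
  obtain c where c: "\<forall>l<i. c l \<in> polys_in W" "G i * b = (\<Sum>l<i. c l * G l)" using Gb by (auto simp: gen_def)
  have const: "as_poly z (G l) = [:G l:]" if "l < i" for l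
  proof (rule as_poly_eq_const[OF G(1)])
    have "v l \<noteq> v i" using inj_onD[OF v(2), of l i] that by auto
    then show "z \<notin> insert (v l) T" using z by (simp add: z_def)
  qed (use that in simp)
  have "?p * ?q = (\<Sum>l<i. as_poly z (c l) * [:G l:])"
    using arg_cong[OF c(2), of "as_poly z"] const by (simp add: rhomD[OF rhom_as_poly] rhom_sum[OF rhom_as_poly])
  then have "coeff (?p * ?q) j = (\<Sum>l<i. coeff (as_poly z (c l)) j * G l)" for j
    by (simp add: coeff_sum mult.commute)
  moreover have "(\<Sum>l<i. coeff (as_poly z (c l)) j * G l) \<in> I" for j
    unfolding I_def by (rule genI) (use c(1) cf in auto)
  ultimately have pq: "coeff (?p * ?q) j \<in> A" for j using IA by simp
  have "coeff ?q j \<in> A" for j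
    by (rule coefficients_in_saturated_ideal[OF A _ _ sat pq]) (use cf b GW in auto)
  then have "(\<Sum>j\<le>degree ?q. coeff ?q j * Var z ^ j) \<in> A"
    using z(1) by (intro ideal_polyR_sum[OF A] AI(6)) (auto intro!: polys_in_power polys_in_Var)
  then have "b \<in> A" using poly_as_poly[of z b, unfolded poly_altdef] by simp
  then show ?thesis by (auto simp: A_def I_def)
qed

context complete_binomial begin

text \<open>A largest independent set \<open>T\<close> is one to which no parameter can be added.\<close>

lemma maximal_independent_parameters:
  assumes P: "primeideal P (polyR U)"
  obtains T where "T \<subseteq> {..n}" "\<And>b. b \<in> polys_in T \<Longrightarrow> psubst \<theta> b \<in> P \<Longrightarrow> b = 0"
    "\<And>i. i \<in> {..n} - T \<Longrightarrow> \<exists>b \<in> polys_in (insert i T). b \<noteq> 0 \<and> psubst \<theta> b \<in> P"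
proof -
  let ?ind = "\<lambda>T. T \<subseteq> {..n} \<and> (\<forall>b \<in> polys_in T. psubst \<theta> b \<in> P \<longrightarrow> b = 0)"
  have ind0: "?ind {}"
  proof (intro conjI ballI impI)
    fix b :: "(nat, 'k) mp" assume b: "b \<in> polys_in {}" "psubst \<theta> b \<in> P"
    obtain c where c: "b = Cst c" using polys_in_empty[OF b(1)] by blast
    show "b = 0"
    proof (rule ccontr)
      assume "b \<noteq> 0"
      have "Cst (inverse c) * psubst \<theta> b \<in> P"
        by (rule ideal_polyRD(5)[OF primeideal_polyRD(1)[OF P] b(2)]) simp
      then show False using \<open>b \<noteq> 0\<close> primeideal_polyRD(2)[OF P] by (simp add: c Cst_mult[symmetric])
    qed
  qed simp
  have "card T < n + 2" if "?ind T" for T using card_mono[of "{..n}" T] that by simp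
  then have bound: "\<forall>T. ?ind T \<longrightarrow> card T < n + 2" by blast
  from ex_has_greatest_nat[of ?ind, OF ind0 bound]
  obtain T where T: "?ind T" and max: "\<forall>S. ?ind S \<longrightarrow> card S \<le> card T"
    by - (erule exE, erule conjE, rule that)
  have "\<exists>b \<in> polys_in (insert i T). b \<noteq> 0 \<and> psubst \<theta> b \<in> P" if i: "i \<in> {..n} - T" for i
  proof (rule ccontr)
    assume "\<not> (\<exists>b \<in> polys_in (insert i T). b \<noteq> 0 \<and> psubst \<theta> b \<in> P)"
    then have "?ind (insert i T)" using T i by auto
    then have "card (insert i T) \<le> card T" using max by blast
    moreover have "finite T" using T finite_subset by auto
    ultimately show False using i by simp
  qed
  then show ?thesis using that T by blast
qed

lemma chain_length_bound:
  assumes T: "T \<subseteq> {..n}" and ind: "\<And>b. b \<in> polys_in T \<Longrightarrow> psubst \<theta> b \<in> P \<Longrightarrow> b = 0"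
    and C: "prime_chain (polyR U) k C" "J \<subseteq> C 0" "C k \<subseteq> P"
  shows "card T + k \<le> n + 1"
proof -
  have finT: "finite T" using T finite_subset by auto
  obtain h where h: "alg_indep (card T) h {b. psubst \<theta> b \<in> P}" "\<And>i. i < card T \<Longrightarrow> h i \<in> polys_in T"
    using alg_indep_Vars[OF finT, of "{b. psubst \<theta> b \<in> P}"] ind by auto
  have "card T + k \<le> card {..n}"
  proof (rule prime_chain_length_bound[OF C(1), where h = "\<lambda>i. psubst \<theta> (h i)" and \<sigma> = \<sigma>])
    show "alg_indep (card T) (\<lambda>i. psubst \<theta> (h i)) (C k)"
      using h(1) C(3) by (auto simp: alg_indep_def psubst_comp)
    show "psubst \<theta> (h i) \<in> polys_in U" if "i < card T" for i
      using h(2)[OF that] polys_in_mono[OF T] by (intro psubst_\<theta>_in) auto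
    show "p \<in> C 0" if "p \<in> polys_in U" "psubst \<sigma> p = 0" for p using that C(2) J_eq_kernel by auto
  qed (auto intro: \<sigma>_in)
  then show ?thesis by simp
qed

text \<open>Choose a maximal set \<open>T\<close> of parameters independent modulo \<open>P\<close>. Every other parameter satisfies an
  algebraic relation over \<open>T\<close> modulo \<open>P\<close>; these relations are the sequence. Coordinates with respect to
  the basis \<open>e\<close> reduce its regularity to polynomials in the parameters. Nonzero polynomials in \<open>T\<close>
  lie outside \<open>P\<close>, so they supply the factor \<open>s\<close>.\<close>

theorem regular_sequence_of_full_length:
  assumes P: "primeideal P (polyR U)" and JP: "J \<subseteq> P"
  shows "\<exists>xs. set xs \<subseteq> P
    \<and> (\<forall>k C. prime_chain (polyR U) k C \<longrightarrow> J \<subseteq> C 0 \<longrightarrow> C k \<subseteq> P \<longrightarrow> k \<le> length xs)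
    \<and> (\<forall>i<length xs. \<forall>r\<in>polys_in U. xs ! i * r \<in> Idl\<^bsub>polyR U\<^esub> (J \<union> set (take i xs)) \<longrightarrow>
        (\<exists>s \<in> polys_in U - P. s * r \<in> Idl\<^bsub>polyR U\<^esub> (J \<union> set (take i xs))))"
proof -
  obtain T where T: "T \<subseteq> {..n}" and ind: "\<And>b. b \<in> polys_in T \<Longrightarrow> psubst \<theta> b \<in> P \<Longrightarrow> b = 0"
    and dep: "\<And>i. i \<in> {..n} - T \<Longrightarrow> \<exists>b \<in> polys_in (insert i T). b \<noteq> 0 \<and> psubst \<theta> b \<in> P"
    using maximal_independent_parameters[OF P] by blast
  define m where "m = card ({..n} - T)"
  have finT: "finite T" using T finite_subset by auto
  have m: "card T + m = n + 1" using card_Un_disjoint[of T "{..n} - T"] finT T by (simp add: m_def Un_absorb1)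
  obtain v where v: "bij_betw v {..<m} ({..n} - T)"
    unfolding m_def using ex_bij_betw_nat_finite[of "{..n} - T"] by (auto simp: atLeast0LessThan)
  have v_in: "v l \<in> {..n} - T" if "l < m" for l using v that by (auto simp: bij_betw_def)
  define G where "G l = (SOME b. b \<in> polys_in (insert (v l) T) \<and> b \<noteq> 0 \<and> psubst \<theta> b \<in> P)" for l
  have G: "G l \<in> polys_in (insert (v l) T)" "G l \<noteq> 0" "psubst \<theta> (G l) \<in> P" if "l < m" for l
  proof -
    have "\<exists>b. b \<in> polys_in (insert (v l) T) \<and> b \<noteq> 0 \<and> psubst \<theta> b \<in> P" using dep[OF v_in[OF that]] by blast
    from someI_ex[OF this] show "G l \<in> polys_in (insert (v l) T)" "G l \<noteq> 0" "psubst \<theta> (G l) \<in> P"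
      unfolding G_def by auto
  qed
  have Gn: "G l \<in> polys_in {..n}" if "l < m" for l
    using G(1)[OF that] v_in[OF that] T polys_in_mono[of "insert (v l) T" "{..n}"] by auto
  define w where "w l = psubst \<theta> (G l)" for l
  have w_in: "w l \<in> polys_in U" if "l < m" for l unfolding w_def by (rule psubst_\<theta>_in[OF Gn[OF that]])
  define xs where "xs = map w [0..<m]"
  have len: "length xs = m" by (simp add: xs_def)
  have nth: "xs ! i = w i" "set (take i xs) = w ` {..<i}" if "i < m" for i
    using that by (auto simp: xs_def take_map take_upt atLeast0LessThan)
  have reg: "\<exists>s \<in> polys_in U - P. s * r \<in> Idl\<^bsub>polyR U\<^esub> (J \<union> w ` {..<i})"
    if i: "i < m" and r: "r \<in> polys_in U" and wr: "w i * r \<in> Idl\<^bsub>polyR U\<^esub> (J \<union> w ` {..<i})" for i r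
  proof -
    have eq: "Idl\<^bsub>polyR U\<^esub> (J \<union> w ` {..<i}) =
      {f \<in> polys_in U. \<exists>c. (\<forall>l<i. c l \<in> polys_in U) \<and> f - (\<Sum>l<i. c l * w l) \<in> J}"
      by (rule Idl_Un_eq[OF J]) (use w_in i in auto)
    from wr obtain c where c: "\<forall>l<i. c l \<in> polys_in U" "w i * r - (\<Sum>l<i. c l * w l) \<in> J" unfolding eq by blast
    obtain b where b: "\<And>k. k < n \<Longrightarrow> b k \<in> polys_in {..n}" "r - comb b \<in> J" using generated[OF r] by blast
    have "\<exists>d. (\<forall>k<n. d k \<in> polys_in {..n}) \<and> c l - comb d \<in> J" if "l < i" for l
    proof -
      have "c l \<in> polys_in U" using c(1) that by blast
      then obtain d where "\<And>k. k < n \<Longrightarrow> d k \<in> polys_in {..n}" "c l - comb d \<in> J" using generated by blast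
      then show ?thesis by blast
    qed
    then obtain d where d: "\<And>l k. l < i \<Longrightarrow> k < n \<Longrightarrow> d l k \<in> polys_in {..n}" "\<And>l. l < i \<Longrightarrow> c l - comb (d l) \<in> J"
      by metis
    (* The coordinates of the relation, which vanish because its image under \<sigma> does. *)
    let ?h = "\<lambda>k. G i * b k - (\<Sum>l<i. G l * d l k)"
    have "comb ?h = w i * comb b - (\<Sum>l<i. w l * comb (d l))"
      by (simp add: comb_diff comb_sum comb_mult w_def)
    also have "\<dots> = (w i * r - (\<Sum>l<i. c l * w l)) - w i * (r - comb b) + (\<Sum>l<i. w l * (c l - comb (d l)))"
      by (simp add: algebra_simps sum_subtractf)
    also have "\<dots> \<in> J"
      by (intro JI(3) JI(4) JI(5) ideal_polyR_sum[OF J] c(2) b(2) d(2) w_in) (use i in auto)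
    finally have "psubst \<sigma> (comb ?h) = 0" by (rule J_\<sigma>)
    moreover have "?h k \<in> polys_in {..n}" if "k < n" for k
      using b(1) d(1) Gn i that by (intro polys_in_diff polys_in_mult polys_in_sum) auto
    ultimately have h0: "?h k = 0" if "k < n" for k using basis_independent[of ?h] that by blast
    have sat: "\<exists>s \<in> polys_in T. s \<noteq> 0 \<and> s * b k \<in> gen {..n} G i" if k: "k < n" for k
    proof (rule separate_variables_regular[OF T])
      show "v l \<in> {..n} - T" if "l \<le> i" for l using v_in i that by simp
      show "inj_on v {..i}" using v i by (auto simp: bij_betw_def intro: inj_on_subset)
      have "G i * b k = (\<Sum>l<i. d l k * G l)" using h0[OF k] by (simp add: mult.commute)
      also have "\<dots> \<in> gen {..n} G i" by (rule genI) (use d(1) k in auto)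
      finally show "G i * b k \<in> gen {..n} G i" .
    qed (use G b k i in auto)
    define s where "s k = (SOME s. s \<in> polys_in T \<and> s \<noteq> 0 \<and> s * b k \<in> gen {..n} G i)" for k
    have s: "s k \<in> polys_in T" "s k \<noteq> 0" "s k * b k \<in> gen {..n} G i" if "k < n" for k
    proof -
      have "\<exists>s. s \<in> polys_in T \<and> s \<noteq> 0 \<and> s * b k \<in> gen {..n} G i" using sat[OF that] by blast
      from someI_ex[OF this] show "s k \<in> polys_in T" "s k \<noteq> 0" "s k * b k \<in> gen {..n} G i"
        unfolding s_def by auto
    qed
    (* A common factor for all coordinates. *)
    define S where "S = (\<Prod>k<n. s k)"
    have S: "S \<in> polys_in T" "S \<noteq> 0" using s by (auto simp: S_def intro!: polys_in_prod)
    have STn: "p \<in> polys_in {..n}" if "p \<in> polys_in T" for p :: "(nat, 'k) mp" using that polys_in_mono[OF T] by blast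
    have gI: "ideal (gen {..n} G i) (polyR {..n})" by (rule ideal_gen) (use Gn i in auto)
    have "S * b k \<in> gen {..n} G i" if "k < n" for k
    proof -
      have "S = s k * (\<Prod>j\<in>{..<n} - {k}. s j)" using that by (simp add: S_def prod.remove)
      moreover have "(\<Prod>j\<in>{..<n} - {k}. s j) * (s k * b k) \<in> gen {..n} G i"
        by (rule ideal_polyRD(5)[OF gI s(3)[OF that]]) (use s STn in \<open>auto intro!: polys_in_prod\<close>)
      ultimately show ?thesis by (simp add: mult_ac)
    qed
    then have "\<exists>a. (\<forall>l<i. a l \<in> polys_in {..n}) \<and> S * b k = (\<Sum>l<i. a l * G l)" if "k < n" for k
      using that by (auto simp: gen_def)
    then obtain a where a: "\<And>k l. k < n \<Longrightarrow> l < i \<Longrightarrow> a k l \<in> polys_in {..n}"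
      "\<And>k. k < n \<Longrightarrow> S * b k = (\<Sum>l<i. a k l * G l)" by metis
    have comb_cong: "comb b1 = comb b2" if "\<And>k. k < n \<Longrightarrow> b1 k = b2 k" for b1 b2
      unfolding comb_def using that by (intro sum.cong) auto
    have "psubst \<theta> S * comb b = comb (\<lambda>k. S * b k)" by (simp add: comb_mult)
    also have "\<dots> = comb (\<lambda>k. \<Sum>l<i. G l * a k l)" by (rule comb_cong) (simp add: a(2) mult.commute)
    also have "\<dots> = (\<Sum>l<i. comb (\<lambda>k. a k l) * w l)" by (simp add: comb_sum comb_mult w_def mult.commute)
    finally have Sb: "psubst \<theta> S * comb b = (\<Sum>l<i. comb (\<lambda>k. a k l) * w l)" .
    have SU: "psubst \<theta> S \<in> polys_in U" by (rule psubst_\<theta>_in[OF STn[OF S(1)]])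
    have "psubst \<theta> S * (r - comb b) \<in> J" by (rule JI(5)[OF b(2) SU])
    then have "psubst \<theta> S * r - (\<Sum>l<i. comb (\<lambda>k. a k l) * w l) \<in> J" by (simp add: right_diff_distrib Sb)
    moreover have "\<forall>l<i. comb (\<lambda>k. a k l) \<in> polys_in U" using a(1) by (auto intro!: comb_in)
    moreover have "psubst \<theta> S * r \<in> polys_in U" using SU r by auto
    ultimately have "psubst \<theta> S * r \<in> Idl\<^bsub>polyR U\<^esub> (J \<union> w ` {..<i})"
      unfolding eq by (intro CollectI conjI exI[of _ "\<lambda>l. comb (\<lambda>k. a k l)"])
    moreover have "psubst \<theta> S \<notin> P" using ind S by blast
    ultimately show ?thesis using SU by blast
  qed
  show ?thesis
  proof (intro exI[of _ xs] conjI allI impI ballI)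
    show "set xs \<subseteq> P" using G(3) by (auto simp: xs_def w_def)
    show "k \<le> length xs" if "prime_chain (polyR U) k C" "J \<subseteq> C 0" "C k \<subseteq> P" for k C
      using chain_length_bound[OF T ind that] m len by simp
  qed (use reg nth len in auto)
qed

end


section \<open>Depth, dimension and localization\<close>

subsection \<open>Depth and dimension\<close>

text \<open>An ideal maximal among those that contain \<open>I\<close> and avoid \<open>S\<close> is prime.\<close>

lemma (in cring) noetherian_prime_avoiding:
  assumes "noetherian_ring R" and I: "ideal I R"
    and S: "\<And>s t. s \<in> S \<Longrightarrow> t \<in> S \<Longrightarrow> s \<otimes> t \<in> S" "S \<noteq> {}" "S \<subseteq> carrier R" "I \<inter> S = {}"
  shows "\<exists>Q. primeideal Q R \<and> I \<subseteq> Q \<and> Q \<inter> S = {}"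
proof -
  interpret noetherian_ring R by fact
  let ?F = "{Q. ideal Q R \<and> I \<subseteq> Q \<and> Q \<inter> S = {}}"
  have "\<exists>M\<in>?F. \<forall>Q\<in>?F. M \<subseteq> Q \<longrightarrow> Q = M"
  proof (rule subset_Zorn)
    fix C assume C: "subset.chain ?F C"
    show "\<exists>T\<in>?F. \<forall>Q\<in>C. Q \<subseteq> T"
    proof (cases "C = {}")
      case True
      then show ?thesis using I S(4) by blast
    next
      case False
      have "subset.chain {I. ideal I R} C" using C by (auto simp: subset.chain_def)
      then have "\<Union>C \<in> C" by (rule ideal_chain_is_trivial[OF False])
      then show ?thesis using C by (intro bexI[of _ "\<Union>C"]) (auto simp: subset.chain_def)
    qed
  qed
  then obtain Q where Q: "ideal Q R" "I \<subseteq> Q" "Q \<inter> S = {}"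
    and max: "\<And>Q'. ideal Q' R \<Longrightarrow> Q \<subseteq> Q' \<Longrightarrow> Q' \<inter> S = {} \<Longrightarrow> Q' = Q" by auto
  interpret Q: ideal Q R by fact
  have meets: "\<exists>q\<in>Q. \<exists>r\<in>carrier R. q \<oplus> r \<otimes> a \<in> S" if a: "a \<in> carrier R" "a \<notin> Q" for a
  proof (rule ccontr)
    assume no: "\<not> (\<exists>q\<in>Q. \<exists>r\<in>carrier R. q \<oplus> r \<otimes> a \<in> S)"
    let ?Q = "Q <+>\<^bsub>R\<^esub> PIdl a"
    have mem: "x \<in> ?Q \<longleftrightarrow> (\<exists>q\<in>Q. \<exists>r\<in>carrier R. x = q \<oplus> r \<otimes> a)" for x
      by (auto simp: set_add_def' cgenideal_def)
    have "ideal ?Q R" by (rule add_ideals[OF Q(1) cgenideal_ideal[OF a(1)]])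
    moreover have "Q \<subseteq> ?Q"
    proof
      fix q assume q: "q \<in> Q"
      then have "q = q \<oplus> \<zero> \<otimes> a" using a(1) Q.a_subset by auto
      then show "q \<in> ?Q" unfolding mem using q by blast
    qed
    moreover have "?Q \<inter> S = {}"
    proof (rule equals0I, elim IntE)
      fix t assume "t \<in> ?Q" "t \<in> S"
      then obtain q r where "q \<in> Q" "r \<in> carrier R" "t = q \<oplus> r \<otimes> a" unfolding mem by blast
      then show False using no \<open>t \<in> S\<close> by blast
    qed
    ultimately have "?Q = Q" using max by blast
    moreover have "a \<in> ?Q"
    proof -
      have "a = \<zero> \<oplus> \<one> \<otimes> a" using a(1) by simp
      moreover have "\<zero> \<in> Q" using additive_subgroup.zero_closed[OF Q.is_additive_subgroup] .
      ultimately show ?thesis unfolding mem by blast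
    qed
    ultimately show False using a(2) by simp
  qed
  have "primeideal Q R"
  proof (rule primeidealI[OF Q(1) cring_axioms])
    show "carrier R \<noteq> Q" using S(2,3) Q(3) by blast
    fix a b assume ab: "a \<in> carrier R" "b \<in> carrier R" "a \<otimes> b \<in> Q"
    show "a \<in> Q \<or> b \<in> Q"
    proof (rule ccontr)
      assume "\<not> (a \<in> Q \<or> b \<in> Q)"
      then obtain q r q' r' where *: "q \<in> Q" "r \<in> carrier R" "q \<oplus> r \<otimes> a \<in> S" "q' \<in> Q" "r' \<in> carrier R" "q' \<oplus> r' \<otimes> b \<in> S"
        using meets ab by meson
      have c: "q \<in> carrier R" "q' \<in> carrier R" using * Q.a_subset by auto
      have "(q \<oplus> r \<otimes> a) \<otimes> (q' \<oplus> r' \<otimes> b) = (q' \<oplus> r' \<otimes> b) \<otimes> q \<oplus> ((r \<otimes> a) \<otimes> q' \<oplus> (r \<otimes> r') \<otimes> (a \<otimes> b))"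
        using c * ab by algebra
      also have "\<dots> \<in> Q"
        by (rule additive_subgroup.a_closed[OF Q.is_additive_subgroup Q.I_l_closed[OF *(1)]
              additive_subgroup.a_closed[OF Q.is_additive_subgroup Q.I_l_closed[OF *(4)] Q.I_l_closed[OF ab(3)]]])
          (use * ab c in auto)
      finally show False using S(1)[OF *(3,6)] Q(3) by blast
    qed
  qed
  then show ?thesis using Q by blast
qed

text \<open>The products of powers of \<open>x\<close> with elements outside \<open>P\<close> avoid \<open>I\<close>: by regularity the power of
  \<open>x\<close> can be cancelled, which would leave an element of \<open>I\<close> outside \<open>P\<close>. A prime that contains \<open>I\<close>
  and avoids all these products lies in \<open>P\<close> and misses \<open>x\<close>.\<close>

lemma (in cring) prime_below_nonzerodivisor:
  assumes noeth: "noetherian_ring R" and I: "ideal I R" and P: "primeideal P R" and IP: "I \<subseteq> P"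
    and x: "x \<in> P" and reg: "\<And>r. r \<in> carrier R \<Longrightarrow> x \<otimes> r \<in> I \<Longrightarrow> r \<in> I"
  shows "\<exists>Q. primeideal Q R \<and> I \<subseteq> Q \<and> Q \<subset> P"
proof -
  interpret P: primeideal P R by fact
  have xR: "x \<in> carrier R" using x P.a_subset by auto
  let ?S = "{x [^] (k::nat) \<otimes> s | k s. s \<in> carrier R - P}"
  have one: "\<one> \<in> carrier R - P" using P.one_imp_carrier P.I_notcarr by auto
  have pow: "r \<in> I" if "r \<in> carrier R" "x [^] (k::nat) \<otimes> r \<in> I" for k r
    using that(2)
  proof (induction k)
    case 0 then show ?case using that(1) by simp
  next
    case (Suc k)
    have "x [^] Suc k \<otimes> r = x \<otimes> (x [^] k \<otimes> r)" using xR that(1) by (simp add: m_ac nat_pow_Suc2 m_assoc)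
    then show ?case using Suc reg[of "x [^] k \<otimes> r"] xR that(1) by simp
  qed
  have "\<exists>Q. primeideal Q R \<and> I \<subseteq> Q \<and> Q \<inter> ?S = {}"
  proof (rule noetherian_prime_avoiding[OF noeth I])
    show "?S \<noteq> {}" using one by blast
    show "?S \<subseteq> carrier R" using xR by auto
    show "I \<inter> ?S = {}" using pow IP by blast
    fix a b assume "a \<in> ?S" "b \<in> ?S"
    then obtain k l s t where ab: "a = x [^] (k::nat) \<otimes> s" "b = x [^] (l::nat) \<otimes> t" "s \<in> carrier R - P" "t \<in> carrier R - P"
      by blast
    have "a \<otimes> b = x [^] (k + l) \<otimes> (s \<otimes> t)"
      using ab xR by (simp add: nat_pow_mult[symmetric] m_ac)
    moreover have "s \<otimes> t \<in> carrier R - P" using ab P.I_prime[of s t] by auto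
    ultimately show "a \<otimes> b \<in> ?S" by blast
  qed
  then obtain Q where Q: "primeideal Q R" "I \<subseteq> Q" "Q \<inter> ?S = {}" by blast
  interpret Q: primeideal Q R by (rule Q(1))
  have QR: "Q \<subseteq> carrier R" by (rule Q.a_subset)
  have "Q \<subseteq> P"
  proof
    fix q assume q: "q \<in> Q"
    show "q \<in> P"
    proof (rule ccontr)
      assume "q \<notin> P"
      then have "q \<in> carrier R - P" "q = x [^] (0::nat) \<otimes> q" using q QR by auto
      then have "q \<in> ?S" by blast
      then show False using Q(3) q by blast
    qed
  qed
  moreover have "x \<notin> Q"
  proof
    assume "x \<in> Q"
    moreover have "x = x [^] (1::nat) \<otimes> \<one>" using xR by simp
    then have "x \<in> ?S" using one by blast
    ultimately show False using Q(3) by blast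
  qed
  ultimately show ?thesis using Q x by blast
qed

text \<open>Start with a prime containing a regular sequence and drop its entries from the last to the
  first; each of them gives a strictly smaller prime over the ideal of the remaining ones.\<close>

lemma (in cring) depth_le_krull_dim:
  assumes noeth: "noetherian_ring R" shows "depth R M \<le> krull_dim R"
  unfolding depth_def
proof (rule Sup_least, safe)
  fix xs assume xs: "regular_sequence R xs"
  have sub: "set (take i xs) \<subseteq> carrier R" for i
    using xs set_take_subset[of i xs] by (auto simp: regular_sequence_def)
  have chain: "\<exists>C. prime_chain R i C \<and> C i = P"
    if "i \<le> length xs" "primeideal P R" "Idl (set (take i xs)) \<subseteq> P" for i P
    using that
  proof (induction i arbitrary: P)
    case 0
    then show ?case by (intro exI[of _ "\<lambda>_. P"]) (simp add: prime_chain_def)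
  next
    case (Suc i)
    have i: "i < length xs" using Suc.prems(1) by simp
    have "set (take i xs) \<subseteq> set (take (Suc i) xs)" using i by (auto simp: take_Suc_conv_app_nth)
    then have "Idl (set (take i xs)) \<subseteq> Idl (set (take (Suc i) xs))"
      using genideal_self[OF sub] by (intro genideal_minimal[OF genideal_ideal[OF sub]]) blast
    then have IP: "Idl (set (take i xs)) \<subseteq> P" using Suc.prems(3) by blast
    have "xs ! i \<in> set (take (Suc i) xs)" using i by (simp add: take_Suc_conv_app_nth)
    then have x: "xs ! i \<in> P" using genideal_self[OF sub[of "Suc i"]] Suc.prems(3) by blast
    have reg: "r \<in> Idl (set (take i xs))" if "r \<in> carrier R" "xs ! i \<otimes> r \<in> Idl (set (take i xs))" for r
      using xs i that by (auto simp: regular_sequence_def)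
    obtain Q where Q: "primeideal Q R" "Idl (set (take i xs)) \<subseteq> Q" "Q \<subset> P"
      using prime_below_nonzerodivisor[OF noeth genideal_ideal[OF sub] Suc.prems(2) IP x reg] by blast
    obtain C where C: "prime_chain R i C" "C i = Q" using Suc.IH[OF _ Q(1,2)] i by auto
    have "C i \<subset> P" using C(2) Q(3) by simp
    note ch = prime_chain_snoc[OF C(1) this Suc.prems(2)]
    have "(C(Suc i := P)) (Suc i) = P" by simp
    with ch show ?case by (intro exI conjI)
  qed
  let ?I = "Idl (set xs)"
  have I: "ideal ?I R" using sub[of "length xs"] by (intro genideal_ideal) simp
  interpret I: ideal ?I R by fact
  have "\<one> \<notin> ?I" using xs I.one_imp_carrier by (auto simp: regular_sequence_def)
  then obtain P where P: "primeideal P R" "?I \<subseteq> P"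
    using noetherian_prime_avoiding[OF noeth I, of "{\<one>}"] by auto
  then obtain C where "prime_chain R (length xs) C" using chain[of "length xs" P] by auto
  then show "enat (length xs) \<le> krull_dim R"
    unfolding krull_dim_def by (intro Sup_upper) blast
qed


subsection \<open>Homomorphisms to a localization\<close>

text \<open>The last three assumptions characterize the composite of \<open>R \<rightarrow> R/J\<close> with the localization at
  \<open>P/J\<close>. Stating them for one homomorphism out of \<open>R\<close> lets ideals, primes and regular sequences of
  the local ring be studied in \<open>R\<close> itself.\<close>

locale localization_hom = ring_hom_cring R L h for R (structure) and L (structure) and h +
  fixes P J
  assumes P: "primeideal P R" and J: "ideal J R" and JP: "J \<subseteq> P"
    and units: "s \<in> carrier R \<Longrightarrow> s \<notin> P \<Longrightarrow> h s \<in> Units L"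
    and fraction: "l \<in> carrier L \<Longrightarrow> \<exists>a\<in>carrier R. \<exists>s\<in>carrier R - P. h s \<otimes>\<^bsub>L\<^esub> l = h a"
    and kernel: "a \<in> carrier R \<Longrightarrow> h a = \<zero>\<^bsub>L\<^esub> \<longleftrightarrow> (\<exists>u\<in>carrier R - P. u \<otimes> a \<in> J)"
begin

lemma hom_ring: "ring_hom_ring R L h"
  by (rule ring_hom_ringI2[OF R.ring_axioms S.ring_axioms homh])

sublocale P: primeideal P R by (rule P)
sublocale J: ideal J R by (rule J)

definition ext :: "'a set \<Rightarrow> 'c set" where
  "ext I = {l \<in> carrier L. \<exists>a\<in>I. \<exists>s\<in>carrier R - P. h s \<otimes>\<^bsub>L\<^esub> l = h a}"

definition contr :: "'c set \<Rightarrow> 'a set" where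
  "contr I = {a \<in> carrier R. h a \<in> I}"

lemma mult_notin: "s \<in> carrier R - P \<Longrightarrow> t \<in> carrier R - P \<Longrightarrow> s \<otimes> t \<in> carrier R - P"
  using P.I_prime[of s t] by auto

lemma one_notin: "\<one> \<in> carrier R - P"
  using P.one_imp_carrier P.I_notcarr by auto

lemma ideal_ext:
  assumes "ideal I R" shows "ideal (ext I) L"
proof (rule S.idealI')
  interpret I: ideal I R by fact
  show "ext I \<subseteq> carrier L" by (auto simp: ext_def)
  have "h \<one> \<otimes>\<^bsub>L\<^esub> \<zero>\<^bsub>L\<^esub> = h \<zero>" by simp
  then show "\<zero>\<^bsub>L\<^esub> \<in> ext I"
    unfolding ext_def using one_notin additive_subgroup.zero_closed[OF I.is_additive_subgroup] by blast
next
  interpret I: ideal I R by fact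
  fix l k assume "l \<in> ext I" "k \<in> ext I"
  then obtain a s b t where *: "l \<in> carrier L" "a \<in> I" "s \<in> carrier R - P" "h s \<otimes>\<^bsub>L\<^esub> l = h a"
    "k \<in> carrier L" "b \<in> I" "t \<in> carrier R - P" "h t \<otimes>\<^bsub>L\<^esub> k = h b" unfolding ext_def by blast
  have c: "a \<in> carrier R" "b \<in> carrier R" "s \<in> carrier R" "t \<in> carrier R" using * I.a_subset by auto
  have hc: "h s \<in> carrier L" "h t \<in> carrier L" using c by auto
  have "h (s \<otimes> t) \<otimes>\<^bsub>L\<^esub> (l \<oplus>\<^bsub>L\<^esub> k) = h t \<otimes>\<^bsub>L\<^esub> (h s \<otimes>\<^bsub>L\<^esub> l) \<oplus>\<^bsub>L\<^esub> h s \<otimes>\<^bsub>L\<^esub> (h t \<otimes>\<^bsub>L\<^esub> k)"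
    using c hc *(1,5) by (simp add: S.r_distr S.m_ac)
  also have "\<dots> = h (t \<otimes> a \<oplus> s \<otimes> b)" using * c by simp
  finally have "h (s \<otimes> t) \<otimes>\<^bsub>L\<^esub> (l \<oplus>\<^bsub>L\<^esub> k) = h (t \<otimes> a \<oplus> s \<otimes> b)" .
  moreover have "t \<otimes> a \<oplus> s \<otimes> b \<in> I"
    using additive_subgroup.a_closed[OF I.is_additive_subgroup] I.I_l_closed * c by auto
  ultimately show "l \<oplus>\<^bsub>L\<^esub> k \<in> ext I"
    unfolding ext_def using *(1,5) mult_notin[OF *(3,7)] by blast
next
  interpret I: ideal I R by fact
  fix l r assume l: "l \<in> ext I" and r: "r \<in> carrier L"
  from l obtain a s where *: "l \<in> carrier L" "a \<in> I" "s \<in> carrier R - P" "h s \<otimes>\<^bsub>L\<^esub> l = h a" unfolding ext_def by blast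
  obtain b t where bt: "b \<in> carrier R" "t \<in> carrier R - P" "h t \<otimes>\<^bsub>L\<^esub> r = h b" using fraction[OF r] by blast
  have c: "a \<in> carrier R" "s \<in> carrier R" "t \<in> carrier R" using * bt I.a_subset by auto
  have hc: "h s \<in> carrier L" "h t \<in> carrier L" using c by auto
  have "h (t \<otimes> s) \<otimes>\<^bsub>L\<^esub> (r \<otimes>\<^bsub>L\<^esub> l) = (h t \<otimes>\<^bsub>L\<^esub> r) \<otimes>\<^bsub>L\<^esub> (h s \<otimes>\<^bsub>L\<^esub> l)"
    using c hc *(1) r by (simp add: S.m_ac)
  also have "\<dots> = h (b \<otimes> a)" using * bt c by simp
  finally show "r \<otimes>\<^bsub>L\<^esub> l \<in> ext I"
    unfolding ext_def using *(1) r mult_notin[OF bt(2) *(3)] I.I_l_closed[OF *(2) bt(1)] by blast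
qed

lemma hom_in_ext_iff:
  assumes I: "ideal I R" "J \<subseteq> I" and a: "a \<in> carrier R"
  shows "h a \<in> ext I \<longleftrightarrow> (\<exists>u\<in>carrier R - P. u \<otimes> a \<in> I)"
proof
  interpret I: ideal I R by fact
  assume "h a \<in> ext I"
  then obtain b s where *: "b \<in> I" "s \<in> carrier R - P" "h s \<otimes>\<^bsub>L\<^esub> h a = h b" unfolding ext_def by blast
  have c: "b \<in> carrier R" "s \<in> carrier R" using * I.a_subset by auto
  have "h (s \<otimes> a \<ominus> b) = \<zero>\<^bsub>L\<^esub>" using * c a by (simp add: a_minus_def) (simp add: S.r_neg)
  then obtain u where u: "u \<in> carrier R - P" "u \<otimes> (s \<otimes> a \<ominus> b) \<in> J" using kernel[of "s \<otimes> a \<ominus> b"] c a by auto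
  have "(u \<otimes> s) \<otimes> a = u \<otimes> (s \<otimes> a \<ominus> b) \<oplus> u \<otimes> b" using u(1) c a by (auto, algebra)
  also have "\<dots> \<in> I"
    using additive_subgroup.a_closed[OF I.is_additive_subgroup] I.I_l_closed[OF *(1), of u] u I(2) by blast
  finally show "\<exists>u\<in>carrier R - P. u \<otimes> a \<in> I" using mult_notin[OF u(1) *(2)] by blast
next
  assume "\<exists>u\<in>carrier R - P. u \<otimes> a \<in> I"
  then obtain u where u: "u \<in> carrier R - P" "u \<otimes> a \<in> I" by blast
  then have "h u \<otimes>\<^bsub>L\<^esub> h a = h (u \<otimes> a)" using a by simp
  then show "h a \<in> ext I" unfolding ext_def using u a by blast
qed

lemma in_ideal_via_unit:
  assumes "ideal I L" "l \<in> carrier L" "s \<in> carrier R - P" "h s \<otimes>\<^bsub>L\<^esub> l \<in> I" shows "l \<in> I"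
proof -
  interpret I: ideal I L by fact
  have u: "h s \<in> Units L" using units assms(3) by auto
  have "l = inv\<^bsub>L\<^esub> (h s) \<otimes>\<^bsub>L\<^esub> (h s \<otimes>\<^bsub>L\<^esub> l)"
    using u assms(2) S.Units_closed[OF u] S.Units_inv_closed[OF u] S.Units_l_inv[OF u]
    by (simp add: S.m_assoc[symmetric])
  also have "\<dots> \<in> I" using I.I_l_closed[OF assms(4) S.Units_inv_closed[OF u]] .
  finally show ?thesis .
qed

lemma contr_props:
  assumes I: "ideal I L" shows "ideal (contr I) R" "J \<subseteq> contr I" "ext (contr I) = I"
proof -
  interpret I: ideal I L by fact
  show "ideal (contr I) R" unfolding contr_def by (rule ring_hom_ring.ideal_vimage[OF hom_ring I])
  show "J \<subseteq> contr I"
  proof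
    fix a assume a: "a \<in> J"
    then have c: "a \<in> carrier R" using J.a_subset by auto
    have "\<one> \<otimes> a \<in> J" using a c by simp
    then have "h a = \<zero>\<^bsub>L\<^esub>" using kernel[OF c] one_notin by blast
    then show "a \<in> contr I"
      using c additive_subgroup.zero_closed[OF I.is_additive_subgroup] by (simp add: contr_def)
  qed
  show "ext (contr I) = I"
  proof
    show "ext (contr I) \<subseteq> I"
    proof
      fix l assume "l \<in> ext (contr I)"
      then obtain a s where "l \<in> carrier L" "h a \<in> I" "s \<in> carrier R - P" "h s \<otimes>\<^bsub>L\<^esub> l = h a"
        unfolding ext_def contr_def by blast
      then show "l \<in> I" using in_ideal_via_unit[OF I, of l s] by simp
    qed
    show "I \<subseteq> ext (contr I)"
    proof
      fix l assume l: "l \<in> I"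
      then have lc: "l \<in> carrier L" using I.a_subset by auto
      obtain a s where as: "a \<in> carrier R" "s \<in> carrier R - P" "h s \<otimes>\<^bsub>L\<^esub> l = h a" using fraction[OF lc] by blast
      have "h a \<in> I" using I.I_l_closed[OF l, of "h s"] as by auto
      then show "l \<in> ext (contr I)" using as lc unfolding ext_def contr_def by blast
    qed
  qed
qed

lemma ext_mono: "I \<subseteq> I' \<Longrightarrow> ext I \<subseteq> ext I'"
  by (auto simp: ext_def)

lemma hom_ext: "a \<in> I \<Longrightarrow> I \<subseteq> carrier R \<Longrightarrow> h a \<in> ext I"
  unfolding ext_def using one_notin by (intro CollectI conjI bexI[of _ a] bexI[of _ "\<one>"]) auto

lemma ext_Idl:
  assumes B: "B \<subseteq> carrier R" shows "ext (Idl (J \<union> B)) = Idl\<^bsub>L\<^esub> (h ` B)"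
proof
  have sub: "J \<union> B \<subseteq> carrier R" using B J.a_subset by auto
  have subL: "h ` B \<subseteq> carrier L" using B by auto
  note I = R.genideal_ideal[OF sub] and IL = S.genideal_ideal[OF subL]
  interpret I: ideal "Idl (J \<union> B)" R by (rule I)
  show "Idl\<^bsub>L\<^esub> (h ` B) \<subseteq> ext (Idl (J \<union> B))"
    by (rule S.genideal_minimal[OF ideal_ext[OF I]])
      (use R.genideal_self[OF sub] I.a_subset in \<open>auto intro!: hom_ext\<close>)
  have "Idl (J \<union> B) \<subseteq> contr (Idl\<^bsub>L\<^esub> (h ` B))"
    by (rule R.genideal_minimal[OF contr_props(1)[OF IL]])
      (use contr_props(2)[OF IL] S.genideal_self[OF subL] B in \<open>auto simp: contr_def\<close>)
  from ext_mono[OF this] show "ext (Idl (J \<union> B)) \<subseteq> Idl\<^bsub>L\<^esub> (h ` B)" using contr_props(3)[OF IL] by simp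
qed

lemma noetherian_L: assumes "noetherian_ring R" shows "noetherian_ring L"
proof (rule S.noetherian_ringI)
  interpret R': noetherian_ring R by fact
  fix I assume I: "ideal I L"
  obtain A where A: "A \<subseteq> carrier R" "finite A" "contr I = Idl A" using R'.finetely_gen[OF contr_props(1)[OF I]] by blast
  have sub: "J \<union> A \<subseteq> carrier R" using A J.a_subset by auto
  have "Idl (J \<union> A) = contr I"
  proof
    show "Idl (J \<union> A) \<subseteq> contr I"
      by (rule R.genideal_minimal[OF contr_props(1)[OF I]]) (use contr_props(2)[OF I] R.genideal_self[OF A(1)] A(3) in auto)
    show "contr I \<subseteq> Idl (J \<union> A)" unfolding A(3)
      by (rule R.genideal_minimal[OF R.genideal_ideal[OF sub]]) (use R.genideal_self[OF sub] in auto)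
  qed
  then have "I = Idl\<^bsub>L\<^esub> (h ` A)" using ext_Idl[OF A(1)] contr_props(3)[OF I] by simp
  then show "\<exists>A\<subseteq>carrier L. finite A \<and> I = Idl\<^bsub>L\<^esub> A" using A by (intro exI[of _ "h ` A"]) auto
qed

lemma one_notin_ext: "\<one>\<^bsub>L\<^esub> \<notin> ext P"
proof
  assume "\<one>\<^bsub>L\<^esub> \<in> ext P"
  then have "h \<one> \<in> ext P" by simp
  then obtain u where "u \<in> carrier R - P" "u \<otimes> \<one> \<in> P" using hom_in_ext_iff[OF P.is_ideal JP R.one_closed] by blast
  then show False by simp
qed

lemma proper_le_ext_P:
  assumes I: "ideal I L" "I \<noteq> carrier L" shows "I \<subseteq> ext P"
proof
  interpret I: ideal I L by fact
  fix l assume l: "l \<in> I"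
  then have lc: "l \<in> carrier L" using I.a_subset by auto
  obtain a s where as: "a \<in> carrier R" "s \<in> carrier R - P" "h s \<otimes>\<^bsub>L\<^esub> l = h a" using fraction[OF lc] by blast
  have ha: "h a \<in> I" using I.I_l_closed[OF l, of "h s"] as by auto
  have "a \<in> P"
  proof (rule ccontr)
    assume "a \<notin> P"
    then have "a \<in> carrier R - P" using as by simp
    moreover have "h a \<otimes>\<^bsub>L\<^esub> \<one>\<^bsub>L\<^esub> \<in> I" using ha as by simp
    ultimately have "\<one>\<^bsub>L\<^esub> \<in> I" using in_ideal_via_unit[OF I(1) S.one_closed] by blast
    then show False using I.one_imp_carrier I(2) by blast
  qed
  then show "l \<in> ext P" unfolding ext_def using as lc by blast
qed

lemma maximal_ideals_L: "{N. maximalideal N L} = {ext P}"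
proof -
  have ne: "ext P \<noteq> carrier L" using one_notin_ext by auto
  have id: "ideal (ext P) L" by (rule ideal_ext[OF P.is_ideal])
  have "maximalideal (ext P) L"
  proof (rule maximalidealI[OF id])
    show "carrier L \<noteq> ext P" using ne by simp
    fix I assume "ideal I L" "ext P \<subseteq> I" "I \<subseteq> carrier L"
    then show "I = ext P \<or> I = carrier L" using proper_le_ext_P by blast
  qed
  moreover have "N = ext P" if N: "maximalideal N L" for N
  proof -
    interpret N: maximalideal N L by fact
    have "N \<subseteq> ext P" using proper_le_ext_P[OF N.is_ideal] N.I_notcarr by auto
    then show ?thesis using N.I_maximal[OF id] ne ideal.Icarr[OF id] by auto
  qed
  ultimately show ?thesis by blast
qed

text \<open>The regular sequence bounds the depth from below and the chains of primes bound the dimension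
  from above, both by \<open>length xs\<close>; the general inequality between depth and dimension closes the gap.\<close>

theorem cohen_macaulay_local:
  assumes noeth: "noetherian_ring R" and xs: "set xs \<subseteq> P"
    and chains: "\<And>k C. prime_chain R k C \<Longrightarrow> J \<subseteq> C 0 \<Longrightarrow> C k \<subseteq> P \<Longrightarrow> k \<le> length xs"
    and reg: "\<And>i r. i < length xs \<Longrightarrow> r \<in> carrier R \<Longrightarrow> xs ! i \<otimes> r \<in> Idl (J \<union> set (take i xs)) \<Longrightarrow>
      \<exists>s\<in>carrier R - P. s \<otimes> r \<in> Idl (J \<union> set (take i xs))"
  shows "cohen_macaulay_local_ring L"
proof -
  have noethL: "noetherian_ring L" by (rule noetherian_L[OF noeth])
  have xsR: "set xs \<subseteq> carrier R" using xs P.a_subset by auto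
  have tk: "set (take i xs) \<subseteq> carrier R" for i using xsR set_take_subset[of i xs] by auto
  let ?ys = "map h xs"
  have Idl_ys: "Idl\<^bsub>L\<^esub> (set (take i ?ys)) = ext (Idl (J \<union> set (take i xs)))" for i
    using ext_Idl[OF tk[of i]] by (simp add: take_map)
  have "regular_sequence L ?ys"
    unfolding regular_sequence_def
  proof (intro conjI allI impI ballI)
    show "set ?ys \<subseteq> carrier L" using xsR by auto
    have "Idl\<^bsub>L\<^esub> (set ?ys) = ext (Idl (J \<union> set xs))" using Idl_ys[of "length xs"] by simp
    also have "\<dots> \<subseteq> ext P" by (rule ext_mono) (use JP xs in \<open>intro R.genideal_minimal P.is_ideal; auto\<close>)
    finally show "Idl\<^bsub>L\<^esub> (set ?ys) \<noteq> carrier L" using one_notin_ext by auto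
    fix i l assume i: "i < length ?ys" and l: "l \<in> carrier L" and m: "?ys ! i \<otimes>\<^bsub>L\<^esub> l \<in> Idl\<^bsub>L\<^esub> (set (take i ?ys))"
    let ?I = "Idl (J \<union> set (take i xs))"
    have sub: "J \<union> set (take i xs) \<subseteq> carrier R" using tk J.a_subset by auto
    have I: "ideal ?I R" by (rule R.genideal_ideal[OF sub])
    have JI: "J \<subseteq> ?I" using R.genideal_self[OF sub] by auto
    have eI: "ideal (ext ?I) L" by (rule ideal_ext[OF I])
    have xi: "xs ! i \<in> carrier R" using i xsR nth_mem[of i xs] by auto
    obtain a s where as: "a \<in> carrier R" "s \<in> carrier R - P" "h s \<otimes>\<^bsub>L\<^esub> l = h a" using fraction[OF l] by blast
    have "h (xs ! i \<otimes> a) = h s \<otimes>\<^bsub>L\<^esub> (h (xs ! i) \<otimes>\<^bsub>L\<^esub> l)"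
      using as xi l by (simp add: as(3)[symmetric] S.m_lcomm)
    also have "\<dots> \<in> ext ?I" using ideal.I_l_closed[OF eI, of _ "h s"] m as(2) i Idl_ys[of i] by simp
    finally have "h (xs ! i \<otimes> a) \<in> ext ?I" .
    then obtain u where u: "u \<in> carrier R - P" "u \<otimes> (xs ! i \<otimes> a) \<in> ?I"
      using hom_in_ext_iff[OF I JI R.m_closed[OF xi as(1)]] by blast
    have "xs ! i \<otimes> (u \<otimes> a) \<in> ?I" using u xi as(1) by (simp add: R.m_lcomm)
    then obtain t where t: "t \<in> carrier R - P" "t \<otimes> (u \<otimes> a) \<in> ?I" using reg[of i "u \<otimes> a"] i u as(1) by auto
    have "(t \<otimes> u) \<otimes> a \<in> ?I" using t u as(1) by (simp add: R.m_assoc)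
    then have "h a \<in> ext ?I" using hom_in_ext_iff[OF I JI as(1)] mult_notin[OF t(1) u(1)] by blast
    then have "l \<in> ext ?I" using in_ideal_via_unit[OF eI l as(2)] as(3) by simp
    then show "l \<in> Idl\<^bsub>L\<^esub> (set (take i ?ys))" using Idl_ys[of i] by simp
  qed
  moreover have "set ?ys \<subseteq> ext P" using xs P.a_subset by (auto intro: hom_ext)
  ultimately have "enat (length ?ys) \<le> depth L (ext P)"
    unfolding depth_def by (intro Sup_upper) blast
  then have len: "enat (length xs) \<le> depth L (ext P)" by simp
  have "krull_dim L \<le> enat (length xs)"
    unfolding krull_dim_def
  proof (rule Sup_least, safe)
    fix k C assume C: "prime_chain L k C"
    have pr: "primeideal (C i) L" if "i \<le> k" for i using C that by (simp add: prime_chain_def)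
    have id: "ideal (C i) L" if "i \<le> k" for i using pr[OF that] by (rule primeideal.axioms(1))
    have "prime_chain R k (\<lambda>i. contr (C i))"
      unfolding prime_chain_def
    proof (intro conjI allI impI)
      show "primeideal (contr (C i)) R" if "i \<le> k" for i
        unfolding contr_def by (rule ring_hom_ring.primeideal_vimage[OF hom_ring R.cring_axioms pr[OF that]])
      fix i assume i: "i < k"
      have "C i \<subset> C (Suc i)" using C i by (simp add: prime_chain_def)
      then have "contr (C i) \<subseteq> contr (C (Suc i))" by (auto simp: contr_def)
      moreover have "contr (C i) \<noteq> contr (C (Suc i))"
      proof
        assume "contr (C i) = contr (C (Suc i))"
        then have "ext (contr (C i)) = ext (contr (C (Suc i)))" by (rule arg_cong)
        moreover have "ext (contr (C i)) = C i" by (rule contr_props(3)[OF id]) (use i in simp)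
        moreover have "ext (contr (C (Suc i))) = C (Suc i)" by (rule contr_props(3)[OF id]) (use i in simp)
        ultimately show False using \<open>C i \<subset> C (Suc i)\<close> by simp
      qed
      ultimately show "contr (C i) \<subset> contr (C (Suc i))" by blast
    qed
    moreover have "J \<subseteq> contr (C 0)" using contr_props(2)[OF id] by simp
    moreover have "contr (C k) \<subseteq> P"
    proof
      fix a assume a: "a \<in> contr (C k)"
      have "C k \<noteq> carrier L" using primeideal.I_notcarr[OF pr[of k]] by auto
      then have "C k \<subseteq> ext P" by (intro proper_le_ext_P id) auto
      then have "h a \<in> ext P" "a \<in> carrier R" using a by (auto simp: contr_def)
      then obtain u where u: "u \<in> carrier R - P" "u \<otimes> a \<in> P" using hom_in_ext_iff[OF P.is_ideal JP] by blast
      then show "a \<in> P" using P.I_prime[of u a] \<open>a \<in> carrier R\<close> by auto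
    qed
    ultimately show "enat k \<le> enat (length xs)" using chains by simp
  qed
  then have "depth L (ext P) = krull_dim L"
    using len S.depth_le_krull_dim[OF noethL, of "ext P"] by (meson antisym order_trans)
  then show ?thesis
    unfolding cohen_macaulay_local_ring_def using noethL S.cring_axioms maximal_ideals_L by blast
qed

end


subsection \<open>The ring of fractions at a prime\<close>

context primeideal begin

abbreviation "D \<equiv> carrier R - I"
abbreviation "cls a s \<equiv> frac_rel R I `` {(a, s)}"
abbreviation "L \<equiv> localization_at R I"

lemma D_mult: "s \<in> D \<Longrightarrow> t \<in> D \<Longrightarrow> s \<otimes> t \<in> D"
  using I_prime[of s t] by auto

lemma D_one: "\<one> \<in> D"
  using one_imp_carrier I_notcarr by auto

text \<open>Without subtraction, the relation can be chained by multiplying equations.\<close>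

lemma frac_rel_iff:
  "((a, s), (b, t)) \<in> frac_rel R I \<longleftrightarrow> a \<in> carrier R \<and> s \<in> D \<and> b \<in> carrier R \<and> t \<in> D \<and>
     (\<exists>u\<in>D. u \<otimes> (a \<otimes> t) = u \<otimes> (b \<otimes> s))"
proof -
  have "u \<otimes> (a \<otimes> t \<ominus> b \<otimes> s) = \<zero> \<longleftrightarrow> u \<otimes> (a \<otimes> t) = u \<otimes> (b \<otimes> s)"
    if "a \<in> carrier R" "s \<in> carrier R" "b \<in> carrier R" "t \<in> carrier R" "u \<in> carrier R" for u
  proof -
    have "u \<otimes> (a \<otimes> t \<ominus> b \<otimes> s) = u \<otimes> (a \<otimes> t) \<ominus> u \<otimes> (b \<otimes> s)" using that by algebra
    then show ?thesis using that by simp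
  qed
  then show ?thesis unfolding frac_rel_def by auto
qed

lemma equiv_frac_rel: "equiv (carrier R \<times> D) (frac_rel R I)"
proof (rule equivI)
  show "frac_rel R I \<subseteq> (carrier R \<times> D) \<times> carrier R \<times> D" by (auto simp: frac_rel_def)
  show "refl_on (carrier R \<times> D) (frac_rel R I)"
    using D_one by (auto simp: refl_on_def frac_rel_iff)
  show "sym (frac_rel R I)"
  proof (rule symI)
    fix x y assume "(x, y) \<in> frac_rel R I"
    moreover obtain a s b t where xy: "x = (a, s)" "y = (b, t)" by (metis surj_pair)
    ultimately obtain u where *: "a \<in> carrier R" "s \<in> D" "b \<in> carrier R" "t \<in> D" "u \<in> D"
      "u \<otimes> (a \<otimes> t) = u \<otimes> (b \<otimes> s)" by (auto simp: frac_rel_iff)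
    then show "(y, x) \<in> frac_rel R I"
      unfolding xy frac_rel_iff by (intro conjI bexI[of _ u]) simp_all
  qed
  show "trans (frac_rel R I)"
  proof (rule transI)
    fix x y z assume "(x, y) \<in> frac_rel R I" "(y, z) \<in> frac_rel R I"
    moreover obtain a s b t c v where xyz: "x = (a, s)" "y = (b, t)" "z = (c, v)" by (metis surj_pair)
    ultimately obtain u w where *: "a \<in> carrier R" "s \<in> D" "b \<in> carrier R" "t \<in> D" "c \<in> carrier R" "v \<in> D"
      "u \<in> D" "w \<in> D" "u \<otimes> (a \<otimes> t) = u \<otimes> (b \<otimes> s)" "w \<otimes> (b \<otimes> v) = w \<otimes> (c \<otimes> t)"
      by (auto simp: frac_rel_iff)
    have c: "s \<in> carrier R" "t \<in> carrier R" "v \<in> carrier R" "u \<in> carrier R" "w \<in> carrier R" using * by auto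
    have "(u \<otimes> w \<otimes> t) \<otimes> (a \<otimes> v) = (w \<otimes> v) \<otimes> (u \<otimes> (a \<otimes> t))" using c *(1,3,5) by algebra
    also have "\<dots> = (u \<otimes> s) \<otimes> (w \<otimes> (b \<otimes> v))" unfolding *(9) using c *(1,3,5) by algebra
    also have "\<dots> = (u \<otimes> w \<otimes> t) \<otimes> (c \<otimes> s)" unfolding *(10) using c *(1,3,5) by algebra
    finally show "(x, z) \<in> frac_rel R I"
      unfolding xyz frac_rel_iff using * D_mult[OF D_mult[OF *(7,8)] *(4)] by blast
  qed
qed

lemma cls_eq_iff:
  "a \<in> carrier R \<Longrightarrow> s \<in> D \<Longrightarrow> b \<in> carrier R \<Longrightarrow> t \<in> D \<Longrightarrow>
    cls a s = cls b t \<longleftrightarrow> (\<exists>u\<in>D. u \<otimes> (a \<otimes> t) = u \<otimes> (b \<otimes> s))"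
  by (subst eq_equiv_class_iff[OF equiv_frac_rel]) (auto simp: frac_rel_iff)

lemma cls_eqI:
  assumes "a \<in> carrier R" "s \<in> D" "b \<in> carrier R" "t \<in> D" "a \<otimes> t = b \<otimes> s" shows "cls a s = cls b t"
  using assms D_one by (subst cls_eq_iff) auto

lemma carrier_L: "l \<in> carrier L \<longleftrightarrow> (\<exists>a\<in>carrier R. \<exists>s\<in>D. l = cls a s)"
  unfolding localization_at_def by (auto simp: quotient_def)

lemma cls_in_L: "a \<in> carrier R \<Longrightarrow> s \<in> D \<Longrightarrow> cls a s \<in> carrier L"
  using carrier_L by blast

lemma cls_mem: "(a', s') \<in> cls a s \<Longrightarrow> a' \<in> carrier R \<and> s' \<in> D \<and> (\<exists>u\<in>D. u \<otimes> (a \<otimes> s') = u \<otimes> (a' \<otimes> s))"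
  by (auto simp: frac_rel_iff)

lemma cls_self: "a \<in> carrier R \<Longrightarrow> s \<in> D \<Longrightarrow> (a, s) \<in> cls a s"
  using D_one by (auto simp: frac_rel_iff)

text \<open>The union over representatives in the operations collapses once all of them give the same class.\<close>

lemma UN_cls:
  assumes as: "a \<in> carrier R" "s \<in> D" and bt: "b \<in> carrier R" "t \<in> D"
    and F: "\<And>a' s' b' t'. (a', s') \<in> cls a s \<Longrightarrow> (b', t') \<in> cls b t \<Longrightarrow> F a' s' b' t' = c"
  shows "(\<Union>(a', s') \<in> cls a s. \<Union>(b', t') \<in> cls b t. F a' s' b' t') = c"
proof (rule UN_constant_eq[OF cls_self[OF as]], intro ballI)
  fix p assume "p \<in> cls a s"
  moreover obtain a' s' where p: "p = (a', s')" by fastforce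
  ultimately have p': "(a', s') \<in> cls a s" by simp
  have "(\<Union>(b', t') \<in> cls b t. F a' s' b' t') = c"
  proof (rule UN_constant_eq[OF cls_self[OF bt]], intro ballI)
    fix q assume "q \<in> cls b t"
    then show "(case q of (b', t') \<Rightarrow> F a' s' b' t') = c" using F[OF p'] by (cases q) simp
  qed
  then show "(case p of (a', s') \<Rightarrow> \<Union>(b', t') \<in> cls b t. F a' s' b' t') = c" by (simp add: p)
qed

lemma mult_L:
  assumes as: "a \<in> carrier R" "s \<in> D" and bt: "b \<in> carrier R" "t \<in> D"
  shows "cls a s \<otimes>\<^bsub>L\<^esub> cls b t = cls (a \<otimes> b) (s \<otimes> t)"
proof -
  have "cls a s \<otimes>\<^bsub>L\<^esub> cls b t = (\<Union>(a', s') \<in> cls a s. \<Union>(b', t') \<in> cls b t. cls (a' \<otimes> b') (s' \<otimes> t'))"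
    by (simp add: localization_at_def)
  also have "\<dots> = cls (a \<otimes> b) (s \<otimes> t)"
  proof (rule UN_cls[OF as bt])
    fix a' s' b' t' assume "(a', s') \<in> cls a s" "(b', t') \<in> cls b t"
    then obtain u w where *: "a' \<in> carrier R" "s' \<in> D" "b' \<in> carrier R" "t' \<in> D" "u \<in> D" "w \<in> D"
      "u \<otimes> (a \<otimes> s') = u \<otimes> (a' \<otimes> s)" "w \<otimes> (b \<otimes> t') = w \<otimes> (b' \<otimes> t)" using cls_mem by meson
    have c: "s \<in> carrier R" "t \<in> carrier R" "s' \<in> carrier R" "t' \<in> carrier R" "u \<in> carrier R" "w \<in> carrier R"
      using * as bt by auto
    have "(u \<otimes> w) \<otimes> ((a' \<otimes> b') \<otimes> (s \<otimes> t)) = (u \<otimes> (a' \<otimes> s)) \<otimes> (w \<otimes> (b' \<otimes> t))"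
      using c as(1) bt(1) *(1,3) by algebra
    also have "\<dots> = (u \<otimes> w) \<otimes> ((a \<otimes> b) \<otimes> (s' \<otimes> t'))"
      unfolding *(7,8)[symmetric] using c as(1) bt(1) *(1,3) by algebra
    finally show "cls (a' \<otimes> b') (s' \<otimes> t') = cls (a \<otimes> b) (s \<otimes> t)"
      using * as bt D_mult D_mult[OF *(5,6)] by (subst cls_eq_iff) auto
  qed
  finally show ?thesis .
qed

lemma add_L:
  assumes as: "a \<in> carrier R" "s \<in> D" and bt: "b \<in> carrier R" "t \<in> D"
  shows "cls a s \<oplus>\<^bsub>L\<^esub> cls b t = cls (a \<otimes> t \<oplus> b \<otimes> s) (s \<otimes> t)"
proof -
  have "cls a s \<oplus>\<^bsub>L\<^esub> cls b t =
      (\<Union>(a', s') \<in> cls a s. \<Union>(b', t') \<in> cls b t. cls (a' \<otimes> t' \<oplus> b' \<otimes> s') (s' \<otimes> t'))"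
    by (simp add: localization_at_def)
  also have "\<dots> = cls (a \<otimes> t \<oplus> b \<otimes> s) (s \<otimes> t)"
  proof (rule UN_cls[OF as bt])
    fix a' s' b' t' assume "(a', s') \<in> cls a s" "(b', t') \<in> cls b t"
    then obtain u w where *: "a' \<in> carrier R" "s' \<in> D" "b' \<in> carrier R" "t' \<in> D" "u \<in> D" "w \<in> D"
      "u \<otimes> (a \<otimes> s') = u \<otimes> (a' \<otimes> s)" "w \<otimes> (b \<otimes> t') = w \<otimes> (b' \<otimes> t)" using cls_mem by meson
    have c: "s \<in> carrier R" "t \<in> carrier R" "s' \<in> carrier R" "t' \<in> carrier R" "u \<in> carrier R" "w \<in> carrier R"
      using * as bt by auto
    have "(u \<otimes> w) \<otimes> ((a' \<otimes> t' \<oplus> b' \<otimes> s') \<otimes> (s \<otimes> t)) =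
        (w \<otimes> t \<otimes> t') \<otimes> (u \<otimes> (a' \<otimes> s)) \<oplus> (u \<otimes> s \<otimes> s') \<otimes> (w \<otimes> (b' \<otimes> t))"
      using c as(1) bt(1) *(1,3) by algebra
    also have "\<dots> = (u \<otimes> w) \<otimes> ((a \<otimes> t \<oplus> b \<otimes> s) \<otimes> (s' \<otimes> t'))"
      unfolding *(7,8)[symmetric] using c as(1) bt(1) *(1,3) by algebra
    finally show "cls (a' \<otimes> t' \<oplus> b' \<otimes> s') (s' \<otimes> t') = cls (a \<otimes> t \<oplus> b \<otimes> s) (s \<otimes> t)"
      using * as bt c D_mult D_mult[OF *(5,6)] by (subst cls_eq_iff) auto
  qed
  finally show ?thesis .
qed

lemma one_L: "\<one>\<^bsub>L\<^esub> = cls \<one> \<one>" and zero_L: "\<zero>\<^bsub>L\<^esub> = cls \<zero> \<one>"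
  by (simp_all add: localization_at_def)

lemma L_cases:
  assumes "l \<in> carrier L" obtains a s where "a \<in> carrier R" "s \<in> carrier R" "s \<in> D" "l = cls a s"
  using assms carrier_L that by auto

lemma cring_L: "cring L"
proof (rule cringI)
  note closed = D_mult D_one
  show "abelian_group L"
  proof (rule abelian_groupI)
    fix x y assume x: "x \<in> carrier L" and y: "y \<in> carrier L"
    obtain a s where a: "a \<in> carrier R" "s \<in> carrier R" "s \<in> D" "x = cls a s" by (rule L_cases[OF x])
    obtain b t where b: "b \<in> carrier R" "t \<in> carrier R" "t \<in> D" "y = cls b t" by (rule L_cases[OF y])
    show "x \<oplus>\<^bsub>L\<^esub> y \<in> carrier L"
      unfolding a(4) b(4) add_L[OF a(1,3) b(1,3)] by (rule cls_in_L[OF _ D_mult[OF a(3) b(3)]]) (use a b in simp)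
    show "x \<oplus>\<^bsub>L\<^esub> y = y \<oplus>\<^bsub>L\<^esub> x"
      unfolding a(4) b(4) add_L[OF a(1,3) b(1,3)] add_L[OF b(1,3) a(1,3)]
      using a(1,2) b(1,2) by (simp add: m_comm[of s t] a_comm)
    fix z assume z: "z \<in> carrier L"
    obtain c v where c: "c \<in> carrier R" "v \<in> carrier R" "v \<in> D" "z = cls c v" by (rule L_cases[OF z])
    have n: "(a \<otimes> t \<oplus> b \<otimes> s) \<otimes> v \<oplus> c \<otimes> (s \<otimes> t) = a \<otimes> (t \<otimes> v) \<oplus> (b \<otimes> v \<oplus> c \<otimes> t) \<otimes> s"
      using a(1,2) b(1,2) c(1,2) by algebra
    have "x \<oplus>\<^bsub>L\<^esub> y \<oplus>\<^bsub>L\<^esub> z = cls ((a \<otimes> t \<oplus> b \<otimes> s) \<otimes> v \<oplus> c \<otimes> (s \<otimes> t)) (s \<otimes> t \<otimes> v)"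
      unfolding a(4) b(4) c(4) add_L[OF a(1,3) b(1,3)]
      by (rule add_L[OF _ D_mult[OF a(3) b(3)] c(1,3)]) (use a b in simp)
    also have "\<dots> = cls (a \<otimes> (t \<otimes> v) \<oplus> (b \<otimes> v \<oplus> c \<otimes> t) \<otimes> s) (s \<otimes> (t \<otimes> v))"
      unfolding n m_assoc[OF a(2) b(2) c(2)] ..
    also have "\<dots> = x \<oplus>\<^bsub>L\<^esub> (y \<oplus>\<^bsub>L\<^esub> z)"
      unfolding a(4) b(4) c(4) add_L[OF b(1,3) c(1,3)]
      by (rule add_L[OF a(1,3) _ D_mult[OF b(3) c(3)], symmetric]) (use b c in simp)
    finally show "x \<oplus>\<^bsub>L\<^esub> y \<oplus>\<^bsub>L\<^esub> z = x \<oplus>\<^bsub>L\<^esub> (y \<oplus>\<^bsub>L\<^esub> z)" .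
  next
    show "\<zero>\<^bsub>L\<^esub> \<in> carrier L" unfolding zero_L by (rule cls_in_L[OF zero_closed D_one])
  next
    fix x assume x: "x \<in> carrier L"
    obtain a s where a: "a \<in> carrier R" "s \<in> carrier R" "s \<in> D" "x = cls a s" by (rule L_cases[OF x])
    show "\<zero>\<^bsub>L\<^esub> \<oplus>\<^bsub>L\<^esub> x = x"
      unfolding zero_L a(4) add_L[OF zero_closed D_one a(1,3)] using a(1,2) by simp
    have "cls (\<ominus> a) s \<oplus>\<^bsub>L\<^esub> x = cls (\<ominus> a \<otimes> s \<oplus> a \<otimes> s) (s \<otimes> s)"
      unfolding a(4) by (rule add_L[OF _ a(3) a(1,3)]) (use a in simp)
    also have "\<dots> = cls \<zero> \<one>"
      by (rule cls_eqI[OF _ D_mult[OF a(3,3)] zero_closed D_one]) (use a(1,2) in \<open>simp_all add: l_minus l_neg\<close>)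
    finally show "\<exists>y\<in>carrier L. y \<oplus>\<^bsub>L\<^esub> x = \<zero>\<^bsub>L\<^esub>"
      unfolding zero_L using cls_in_L[OF a_inv_closed[OF a(1)] a(3)] by blast
  qed
  show "comm_monoid L"
  proof (rule comm_monoidI)
    show "\<one>\<^bsub>L\<^esub> \<in> carrier L" unfolding one_L by (rule cls_in_L[OF one_closed D_one])
  next
    fix x assume x: "x \<in> carrier L"
    obtain a s where a: "a \<in> carrier R" "s \<in> carrier R" "s \<in> D" "x = cls a s" by (rule L_cases[OF x])
    show "\<one>\<^bsub>L\<^esub> \<otimes>\<^bsub>L\<^esub> x = x"
      unfolding one_L a(4) mult_L[OF one_closed D_one a(1,3)] using a(1,2) by simp
  next
    fix x y assume x: "x \<in> carrier L" and y: "y \<in> carrier L"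
    obtain a s where a: "a \<in> carrier R" "s \<in> carrier R" "s \<in> D" "x = cls a s" by (rule L_cases[OF x])
    obtain b t where b: "b \<in> carrier R" "t \<in> carrier R" "t \<in> D" "y = cls b t" by (rule L_cases[OF y])
    show "x \<otimes>\<^bsub>L\<^esub> y \<in> carrier L"
      unfolding a(4) b(4) mult_L[OF a(1,3) b(1,3)] by (rule cls_in_L[OF _ D_mult[OF a(3) b(3)]]) (use a b in simp)
    show "x \<otimes>\<^bsub>L\<^esub> y = y \<otimes>\<^bsub>L\<^esub> x"
      unfolding a(4) b(4) mult_L[OF a(1,3) b(1,3)] mult_L[OF b(1,3) a(1,3)]
      using a(1,2) b(1,2) by (simp add: m_comm)
    fix z assume z: "z \<in> carrier L"
    obtain c v where c: "c \<in> carrier R" "v \<in> carrier R" "v \<in> D" "z = cls c v" by (rule L_cases[OF z])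
    show "x \<otimes>\<^bsub>L\<^esub> y \<otimes>\<^bsub>L\<^esub> z = x \<otimes>\<^bsub>L\<^esub> (y \<otimes>\<^bsub>L\<^esub> z)"
      unfolding a(4) b(4) c(4) mult_L[OF a(1,3) b(1,3)] mult_L[OF b(1,3) c(1,3)]
        mult_L[OF m_closed[OF a(1) b(1)] D_mult[OF a(3) b(3)] c(1,3)]
        mult_L[OF a(1,3) m_closed[OF b(1) c(1)] D_mult[OF b(3) c(3)]]
        m_assoc[OF a(1) b(1) c(1)] m_assoc[OF a(2) b(2) c(2)] ..
  qed
  fix x y z assume x: "x \<in> carrier L" and y: "y \<in> carrier L" and z: "z \<in> carrier L"
  obtain a s where a: "a \<in> carrier R" "s \<in> carrier R" "s \<in> D" "x = cls a s" by (rule L_cases[OF x])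
  obtain b t where b: "b \<in> carrier R" "t \<in> carrier R" "t \<in> D" "y = cls b t" by (rule L_cases[OF y])
  obtain c v where c: "c \<in> carrier R" "v \<in> carrier R" "v \<in> D" "z = cls c v" by (rule L_cases[OF z])
  have sum: "a \<otimes> t \<oplus> b \<otimes> s \<in> carrier R" using a b by simp
  show "(x \<oplus>\<^bsub>L\<^esub> y) \<otimes>\<^bsub>L\<^esub> z = x \<otimes>\<^bsub>L\<^esub> z \<oplus>\<^bsub>L\<^esub> y \<otimes>\<^bsub>L\<^esub> z"
    unfolding a(4) b(4) c(4) add_L[OF a(1,3) b(1,3)] mult_L[OF sum D_mult[OF a(3) b(3)] c(1,3)]
      mult_L[OF a(1,3) c(1,3)] mult_L[OF b(1,3) c(1,3)]
      add_L[OF m_closed[OF a(1) c(1)] D_mult[OF a(3) c(3)] m_closed[OF b(1) c(1)] D_mult[OF b(3) c(3)]]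
  proof (rule cls_eqI)
    show "(a \<otimes> t \<oplus> b \<otimes> s) \<otimes> c \<otimes> (s \<otimes> v \<otimes> (t \<otimes> v)) =
        (a \<otimes> c \<otimes> (t \<otimes> v) \<oplus> b \<otimes> c \<otimes> (s \<otimes> v)) \<otimes> (s \<otimes> t \<otimes> v)"
      using a(1,2) b(1,2) c(1,2) by algebra
  qed (use a b c closed in auto)
qed

lemma hom_cls: "(\<lambda>a. cls a \<one>) \<in> ring_hom R L"
proof (rule ring_hom_memI)
  fix a b assume ab: "a \<in> carrier R" "b \<in> carrier R"
  show "cls a \<one> \<in> carrier L" by (rule cls_in_L[OF ab(1) D_one])
  show "cls (a \<otimes> b) \<one> = cls a \<one> \<otimes>\<^bsub>L\<^esub> cls b \<one>"
    unfolding mult_L[OF ab(1) D_one ab(2) D_one] by simp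
  show "cls (a \<oplus> b) \<one> = cls a \<one> \<oplus>\<^bsub>L\<^esub> cls b \<one>"
    unfolding add_L[OF ab(1) D_one ab(2) D_one] using ab by simp
qed (simp add: one_L)

lemma cls_unit: assumes s: "s \<in> D" shows "cls s \<one> \<in> Units L"
proof -
  interpret L: cring L by (rule cring_L)
  have sR: "s \<in> carrier R" using s by simp
  have "cls s \<one> \<otimes>\<^bsub>L\<^esub> cls \<one> s = \<one>\<^bsub>L\<^esub>"
    unfolding mult_L[OF sR D_one one_closed s] one_L
    by (rule cls_eqI) (use sR s D_one in auto)
  then show ?thesis
    using L.m_comm[of "cls s \<one>" "cls \<one> s"] cls_in_L[OF sR D_one] cls_in_L[OF one_closed s]
    by (auto simp: Units_def)
qed

lemma cls_fraction: assumes "l \<in> carrier L" shows "\<exists>a\<in>carrier R. \<exists>s\<in>D. cls s \<one> \<otimes>\<^bsub>L\<^esub> l = cls a \<one>"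
proof -
  obtain a s where a: "a \<in> carrier R" "s \<in> carrier R" "s \<in> D" "l = cls a s" by (rule L_cases[OF assms])
  have "cls s \<one> \<otimes>\<^bsub>L\<^esub> l = cls a \<one>"
    unfolding a(4) mult_L[OF a(2) D_one a(1,3)]
    by (rule cls_eqI[OF _ D_mult[OF D_one a(3)] a(1) D_one]) (use a(1,2) in \<open>simp_all add: m_comm\<close>)
  then show ?thesis using a by blast
qed

lemma cls_zero_iff: "a \<in> carrier R \<Longrightarrow> cls a \<one> = \<zero>\<^bsub>L\<^esub> \<longleftrightarrow> (\<exists>u\<in>D. u \<otimes> a = \<zero>)"
  unfolding zero_L by (subst cls_eq_iff) (use D_one in auto)

end


subsection \<open>Quotients\<close>

lemma quot_zero_iff:
  assumes "ideal J R" "a \<in> carrier R" shows "J +>\<^bsub>R\<^esub> a = \<zero>\<^bsub>R Quot J\<^esub> \<longleftrightarrow> a \<in> J"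
proof -
  interpret ideal J R by fact
  show ?thesis
    using quotient_eq_iff_same_a_r_cos[OF assms(1,2), of "\<zero>\<^bsub>R\<^esub>"] a_rcos_zero[OF assms(1) additive_subgroup.zero_closed[OF is_additive_subgroup]] assms(2)
    by (simp add: FactRing_def a_minus_def)
qed

lemma quot_surj: "l \<in> carrier (R Quot J) \<Longrightarrow> \<exists>a\<in>carrier R. l = J +>\<^bsub>R\<^esub> a"
  unfolding FactRing_def A_RCOSETS_def' by simp

lemma noetherian_quot:
  assumes "cring R" "noetherian_ring R" and J: "ideal J R" shows "noetherian_ring (R Quot J)"
proof -
  interpret R: cring R by fact
  interpret R': noetherian_ring R by fact
  interpret J: ideal J R by fact
  interpret A: cring "R Quot J" by (rule J.quotient_is_cring[OF assms(1)])
  let ?\<pi> = "\<lambda>a. J +>\<^bsub>R\<^esub> a"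
  interpret h: ring_hom_ring R "R Quot J" ?\<pi> by (rule J.rcos_ring_hom_ring)
  note surj = quot_surj[of _ R J]
  show ?thesis
  proof (rule A.noetherian_ringI)
    fix I assume I: "ideal I (R Quot J)"
    let ?C = "{a \<in> carrier R. ?\<pi> a \<in> I}"
    have "ideal ?C R" by (rule h.ideal_vimage[OF I])
    then obtain B where B: "B \<subseteq> carrier R" "finite B" "?C = Idl\<^bsub>R\<^esub> B" using R'.finetely_gen by blast
    have sub: "?\<pi> ` B \<subseteq> carrier (R Quot J)" using B(1) h.hom_closed by blast
    let ?I = "Idl\<^bsub>R Quot J\<^esub> (?\<pi> ` B)"
    have BC: "B \<subseteq> ?C" unfolding B(3) by (rule R.genideal_self[OF B(1)])
    have "Idl\<^bsub>R\<^esub> B \<subseteq> {a \<in> carrier R. ?\<pi> a \<in> ?I}"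
      by (rule R.genideal_minimal[OF h.ideal_vimage[OF A.genideal_ideal[OF sub]]])
        (use A.genideal_self[OF sub] B(1) in auto)
    then have C: "?C \<subseteq> {a \<in> carrier R. ?\<pi> a \<in> ?I}" using B(3) by simp
    have "I = ?I"
    proof
      show "?I \<subseteq> I" by (rule A.genideal_minimal[OF I]) (use BC in auto)
      show "I \<subseteq> ?I"
      proof
        fix l assume l: "l \<in> I"
        then have "l \<in> carrier (R Quot J)" using ideal.Icarr[OF I] by blast
        then obtain a where "a \<in> carrier R" "l = ?\<pi> a" using surj by blast
        then show "l \<in> ?I" using C l by blast
      qed
    qed
    then show "\<exists>A\<subseteq>carrier (R Quot J). finite A \<and> I = Idl\<^bsub>R Quot J\<^esub> A"
      using sub B(2) by (intro exI[of _ "?\<pi> ` B"]) auto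
  qed
qed

text \<open>For a maximal ideal \<open>M\<close> of \<open>R/J\<close> the composite of \<open>R \<rightarrow> R/J\<close> with the localization at \<open>M\<close> has the
  properties above, with the preimage of \<open>M\<close> for \<open>P\<close>.\<close>

theorem cohen_macaulay_quot:
  assumes R: "cring R" and noeth: "noetherian_ring R" and J: "ideal J R"
    and seq: "\<And>P. primeideal P R \<Longrightarrow> J \<subseteq> P \<Longrightarrow> \<exists>xs. set xs \<subseteq> P
      \<and> (\<forall>k C. prime_chain R k C \<longrightarrow> J \<subseteq> C 0 \<longrightarrow> C k \<subseteq> P \<longrightarrow> k \<le> length xs)
      \<and> (\<forall>i<length xs. \<forall>r\<in>carrier R. xs ! i \<otimes>\<^bsub>R\<^esub> r \<in> Idl\<^bsub>R\<^esub> (J \<union> set (take i xs)) \<longrightarrow>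
          (\<exists>s\<in>carrier R - P. s \<otimes>\<^bsub>R\<^esub> r \<in> Idl\<^bsub>R\<^esub> (J \<union> set (take i xs))))"
  shows "cohen_macaulay_ring (R Quot J)"
  unfolding cohen_macaulay_ring_def
proof (intro conjI allI impI)
  interpret R: cring R by fact
  interpret J: ideal J R by fact
  show cA: "cring (R Quot J)" by (rule J.quotient_is_cring[OF R])
  then interpret A: cring "R Quot J" .
  show "noetherian_ring (R Quot J)" by (rule noetherian_quot[OF R noeth J])
  fix M assume M: "maximalideal M (R Quot J)"
  have Mp: "primeideal M (R Quot J)" by (rule A.maximalideal_prime[OF M])
  interpret M: primeideal M "R Quot J" by (rule Mp)
  let ?\<pi> = "\<lambda>a. J +>\<^bsub>R\<^esub> a" and ?L = "localization_at (R Quot J) M"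
  interpret h: ring_hom_ring R "R Quot J" ?\<pi> by (rule J.rcos_ring_hom_ring)
  note surj = quot_surj[of _ R J]
  let ?P = "{a \<in> carrier R. ?\<pi> a \<in> M}"
  let ?h = "\<lambda>a. frac_rel (R Quot J) M `` {(?\<pi> a, \<one>\<^bsub>R Quot J\<^esub>)}"
  have P: "primeideal ?P R" by (rule h.primeideal_vimage[OF R Mp])
  have JP: "J \<subseteq> ?P"
  proof
    fix a assume a: "a \<in> J"
    then have "a \<in> carrier R" using J.a_subset by auto
    moreover from this a have "?\<pi> a = \<zero>\<^bsub>R Quot J\<^esub>" using quot_zero_iff[OF J] by blast
    ultimately show "a \<in> ?P" using additive_subgroup.zero_closed[OF M.is_additive_subgroup] by simp
  qed
  have hh: "?h \<in> ring_hom R ?L"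
    using ring_hom_trans[OF J.rcos_ring_hom M.hom_cls] by (simp add: comp_def)
  interpret localization_hom R ?L ?h ?P J
  proof (intro localization_hom.intro localization_hom_axioms.intro P J JP)
    show "ring_hom_cring R ?L ?h"
      by (intro ring_hom_cring.intro R M.cring_L ring_hom_cring_axioms.intro hh)
    show "?h s \<in> Units ?L" if "s \<in> carrier R" "s \<notin> ?P" for s
      using that h.hom_closed[of s] by (intro M.cls_unit) auto
    show "\<exists>a\<in>carrier R. \<exists>s\<in>carrier R - ?P. ?h s \<otimes>\<^bsub>?L\<^esub> l = ?h a" if "l \<in> carrier ?L" for l
    proof -
      obtain \<alpha> \<sigma> where *: "\<alpha> \<in> carrier (R Quot J)" "\<sigma> \<in> carrier (R Quot J) - M"
        "frac_rel (R Quot J) M `` {(\<sigma>, \<one>\<^bsub>R Quot J\<^esub>)} \<otimes>\<^bsub>?L\<^esub> l = frac_rel (R Quot J) M `` {(\<alpha>, \<one>\<^bsub>R Quot J\<^esub>)}"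
        using M.cls_fraction[OF \<open>l \<in> carrier ?L\<close>] by blast
      obtain a s where as: "a \<in> carrier R" "\<alpha> = ?\<pi> a" "s \<in> carrier R" "\<sigma> = ?\<pi> s"
        using surj[OF *(1)] surj[of \<sigma>] *(2) by blast
      have "s \<in> carrier R - ?P" using as *(2) by auto
      moreover have "?h s \<otimes>\<^bsub>?L\<^esub> l = ?h a" using *(3) as by simp
      ultimately show ?thesis using as(1) by blast
    qed
    show "?h a = \<zero>\<^bsub>?L\<^esub> \<longleftrightarrow> (\<exists>u\<in>carrier R - ?P. u \<otimes>\<^bsub>R\<^esub> a \<in> J)" if a: "a \<in> carrier R" for a
    proof -
      have "?h a = \<zero>\<^bsub>?L\<^esub> \<longleftrightarrow> (\<exists>u\<in>carrier (R Quot J) - M. u \<otimes>\<^bsub>R Quot J\<^esub> ?\<pi> a = \<zero>\<^bsub>R Quot J\<^esub>)"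
        by (rule M.cls_zero_iff[OF h.hom_closed[OF a]])
      also have "\<dots> \<longleftrightarrow> (\<exists>u\<in>carrier R - ?P. ?\<pi> u \<otimes>\<^bsub>R Quot J\<^esub> ?\<pi> a = \<zero>\<^bsub>R Quot J\<^esub>)"
      proof
        assume "\<exists>u\<in>carrier (R Quot J) - M. u \<otimes>\<^bsub>R Quot J\<^esub> ?\<pi> a = \<zero>\<^bsub>R Quot J\<^esub>"
        then obtain u where u: "u \<in> carrier (R Quot J)" "u \<notin> M" "u \<otimes>\<^bsub>R Quot J\<^esub> ?\<pi> a = \<zero>\<^bsub>R Quot J\<^esub>" by blast
        then obtain v where v: "v \<in> carrier R" "u = ?\<pi> v" using surj by blast
        then show "\<exists>u\<in>carrier R - ?P. ?\<pi> u \<otimes>\<^bsub>R Quot J\<^esub> ?\<pi> a = \<zero>\<^bsub>R Quot J\<^esub>"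
          using u by (intro bexI[of _ v]) auto
      next
        assume "\<exists>u\<in>carrier R - ?P. ?\<pi> u \<otimes>\<^bsub>R Quot J\<^esub> ?\<pi> a = \<zero>\<^bsub>R Quot J\<^esub>"
        then obtain u where u: "u \<in> carrier R" "?\<pi> u \<notin> M" "?\<pi> u \<otimes>\<^bsub>R Quot J\<^esub> ?\<pi> a = \<zero>\<^bsub>R Quot J\<^esub>" by blast
        then show "\<exists>u\<in>carrier (R Quot J) - M. u \<otimes>\<^bsub>R Quot J\<^esub> ?\<pi> a = \<zero>\<^bsub>R Quot J\<^esub>"
          using h.hom_closed[of u] by (intro bexI[of _ "?\<pi> u"]) auto
      qed
      also have "\<dots> \<longleftrightarrow> (\<exists>u\<in>carrier R - ?P. u \<otimes>\<^bsub>R\<^esub> a \<in> J)"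
      proof (rule bex_cong[OF refl])
        fix u assume "u \<in> carrier R - ?P"
        then have u: "u \<in> carrier R" by simp
        show "?\<pi> u \<otimes>\<^bsub>R Quot J\<^esub> ?\<pi> a = \<zero>\<^bsub>R Quot J\<^esub> \<longleftrightarrow> u \<otimes>\<^bsub>R\<^esub> a \<in> J"
          using quot_zero_iff[OF J R.m_closed[OF u a]] h.hom_mult[OF u a] by simp
      qed
      finally show ?thesis .
    qed
  qed
  obtain xs where xs: "set xs \<subseteq> ?P" "\<forall>k C. prime_chain R k C \<longrightarrow> J \<subseteq> C 0 \<longrightarrow> C k \<subseteq> ?P \<longrightarrow> k \<le> length xs"
    "\<forall>i<length xs. \<forall>r\<in>carrier R. xs ! i \<otimes>\<^bsub>R\<^esub> r \<in> Idl\<^bsub>R\<^esub> (J \<union> set (take i xs)) \<longrightarrow>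
      (\<exists>s\<in>carrier R - ?P. s \<otimes>\<^bsub>R\<^esub> r \<in> Idl\<^bsub>R\<^esub> (J \<union> set (take i xs)))"
    using seq[OF P JP] by (elim exE conjE)
  show "cohen_macaulay_local_ring ?L"
    by (rule cohen_macaulay_local[OF noeth xs(1)]) (use xs(2,3) in blast)+
qed


section \<open>Complete graphs and the theorem\<close>

lemma complete_binomial_graph:
  fixes K :: "'k::field itself" and G :: "'a::linorder graph"
  assumes G: "simple_graph G" and comp: "complete_graph G" and ne: "verts G \<noteq> {}"
  obtains n g where "complete_binomial (verts G) (binomial_edge_ideal K G) n g"
proof -
  have fin: "finite (verts G)" using G by (simp add: simple_graph_def)
  obtain g where g: "bij_betw g {..<card (verts G)} (verts G)"
    using ex_bij_betw_nat_finite[OF fin] by (auto simp: atLeast0LessThan)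
  note J = binomial_edge_ideal_props[OF G, where K = K]
  have "complete_binomial (verts G) (binomial_edge_ideal K G) (card (verts G)) g"
  proof (rule complete_binomial.intro[OF g])
    show "0 < card (verts G)" using fin ne by (simp add: card_gt_0_iff)
    show "ideal (binomial_edge_ideal K G) (polyR (gvars G))" by (rule J(1))
    show "bin a b \<in> binomial_edge_ideal K G" if "a \<in> verts G" "b \<in> verts G" for a b
    proof (cases "a = b")
      case True
      then show ?thesis using ideal_polyRD(2)[OF J(1)] by simp
    next
      case False
      then show ?thesis using comp that by (intro J(2)) (simp add: complete_graph_def)
    qed
    show "binomial_edge_ideal K G \<subseteq> I"
      if "ideal I (polyR (gvars G))" "\<And>a b. a \<in> verts G \<Longrightarrow> b \<in> verts G \<Longrightarrow> bin a b \<in> I" for I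
      using edge_verts[OF G] that by (intro J(3)) auto
  qed
  then show ?thesis by (rule that)
qed

text \<open>Modulo a prime \<open>P\<close> every nonzero element has annihilator \<open>P\<close>.\<close>

lemma unmixed_prime: assumes P: "primeideal P R" shows "unmixed R P"
proof -
  interpret P: primeideal P R by fact
  have "Q = P" if "Q \<in> associated_primes R P" for Q
  proof -
    obtain f where f: "f \<in> carrier R" "primeideal Q R" "Q = {r \<in> carrier R. r \<otimes>\<^bsub>R\<^esub> f \<in> P}"
      using \<open>Q \<in> associated_primes R P\<close> by (auto simp: associated_primes_def)
    have "f \<notin> P"
    proof
      assume "f \<in> P"
      then have "Q = carrier R" using f(3) P.I_l_closed by auto
      then show False using primeideal.I_notcarr[OF f(2)] by simp
    qed
    then show ?thesis using f P.I_prime P.I_r_closed P.a_subset by blast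
  qed
  then show ?thesis unfolding unmixed_def by metis
qed

lemma complete_cone: "complete_graph H \<Longrightarrow> complete_graph (cone v H)"
  by (auto simp: complete_graph_def cone_def insert_commute)

theorem theorem3p3:
  fixes K :: "'k::field itself"
    and H G :: "'a::linorder graph"
    and v :: 'a
  assumes "simple_graph H"
    and "connected_graph H"
    and "unmixed (edge_ring K (verts H)) (binomial_edge_ideal K H)"
    and "v \<notin> verts H"
    and "G = cone v H"
  shows "(complete_graph H \<longleftrightarrow>
            unmixed (edge_ring K (verts G)) (binomial_edge_ideal K G)) \<and>
         (complete_graph H \<longrightarrow>
            cohen_macaulay_ring (edge_ring K (verts G) Quot binomial_edge_ideal K G))"
proof (intro conjI iffI impI)
  assume "unmixed (edge_ring K (verts G)) (binomial_edge_ideal K G)"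
  then show "complete_graph H"
    using unmixed_cone_imp_complete[OF assms(1,2,4,3)] assms(5) by simp
next
  have G: "simple_graph G" "verts G \<noteq> {}" using simple_graph_cone assms by (auto simp: cone_def)
  assume "complete_graph H"
  then have c: "complete_graph G" using complete_cone assms(5) by simp
  obtain n g where "complete_binomial (verts G) (binomial_edge_ideal K G) n g"
    by (rule complete_binomial_graph[OF G(1) c G(2)])
  then interpret complete_binomial "verts G" "binomial_edge_ideal K G" n g .
  show "unmixed (edge_ring K (verts G)) (binomial_edge_ideal K G)"
    unfolding edge_ring_eq_polyR by (rule unmixed_prime[OF prime_J])
  have fin: "finite (gvars G)" using G(1) by (simp add: simple_graph_def)
  show "cohen_macaulay_ring (edge_ring K (verts G) Quot binomial_edge_ideal K G)"
    unfolding edge_ring_eq_polyR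
    by (rule cohen_macaulay_quot[OF cring_polyR noetherian_polyR[OF fin] J])
      (use regular_sequence_of_full_length in \<open>simp only: polyR_simps\<close>)
qed

end
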